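(* Let $R$ be a commutative noetherian local ring and let $M$ be a finitely generated $R$-module. Then $\min(M)\subseteq \bigcup_{i\ge 0}\operatorname{Ass}_R(\operatorname{Ext}^i_R(M,R))$.
   Context: $\min(M)$ denotes the set of minimal elements (with respect to inclusion) of $\operatorname{Supp}(M)$. *)

theory Defs
  imports "HOL-Algebra.Ring_Divisibility" "HOL-Algebra.Module"
begin

text \<open>
  Modules are the records of \<^theory>\<open>HOL-Algebra.Module\<close>.  Their ring multiplication and unit play no
  role in the locale \<^locale>\<open>module\<close>, and are left undefined in the constructions below.
\<close>

section \<open>Rings and modules\<close>

definition local_ring :: "('a, 'm) ring_scheme \<Rightarrow> bool"
  where "local_ring R \<longleftrightarrow> cring R \<and> (\<exists>!\<mm>. maximalideal \<mm> R)"

definition finitely_generated_module ::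
    "('a, 'm) ring_scheme \<Rightarrow> ('a, 'b, 'n) module_scheme \<Rightarrow> bool"
  where "finitely_generated_module R M \<longleftrightarrow>
    (\<exists>A. finite A \<and> A \<subseteq> carrier M \<and>
      carrier M = {\<Oplus>\<^bsub>M\<^esub>x\<in>A. c x \<odot>\<^bsub>M\<^esub> x | c. c \<in> A \<rightarrow> carrier R})"

definition regular_module :: "('a, 'm) ring_scheme \<Rightarrow> ('a, 'a) module"
  where "regular_module R =
    \<lparr>carrier = carrier R, monoid.mult = mult R, one = one R, zero = zero R, add = add R,
     smult = mult R\<rparr>"

text \<open>The direct sum of copies of \<open>R\<close> indexed by \<open>X\<close>.\<close>

definition free_module :: "('a, 'm) ring_scheme \<Rightarrow> 'i set \<Rightarrow> ('a, 'i \<Rightarrow> 'a) module"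
  where "free_module R X =
    \<lparr>carrier = {f. (\<forall>i. f i \<in> carrier R) \<and> finite {i. f i \<noteq> \<zero>\<^bsub>R\<^esub>} \<and> {i. f i \<noteq> \<zero>\<^bsub>R\<^esub>} \<subseteq> X},
     monoid.mult = undefined, one = undefined,
     zero = (\<lambda>i. \<zero>\<^bsub>R\<^esub>),
     add = (\<lambda>f g i. f i \<oplus>\<^bsub>R\<^esub> g i),
     smult = (\<lambda>r f i. r \<otimes>\<^bsub>R\<^esub> f i)\<rparr>"

definition mod_hom ::
    "('a, 'm) ring_scheme \<Rightarrow> ('a, 'b, 'n) module_scheme \<Rightarrow> ('a, 'c, 'k) module_scheme \<Rightarrow> ('b \<Rightarrow> 'c) set"
  where "mod_hom R M N =
    {h \<in> carrier M \<rightarrow> carrier N.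
      (\<forall>x\<in>carrier M. \<forall>y\<in>carrier M. h (x \<oplus>\<^bsub>M\<^esub> y) = h x \<oplus>\<^bsub>N\<^esub> h y) \<and>
      (\<forall>r\<in>carrier R. \<forall>x\<in>carrier M. h (r \<odot>\<^bsub>M\<^esub> x) = r \<odot>\<^bsub>N\<^esub> h x)}"

text \<open>\<open>Hom\<^sub>R(M, N)\<close>; maps are made extensional, so that they are determined by their values on the
  carrier of \<open>M\<close>.\<close>

definition Hom_module ::
    "('a, 'm) ring_scheme \<Rightarrow> ('a, 'b, 'n) module_scheme \<Rightarrow> ('a, 'c, 'k) module_scheme \<Rightarrow>
      ('a, 'b \<Rightarrow> 'c) module"
  where "Hom_module R M N =
    \<lparr>carrier = mod_hom R M N \<inter> extensional (carrier M),
     monoid.mult = undefined, one = undefined,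
     zero = (\<lambda>x\<in>carrier M. \<zero>\<^bsub>N\<^esub>),
     add = (\<lambda>f g. \<lambda>x\<in>carrier M. f x \<oplus>\<^bsub>N\<^esub> g x),
     smult = (\<lambda>r f. \<lambda>x\<in>carrier M. r \<odot>\<^bsub>N\<^esub> f x)\<rparr>"

definition quotient_module ::
    "('a, 'b, 'n) module_scheme \<Rightarrow> 'b set \<Rightarrow> ('a, 'b set) module"
  where "quotient_module M H =
    \<lparr>carrier = a_rcosets\<^bsub>M\<^esub> H,
     monoid.mult = undefined, one = undefined,
     zero = H,
     add = (\<lambda>A B. A <+>\<^bsub>M\<^esub> B),
     smult = (\<lambda>r A. H <+>\<^bsub>M\<^esub> ((\<lambda>x. r \<odot>\<^bsub>M\<^esub> x) ` A))\<rparr>"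


section \<open>Support and associated primes\<close>

text \<open>The fraction \<open>x/s\<close>, for \<open>s\<close> outside the prime \<open>\<pp>\<close>, is the class of the pair \<open>(x, s)\<close>.\<close>

definition frac_rel ::
    "('a, 'm) ring_scheme \<Rightarrow> ('a, 'b, 'n) module_scheme \<Rightarrow> 'a set \<Rightarrow> (('b \<times> 'a) \<times> ('b \<times> 'a)) set"
  where "frac_rel R M \<pp> =
    {((x, s), (y, t)) | x s y t.
      x \<in> carrier M \<and> y \<in> carrier M \<and> s \<in> carrier R - \<pp> \<and> t \<in> carrier R - \<pp> \<and>
      (\<exists>u \<in> carrier R - \<pp>. u \<odot>\<^bsub>M\<^esub> (t \<odot>\<^bsub>M\<^esub> x) = u \<odot>\<^bsub>M\<^esub> (s \<odot>\<^bsub>M\<^esub> y))}"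

text \<open>The localization \<open>M\<^sub>\<pp>\<close>, with its \<open>R\<close>-module structure.\<close>

definition localized_module ::
    "('a, 'm) ring_scheme \<Rightarrow> ('a, 'b, 'n) module_scheme \<Rightarrow> 'a set \<Rightarrow> ('a, ('b \<times> 'a) set) module"
  where "localized_module R M \<pp> =
    \<lparr>carrier = (carrier M \<times> (carrier R - \<pp>)) // frac_rel R M \<pp>,
     monoid.mult = undefined, one = undefined,
     zero = frac_rel R M \<pp> `` {(\<zero>\<^bsub>M\<^esub>, \<one>\<^bsub>R\<^esub>)},
     add = (\<lambda>A B. \<Union>(x, s)\<in>A. \<Union>(y, t)\<in>B.
       frac_rel R M \<pp> `` {(t \<odot>\<^bsub>M\<^esub> x \<oplus>\<^bsub>M\<^esub> s \<odot>\<^bsub>M\<^esub> y, s \<otimes>\<^bsub>R\<^esub> t)}),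
     smult = (\<lambda>r A. \<Union>(x, s)\<in>A. frac_rel R M \<pp> `` {(r \<odot>\<^bsub>M\<^esub> x, s)})\<rparr>"

definition Supp :: "('a, 'm) ring_scheme \<Rightarrow> ('a, 'b, 'n) module_scheme \<Rightarrow> 'a set set"
  where "Supp R M =
    {\<pp>. primeideal \<pp> R \<and> carrier (localized_module R M \<pp>) \<noteq> {\<zero>\<^bsub>localized_module R M \<pp>\<^esub>}}"

definition min_Supp :: "('a, 'm) ring_scheme \<Rightarrow> ('a, 'b, 'n) module_scheme \<Rightarrow> 'a set set"
  where "min_Supp R M = {\<pp> \<in> Supp R M. \<forall>\<qq>\<in>Supp R M. \<qq> \<subseteq> \<pp> \<longrightarrow> \<qq> = \<pp>}"

definition annihilator ::
    "('a, 'm) ring_scheme \<Rightarrow> ('a, 'b, 'n) module_scheme \<Rightarrow> 'b \<Rightarrow> 'a set"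
  where "annihilator R M x = {r \<in> carrier R. r \<odot>\<^bsub>M\<^esub> x = \<zero>\<^bsub>M\<^esub>}"

definition Ass :: "('a, 'm) ring_scheme \<Rightarrow> ('a, 'b, 'n) module_scheme \<Rightarrow> 'a set set"
  where "Ass R M = {\<pp>. primeideal \<pp> R \<and> (\<exists>x\<in>carrier M. \<pp> = annihilator R M x)}"


section \<open>Ext\<close>

text \<open>
  An exact sequence \<open>\<dots> \<rightarrow> F\<^sub>2 \<rightarrow> F\<^sub>1 \<rightarrow> F\<^sub>0 \<rightarrow> M \<rightarrow> 0\<close>, where \<open>F\<^sub>n\<close> is free on \<open>X n\<close>,
  the differential \<open>d n\<close> goes from \<open>F\<^sub>n\<^sub>+\<^sub>1\<close> to \<open>F\<^sub>n\<close>, and \<open>e\<close> is the augmentation.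
\<close>

definition free_resolution ::
    "('a, 'm) ring_scheme \<Rightarrow> ('a, 'b, 'n) module_scheme \<Rightarrow>
      (nat \<Rightarrow> 'i set) \<Rightarrow> (nat \<Rightarrow> ('i \<Rightarrow> 'a) \<Rightarrow> ('i \<Rightarrow> 'a)) \<Rightarrow> (('i \<Rightarrow> 'a) \<Rightarrow> 'b) \<Rightarrow> bool"
  where "free_resolution R M X d e \<longleftrightarrow>
    e \<in> mod_hom R (free_module R (X 0)) M \<and>
    e ` carrier (free_module R (X 0)) = carrier M \<and>
    (\<forall>n. d n \<in> mod_hom R (free_module R (X (Suc n))) (free_module R (X n))) \<and>
    d 0 ` carrier (free_module R (X 1)) =
      {f \<in> carrier (free_module R (X 0)). e f = \<zero>\<^bsub>M\<^esub>} \<and>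
    (\<forall>n. d (Suc n) ` carrier (free_module R (X (Suc (Suc n)))) =
      {f \<in> carrier (free_module R (X (Suc n))). d n f = \<zero>\<^bsub>free_module R (X n)\<^esub>})"

text \<open>The cohomology of the complex \<open>0 \<rightarrow> Hom(F\<^sub>0, N) \<rightarrow> Hom(F\<^sub>1, N) \<rightarrow> \<dots>\<close>, whose
  differentials are precomposition with the \<open>d n\<close>.\<close>

definition Hom_cocycles ::
    "('a, 'm) ring_scheme \<Rightarrow> (nat \<Rightarrow> 'i set) \<Rightarrow> (nat \<Rightarrow> ('i \<Rightarrow> 'a) \<Rightarrow> ('i \<Rightarrow> 'a)) \<Rightarrow>
      ('a, 'c, 'k) module_scheme \<Rightarrow> nat \<Rightarrow> (('i \<Rightarrow> 'a) \<Rightarrow> 'c) set"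
  where "Hom_cocycles R X d N i =
    {f \<in> carrier (Hom_module R (free_module R (X i)) N).
      compose (carrier (free_module R (X (Suc i)))) f (d i) =
        \<zero>\<^bsub>Hom_module R (free_module R (X (Suc i))) N\<^esub>}"

primrec Hom_coboundaries ::
    "('a, 'm) ring_scheme \<Rightarrow> (nat \<Rightarrow> 'i set) \<Rightarrow> (nat \<Rightarrow> ('i \<Rightarrow> 'a) \<Rightarrow> ('i \<Rightarrow> 'a)) \<Rightarrow>
      ('a, 'c, 'k) module_scheme \<Rightarrow> nat \<Rightarrow> (('i \<Rightarrow> 'a) \<Rightarrow> 'c) set"
  where
    "Hom_coboundaries R X d N 0 = {\<zero>\<^bsub>Hom_module R (free_module R (X 0)) N\<^esub>}"
  | "Hom_coboundaries R X d N (Suc j) =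
      (\<lambda>f. compose (carrier (free_module R (X (Suc j)))) f (d j)) `
        carrier (Hom_module R (free_module R (X j)) N)"

definition Hom_cohomology ::
    "('a, 'm) ring_scheme \<Rightarrow> (nat \<Rightarrow> 'i set) \<Rightarrow> (nat \<Rightarrow> ('i \<Rightarrow> 'a) \<Rightarrow> ('i \<Rightarrow> 'a)) \<Rightarrow>
      ('a, 'c, 'k) module_scheme \<Rightarrow> nat \<Rightarrow> ('a, (('i \<Rightarrow> 'a) \<Rightarrow> 'c) set) module"
  where "Hom_cohomology R X d N i =
    quotient_module
      ((Hom_module R (free_module R (X i)) N)\<lparr>carrier := Hom_cocycles R X d N i\<rparr>)
      (Hom_coboundaries R X d N i)"

text \<open>
  A type of basis elements large enough for every \<open>R\<close>-module \<open>M\<close> with \<open>R\<close> over \<open>'a\<close> and \<open>M\<close>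
  over \<open>'b\<close> to have a free resolution over it, see \<open>free_resolution_exists\<close> below: a basis of
  \<open>F\<^sub>0\<close> can be indexed by \<open>M\<close>, and a basis of \<open>F\<^sub>n\<^sub>+\<^sub>1\<close> by finite linear combinations
  of basis elements of \<open>F\<^sub>n\<close>.
\<close>

datatype ('a, 'b) syzygy = Generator 'b | Combination "(('a, 'b) syzygy \<times> 'a) list"

text \<open>\<open>Ext\<^sup>i\<^sub>R(M, N)\<close>, computed from a chosen free resolution of \<open>M\<close>; up to isomorphism it does not
  depend on that choice.\<close>

definition chosen_resolution ::
    "('a, 'm) ring_scheme \<Rightarrow> ('a, 'b, 'n) module_scheme \<Rightarrow>
      (nat \<Rightarrow> ('a, 'b) syzygy set) \<times>
      (nat \<Rightarrow> (('a, 'b) syzygy \<Rightarrow> 'a) \<Rightarrow> (('a, 'b) syzygy \<Rightarrow> 'a))"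
  where "chosen_resolution R M = (SOME (X, d). \<exists>e. free_resolution R M X d e)"

definition Ext ::
    "('a, 'm) ring_scheme \<Rightarrow> nat \<Rightarrow> ('a, 'b, 'n) module_scheme \<Rightarrow> ('a, 'c, 'k) module_scheme \<Rightarrow>
      ('a, ((('a, 'b) syzygy \<Rightarrow> 'a) \<Rightarrow> 'c) set) module"
  where "Ext R i M N =
    (case chosen_resolution R M of (X, d) \<Rightarrow> Hom_cohomology R X d N i)"



section \<open>Well-definedness\<close>

lemma free_module_simps:
  "f \<in> carrier (free_module R X) \<longleftrightarrow>
     (\<forall>i. f i \<in> carrier R) \<and> finite {i. f i \<noteq> \<zero>\<^bsub>R\<^esub>} \<and> {i. f i \<noteq> \<zero>\<^bsub>R\<^esub>} \<subseteq> X"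
  "\<zero>\<^bsub>free_module R X\<^esub> = (\<lambda>i. \<zero>\<^bsub>R\<^esub>)"
  "f \<oplus>\<^bsub>free_module R X\<^esub> g = (\<lambda>i. f i \<oplus>\<^bsub>R\<^esub> g i)"
  "r \<odot>\<^bsub>free_module R X\<^esub> f = (\<lambda>i. r \<otimes>\<^bsub>R\<^esub> f i)"
  by (auto simp: free_module_def)

lemma free_module_is_module:
  assumes "cring R"
  shows "Module.module R (free_module R X)"
proof -
  interpret cring R by fact
  have add: "f \<oplus>\<^bsub>free_module R X\<^esub> g \<in> carrier (free_module R X)"
    if "f \<in> carrier (free_module R X)" "g \<in> carrier (free_module R X)" for f g
  proof -
    have sub: "{i. f i \<oplus>\<^bsub>R\<^esub> g i \<noteq> \<zero>\<^bsub>R\<^esub>} \<subseteq> {i. f i \<noteq> \<zero>\<^bsub>R\<^esub>} \<union> {i. g i \<noteq> \<zero>\<^bsub>R\<^esub>}"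
      by auto
    then show ?thesis
      using that finite_subset[OF sub] sub unfolding free_module_simps by auto
  qed
  have smult: "r \<odot>\<^bsub>free_module R X\<^esub> f \<in> carrier (free_module R X)"
    if "r \<in> carrier R" "f \<in> carrier (free_module R X)" for r f
  proof -
    have sub: "{i. r \<otimes>\<^bsub>R\<^esub> f i \<noteq> \<zero>\<^bsub>R\<^esub>} \<subseteq> {i. f i \<noteq> \<zero>\<^bsub>R\<^esub>}"
      using that by auto
    then show ?thesis
      using that finite_subset[OF sub] sub unfolding free_module_simps by auto
  qed
  have inv: "\<exists>g\<in>carrier (free_module R X). g \<oplus>\<^bsub>free_module R X\<^esub> f = \<zero>\<^bsub>free_module R X\<^esub>"
    if "f \<in> carrier (free_module R X)" for f
    by (rule bexI[of _ "(\<ominus>\<^bsub>R\<^esub> \<one>\<^bsub>R\<^esub>) \<odot>\<^bsub>free_module R X\<^esub> f"])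
       (use that smult in \<open>auto simp: free_module_simps l_minus l_neg\<close>)
  have ag: "abelian_group (free_module R X)"
    by (rule abelian_groupI, erule (1) add)
       (use inv in \<open>auto simp: free_module_simps(2-3) free_module_simps(1) a_ac\<close>)
  show ?thesis
    by (rule moduleI[OF \<open>cring R\<close> ag])
       (use smult in \<open>auto simp: free_module_simps l_distr r_distr m_assoc intro!: ext\<close>)
qed

text \<open>The linear extension of a map given on the basis.\<close>

definition free_lift ::
    "('a, 'm) ring_scheme \<Rightarrow> ('a, 'b, 'n) module_scheme \<Rightarrow> ('i \<Rightarrow> 'b) \<Rightarrow> ('i \<Rightarrow> 'a) \<Rightarrow> 'b"
  where "free_lift R N g f = (\<Oplus>\<^bsub>N\<^esub>i\<in>{i. f i \<noteq> \<zero>\<^bsub>R\<^esub>}. f i \<odot>\<^bsub>N\<^esub> g i)"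

lemma free_lift_superset:
  assumes "Module.module R N" and g: "g \<in> X \<rightarrow> carrier N"
    and f: "f \<in> carrier (free_module R X)"
    and S: "finite S" "{i. f i \<noteq> \<zero>\<^bsub>R\<^esub>} \<subseteq> S" "S \<subseteq> X"
  shows "free_lift R N g f = (\<Oplus>\<^bsub>N\<^esub>i\<in>S. f i \<odot>\<^bsub>N\<^esub> g i)"
proof -
  interpret Module.module R N by fact
  show ?thesis
    unfolding free_lift_def using S g f
    by (intro add.finprod_mono_neutral_cong) (auto simp: free_module_simps Pi_def subset_iff)
qed

lemma free_lift_hom:
  assumes "Module.module R N" and g: "g \<in> X \<rightarrow> carrier N"
  shows "free_lift R N g \<in> mod_hom R (free_module R X) N"
proof -
  interpret Module.module R N by fact
  interpret F: Module.module R "free_module R X"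
    by (rule free_module_is_module) (rule R.is_cring)
  have gc: "g i \<in> carrier N" if "i \<in> X" for i using g that by auto
  have closed: "free_lift R N g f \<in> carrier N" if "f \<in> carrier (free_module R X)" for f
    unfolding free_lift_def using that gc
    by (intro finsum_closed) (auto simp: free_module_simps)
  have add: "free_lift R N g (f \<oplus>\<^bsub>free_module R X\<^esub> h) = free_lift R N g f \<oplus>\<^bsub>N\<^esub> free_lift R N g h"
    if f: "f \<in> carrier (free_module R X)" and h: "h \<in> carrier (free_module R X)" for f h
  proof -
    define S where "S = {i. f i \<noteq> \<zero>\<^bsub>R\<^esub>} \<union> {i. h i \<noteq> \<zero>\<^bsub>R\<^esub>}"
    have S: "finite S" "S \<subseteq> X" using f h by (auto simp: S_def free_module_simps)
    have "free_lift R N g (f \<oplus>\<^bsub>free_module R X\<^esub> h) =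
        (\<Oplus>\<^bsub>N\<^esub>i\<in>S. (f \<oplus>\<^bsub>free_module R X\<^esub> h) i \<odot>\<^bsub>N\<^esub> g i)"
      using F.add.m_closed[OF f h] f h S
      by (intro free_lift_superset[OF assms]) (auto simp: S_def free_module_simps)
    also have "\<dots> = (\<Oplus>\<^bsub>N\<^esub>i\<in>S. f i \<odot>\<^bsub>N\<^esub> g i \<oplus>\<^bsub>N\<^esub> h i \<odot>\<^bsub>N\<^esub> g i)"
      using f h S gc by (intro finsum_cong') (auto simp: free_module_simps smult_l_distr subset_iff)
    also have "\<dots> = (\<Oplus>\<^bsub>N\<^esub>i\<in>S. f i \<odot>\<^bsub>N\<^esub> g i) \<oplus>\<^bsub>N\<^esub> (\<Oplus>\<^bsub>N\<^esub>i\<in>S. h i \<odot>\<^bsub>N\<^esub> g i)"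
      using f h S gc by (intro finsum_addf) (auto simp: free_module_simps subset_iff)
    also have "(\<Oplus>\<^bsub>N\<^esub>i\<in>S. f i \<odot>\<^bsub>N\<^esub> g i) = free_lift R N g f"
      using f S by (intro free_lift_superset[OF assms, symmetric]) (auto simp: S_def)
    also have "(\<Oplus>\<^bsub>N\<^esub>i\<in>S. h i \<odot>\<^bsub>N\<^esub> g i) = free_lift R N g h"
      using h S by (intro free_lift_superset[OF assms, symmetric]) (auto simp: S_def)
    finally show ?thesis .
  qed
  have smult: "free_lift R N g (r \<odot>\<^bsub>free_module R X\<^esub> f) = r \<odot>\<^bsub>N\<^esub> free_lift R N g f"
    if r: "r \<in> carrier R" and f: "f \<in> carrier (free_module R X)" for r f
  proof -
    define S where "S = {i. f i \<noteq> \<zero>\<^bsub>R\<^esub>}"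
    have S: "finite S" "S \<subseteq> X" using f by (auto simp: S_def free_module_simps)
    have "free_lift R N g (r \<odot>\<^bsub>free_module R X\<^esub> f) =
        (\<Oplus>\<^bsub>N\<^esub>i\<in>S. (r \<odot>\<^bsub>free_module R X\<^esub> f) i \<odot>\<^bsub>N\<^esub> g i)"
      using r f S F.smult_closed[OF r f]
      by (intro free_lift_superset[OF assms]) (auto simp: S_def free_module_simps)
    also have "\<dots> = (\<Oplus>\<^bsub>N\<^esub>i\<in>S. r \<odot>\<^bsub>N\<^esub> (f i \<odot>\<^bsub>N\<^esub> g i))"
      using r f S gc by (intro finsum_cong') (auto simp: free_module_simps smult_assoc1 subset_iff)
    also have "\<dots> = r \<odot>\<^bsub>N\<^esub> (\<Oplus>\<^bsub>N\<^esub>i\<in>S. f i \<odot>\<^bsub>N\<^esub> g i)"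
      using r f S gc
      by (intro finsum_smult_ldistr[symmetric]) (auto simp: free_module_simps subset_iff)
    finally show ?thesis by (simp add: free_lift_def S_def)
  qed
  show ?thesis
    unfolding mod_hom_def using closed add smult by auto
qed

lemma free_lift_image:
  assumes "Module.module R N" and g: "g ` X = H" and H: "submodule H R N"
  shows "free_lift R N g ` carrier (free_module R X) = H"
proof -
  interpret Module.module R N by fact
  note subE = submoduleE[OF H]
  have z: "\<zero>\<^bsub>N\<^esub> \<in> H"
    using submodule.axioms(1)[OF H] subgroup.one_closed by fastforce
  have g': "g \<in> X \<rightarrow> carrier N" using g subE(1) by auto
  show ?thesis
  proof (intro equalityI subsetI)
    fix y assume "y \<in> free_lift R N g ` carrier (free_module R X)"
    then obtain f where f: "f \<in> carrier (free_module R X)" and y: "y = free_lift R N g f"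
      by auto
    have "S \<subseteq> X \<Longrightarrow> (\<Oplus>\<^bsub>N\<^esub>i\<in>S. f i \<odot>\<^bsub>N\<^esub> g i) \<in> H" if "finite S" for S
      using that
    proof (induction S rule: finite_induct)
      case empty
      then show ?case using z by simp
    next
      case (insert i S)
      have "(\<Oplus>\<^bsub>N\<^esub>i\<in>insert i S. f i \<odot>\<^bsub>N\<^esub> g i) = f i \<odot>\<^bsub>N\<^esub> g i \<oplus>\<^bsub>N\<^esub> (\<Oplus>\<^bsub>N\<^esub>i\<in>S. f i \<odot>\<^bsub>N\<^esub> g i)"
        using insert f g' by (intro finsum_insert) (auto simp: free_module_simps subset_iff Pi_def)
      then show ?case using insert subE f g by (auto simp: free_module_simps)
    qed
    then show "y \<in> H" using f by (auto simp: y free_lift_def free_module_simps)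
  next
    fix y assume y: "y \<in> H"
    then obtain x where x: "x \<in> X" "y = g x" using g by auto
    define f where "f = (\<lambda>i. if i = x then \<one>\<^bsub>R\<^esub> else \<zero>\<^bsub>R\<^esub>)"
    have fin: "{i. f i \<noteq> \<zero>\<^bsub>R\<^esub>} \<subseteq> {x}" by (auto simp: f_def)
    have f: "f \<in> carrier (free_module R X)"
      using x finite_subset[OF fin] fin by (auto simp: free_module_simps f_def)
    have "free_lift R N g f = (\<Oplus>\<^bsub>N\<^esub>i\<in>{x}. f i \<odot>\<^bsub>N\<^esub> g i)"
      using x fin by (intro free_lift_superset[OF assms(1) g' f]) auto
    also have "\<dots> = y" using x g' by (simp add: f_def Pi_def)
    finally show "y \<in> free_lift R N g ` carrier (free_module R X)" using f by blast
  qed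
qed

lemma mod_hom_kernel_submodule:
  assumes "Module.module R M" and "Module.module R N" and h: "h \<in> mod_hom R M N"
  shows "submodule {x \<in> carrier M. h x = \<zero>\<^bsub>N\<^esub>} R M"
proof -
  interpret M: Module.module R M by fact
  interpret N: Module.module R N by fact
  have hc: "h x \<in> carrier N" if "x \<in> carrier M" for x using h that by (auto simp: mod_hom_def)
  have hs: "h (r \<odot>\<^bsub>M\<^esub> x) = r \<odot>\<^bsub>N\<^esub> h x" if "r \<in> carrier R" "x \<in> carrier M" for r x
    using h that by (auto simp: mod_hom_def)
  have ha: "h (x \<oplus>\<^bsub>M\<^esub> y) = h x \<oplus>\<^bsub>N\<^esub> h y" if "x \<in> carrier M" "y \<in> carrier M" for x y
    using h that by (auto simp: mod_hom_def)
  have h0: "h \<zero>\<^bsub>M\<^esub> = \<zero>\<^bsub>N\<^esub>"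
    using hs[of "\<zero>\<^bsub>R\<^esub>" "\<zero>\<^bsub>M\<^esub>"] hc by simp
  have hm: "h (\<ominus>\<^bsub>M\<^esub> x) = \<zero>\<^bsub>N\<^esub>" if "x \<in> carrier M" "h x = \<zero>\<^bsub>N\<^esub>" for x
    using ha[of x "\<ominus>\<^bsub>M\<^esub> x"] that h0 hc by (simp add: M.r_neg)
  show ?thesis
    by (rule M.submoduleI) (auto simp: ha hs h0 hm)
qed

lemma syzygy_code_exists:
  "\<exists>code :: (('a, 'b) syzygy \<Rightarrow> 'a) \<Rightarrow> ('a, 'b) syzygy. inj_on code {f. finite {i. f i \<noteq> z}}"
proof -
  define L where "L f = (SOME l. set l = {(i, f i) | i. f i \<noteq> z})"
    for f :: "('a, 'b) syzygy \<Rightarrow> 'a"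
  have L: "set (L f) = {(i, f i) | i. f i \<noteq> z}" if "finite {i. f i \<noteq> z}" for f
    unfolding L_def by (rule someI_ex, rule finite_list) (use that in simp)
  have "inj_on (\<lambda>f. Combination (L f)) {f. finite {i. f i \<noteq> z}}"
  proof (rule inj_onI)
    fix f g :: "('a, 'b) syzygy \<Rightarrow> 'a"
    assume *: "f \<in> {f. finite {i. f i \<noteq> z}}" "g \<in> {f. finite {i. f i \<noteq> z}}"
      "Combination (L f) = Combination (L g)"
    then have eq: "{(i, f i) | i. f i \<noteq> z} = {(i, g i) | i. g i \<noteq> z}"
      using L[of f] L[of g] by simp
    show "f = g"
    proof
      fix i show "f i = g i"
        using eq[unfolded set_eq_iff, rule_format, of "(i, f i)"]
          eq[unfolded set_eq_iff, rule_format, of "(i, g i)"] by auto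
    qed
  qed
  then show ?thesis by blast
qed

lemma free_resolution_exists:
  fixes R :: "('a, 'm) ring_scheme" and M :: "('a, 'b, 'n) module_scheme"
  assumes M: "Module.module R M"
  shows "\<exists>(X :: nat \<Rightarrow> ('a, 'b) syzygy set) d e. free_resolution R M X d e"
proof -
  interpret M: Module.module R M by fact
  note F = free_module_is_module[OF M.R.is_cring]
  obtain code :: "(('a, 'b) syzygy \<Rightarrow> 'a) \<Rightarrow> ('a, 'b) syzygy"
    where code: "inj_on code {f. finite {i. f i \<noteq> \<zero>\<^bsub>R\<^esub>}}"
    by (rule exE[OF syzygy_code_exists])
  define dec where "dec = inv_into {f. finite {i. f i \<noteq> \<zero>\<^bsub>R\<^esub>}} code"
  have dec: "dec (code f) = f" if "f \<in> carrier (free_module R Y)" for f Y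
    using that unfolding dec_def by (intro inv_into_f_f[OF code]) (auto simp: free_module_simps)
  define g0 where "g0 = (\<lambda>s :: ('a, 'b) syzygy. case s of Generator x \<Rightarrow> x | _ \<Rightarrow> \<zero>\<^bsub>M\<^esub>)"
  define X0 :: "('a, 'b) syzygy set" where "X0 = Generator ` carrier M"
  define e where "e = free_lift R M g0"
  define step where "step = (\<lambda>(X, K).
    (code ` K, {f \<in> carrier (free_module R (code ` K)).
       free_lift R (free_module R X) dec f = \<zero>\<^bsub>free_module R X\<^esub>}))"
  define XK where "XK = rec_nat (X0, {f \<in> carrier (free_module R X0). e f = \<zero>\<^bsub>M\<^esub>}) (\<lambda>_. step)"
  define X where "X n = fst (XK n)" for n
  define K where "K n = snd (XK n)" for n
  define d where "d n = free_lift R (free_module R (X n)) dec" for n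
  have X_0: "X 0 = X0" and K_0: "K 0 = {f \<in> carrier (free_module R (X 0)). e f = \<zero>\<^bsub>M\<^esub>}"
    by (auto simp: X_def K_def XK_def)
  have X_Suc: "X (Suc n) = code ` K n" for n
    by (simp add: X_def K_def XK_def step_def case_prod_beta)
  have K_Suc: "K (Suc n) =
      {f \<in> carrier (free_module R (X (Suc n))). d n f = \<zero>\<^bsub>free_module R (X n)\<^esub>}" for n
    by (simp add: d_def X_Suc) (simp add: X_def K_def XK_def step_def case_prod_beta)
  have g0: "g0 ` X 0 = carrier M"
    by (auto simp: X_0 X0_def g0_def image_image)
  have e_hom: "e \<in> mod_hom R (free_module R (X 0)) M"
    unfolding e_def using g0 by (intro free_lift_hom[OF M]) auto
  have e_im: "e ` carrier (free_module R (X 0)) = carrier M"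
    unfolding e_def by (rule free_lift_image[OF M g0 M.carrier_is_submodule])
  have K_dec: "dec ` X (Suc n) = K n" if "submodule (K n) R (free_module R (X n))" for n
    using dec[of _ "X n"] Module.module.submoduleE(1)[OF F that]
    by (force simp: X_Suc image_image)
  have d_hom': "d n \<in> mod_hom R (free_module R (X (Suc n))) (free_module R (X n))"
    if "submodule (K n) R (free_module R (X n))" for n
    unfolding d_def using K_dec[OF that] Module.module.submoduleE(1)[OF F that]
    by (intro free_lift_hom[OF F]) blast
  have K_sub: "submodule (K n) R (free_module R (X n))" for n
  proof (induction n)
    case 0
    show ?case unfolding K_0 by (rule mod_hom_kernel_submodule[OF F M e_hom])
  next
    case (Suc n)
    show ?case unfolding K_Suc by (rule mod_hom_kernel_submodule[OF F F d_hom'[OF Suc]])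
  qed
  have d_im: "d n ` carrier (free_module R (X (Suc n))) = K n" for n
    unfolding d_def by (rule free_lift_image[OF F K_dec[OF K_sub] K_sub])
  have "free_resolution R M X d e"
    unfolding free_resolution_def
    using e_hom e_im d_hom'[OF K_sub] d_im K_0 K_Suc by auto
  then show ?thesis by blast
qed

lemma chosen_resolution:
  assumes "Module.module R M" and "chosen_resolution R M = (X, d)"
  shows "\<exists>e. free_resolution R M X d e"
proof -
  have "\<exists>p. case p of (X, d) \<Rightarrow>
      \<exists>e. free_resolution R M (X :: nat \<Rightarrow> ('a, 'c) syzygy set) d e"
    using free_resolution_exists[OF assms(1)] by simp
  from someI_ex[OF this] show ?thesis
    using assms(2) unfolding chosen_resolution_def by simp
qed

lemma Hom_module_simps:
  "h \<in> carrier (Hom_module R M N) \<longleftrightarrow> h \<in> mod_hom R M N \<and> h \<in> extensional (carrier M)"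
  "\<zero>\<^bsub>Hom_module R M N\<^esub> = (\<lambda>x\<in>carrier M. \<zero>\<^bsub>N\<^esub>)"
  "f \<oplus>\<^bsub>Hom_module R M N\<^esub> g = (\<lambda>x\<in>carrier M. f x \<oplus>\<^bsub>N\<^esub> g x)"
  "r \<odot>\<^bsub>Hom_module R M N\<^esub> f = (\<lambda>x\<in>carrier M. r \<odot>\<^bsub>N\<^esub> f x)"
  by (auto simp: Hom_module_def)

lemma mod_homD:
  assumes "h \<in> mod_hom R M N"
  shows "x \<in> carrier M \<Longrightarrow> h x \<in> carrier N"
    and "x \<in> carrier M \<Longrightarrow> y \<in> carrier M \<Longrightarrow> h (x \<oplus>\<^bsub>M\<^esub> y) = h x \<oplus>\<^bsub>N\<^esub> h y"
    and "r \<in> carrier R \<Longrightarrow> x \<in> carrier M \<Longrightarrow> h (r \<odot>\<^bsub>M\<^esub> x) = r \<odot>\<^bsub>N\<^esub> h x"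
  using assms by (auto simp: mod_hom_def)

lemma Hom_module_is_module:
  assumes "Module.module R M" and "Module.module R N"
  shows "Module.module R (Hom_module R M N)"
proof -
  interpret M: Module.module R M by fact
  interpret N: Module.module R N by fact
  have add: "f \<oplus>\<^bsub>Hom_module R M N\<^esub> g \<in> carrier (Hom_module R M N)"
    if "f \<in> carrier (Hom_module R M N)" "g \<in> carrier (Hom_module R M N)" for f g
    using that
    by (auto simp: Hom_module_simps mod_hom_def Pi_def N.a_ac N.smult_r_distr)
  have smult: "r \<odot>\<^bsub>Hom_module R M N\<^esub> f \<in> carrier (Hom_module R M N)"
    if "r \<in> carrier R" "f \<in> carrier (Hom_module R M N)" for r f
    using that
    by (auto simp: Hom_module_simps mod_hom_def Pi_def N.smult_r_distr
          N.smult_assoc1[symmetric] M.m_comm)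
  have zero: "\<zero>\<^bsub>Hom_module R M N\<^esub> \<in> carrier (Hom_module R M N)"
    by (auto simp: Hom_module_simps mod_hom_def)
  have val: "f x \<in> carrier N" if "f \<in> carrier (Hom_module R M N)" "x \<in> carrier M" for f x
    using that by (auto simp: Hom_module_simps mod_hom_def)
  have eqI: "f = g" if "f \<in> carrier (Hom_module R M N)" "g \<in> carrier (Hom_module R M N)"
    "\<And>x. x \<in> carrier M \<Longrightarrow> f x = g x" for f g
    using that by (auto simp: Hom_module_simps intro: extensionalityI)
  have inv: "\<exists>g\<in>carrier (Hom_module R M N). g \<oplus>\<^bsub>Hom_module R M N\<^esub> f = \<zero>\<^bsub>Hom_module R M N\<^esub>"
    if f: "f \<in> carrier (Hom_module R M N)" for f
  proof (rule bexI)
    show c: "(\<ominus>\<^bsub>R\<^esub> \<one>\<^bsub>R\<^esub>) \<odot>\<^bsub>Hom_module R M N\<^esub> f \<in> carrier (Hom_module R M N)"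
      using f by (intro smult) auto
    show "(\<ominus>\<^bsub>R\<^esub> \<one>\<^bsub>R\<^esub>) \<odot>\<^bsub>Hom_module R M N\<^esub> f \<oplus>\<^bsub>Hom_module R M N\<^esub> f = \<zero>\<^bsub>Hom_module R M N\<^esub>"
      using val[OF f] c f
      by (intro eqI add zero)
         (auto simp: Hom_module_simps(2-4) N.smult_l_minus N.l_neg)
  qed
  have ag: "abelian_group (Hom_module R M N)"
  proof (rule abelian_groupI)
    fix f g h assume c: "f \<in> carrier (Hom_module R M N)" "g \<in> carrier (Hom_module R M N)"
      "h \<in> carrier (Hom_module R M N)"
    show "f \<oplus>\<^bsub>Hom_module R M N\<^esub> g \<oplus>\<^bsub>Hom_module R M N\<^esub> h =
        f \<oplus>\<^bsub>Hom_module R M N\<^esub> (g \<oplus>\<^bsub>Hom_module R M N\<^esub> h)"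
      using c val[OF c(1)] val[OF c(2)] val[OF c(3)]
      by (intro eqI add) (auto simp: Hom_module_simps(2-4) N.a_assoc)
  next
    fix f g assume c: "f \<in> carrier (Hom_module R M N)" "g \<in> carrier (Hom_module R M N)"
    show "f \<oplus>\<^bsub>Hom_module R M N\<^esub> g = g \<oplus>\<^bsub>Hom_module R M N\<^esub> f"
      using c val[OF c(1)] val[OF c(2)]
      by (intro eqI add) (auto simp: Hom_module_simps(2-4) N.a_comm)
  next
    fix f assume c: "f \<in> carrier (Hom_module R M N)"
    show "\<zero>\<^bsub>Hom_module R M N\<^esub> \<oplus>\<^bsub>Hom_module R M N\<^esub> f = f"
      using c val[OF c] by (intro eqI add zero) (auto simp: Hom_module_simps(2-4))
  qed (use add zero inv in auto)
  show ?thesis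
  proof (rule moduleI[OF M.R.is_cring ag])
    fix r s f g assume r: "r \<in> carrier R" and s: "s \<in> carrier R"
      and f: "f \<in> carrier (Hom_module R M N)" and g: "g \<in> carrier (Hom_module R M N)"
    show "r \<odot>\<^bsub>Hom_module R M N\<^esub> f \<in> carrier (Hom_module R M N)" using r f by (rule smult)
    show "(r \<oplus>\<^bsub>R\<^esub> s) \<odot>\<^bsub>Hom_module R M N\<^esub> f =
        r \<odot>\<^bsub>Hom_module R M N\<^esub> f \<oplus>\<^bsub>Hom_module R M N\<^esub> s \<odot>\<^bsub>Hom_module R M N\<^esub> f"
      using r s f val[OF f]
      by (intro eqI add smult) (auto simp: Hom_module_simps(2-4) N.smult_l_distr)
    show "r \<odot>\<^bsub>Hom_module R M N\<^esub> (f \<oplus>\<^bsub>Hom_module R M N\<^esub> g) =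
        r \<odot>\<^bsub>Hom_module R M N\<^esub> f \<oplus>\<^bsub>Hom_module R M N\<^esub> r \<odot>\<^bsub>Hom_module R M N\<^esub> g"
      using r f g val[OF f] val[OF g]
      by (intro eqI add smult) (auto simp: Hom_module_simps(2-4) N.smult_r_distr)
    show "(r \<otimes>\<^bsub>R\<^esub> s) \<odot>\<^bsub>Hom_module R M N\<^esub> f =
        r \<odot>\<^bsub>Hom_module R M N\<^esub> (s \<odot>\<^bsub>Hom_module R M N\<^esub> f)"
      using r s f val[OF f]
      by (intro eqI add smult) (auto simp: Hom_module_simps(2-4) N.smult_assoc1)
  next
    fix f assume f: "f \<in> carrier (Hom_module R M N)"
    show "\<one>\<^bsub>R\<^esub> \<odot>\<^bsub>Hom_module R M N\<^esub> f = f"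
      using f val[OF f] by (intro eqI smult) (auto simp: Hom_module_simps(2-4))
  qed
qed

lemma compose_mod_hom:
  assumes "Module.module R L" and "d \<in> mod_hom R L M"
  shows "(\<lambda>f. compose (carrier L) f d) \<in> mod_hom R (Hom_module R M N) (Hom_module R L N)"
proof -
  interpret Module.module R L by fact
  note d = mod_homD[OF assms(2)]
  have "compose (carrier L) f d \<in> carrier (Hom_module R L N)"
    if "f \<in> carrier (Hom_module R M N)" for f
    using that d by (auto simp: Hom_module_simps mod_hom_def compose_def Pi_def)
  then show ?thesis
    using d by (auto simp: mod_hom_def[of R "Hom_module R M N"] Hom_module_simps(2-4) compose_def
        fun_eq_iff)
qed

lemma mod_hom_image_submodule:
  assumes "Module.module R M" and "Module.module R N" and h: "h \<in> mod_hom R M N"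
  shows "submodule (h ` carrier M) R N"
proof -
  interpret M: Module.module R M by fact
  interpret N: Module.module R N by fact
  note h = mod_homD[OF h]
  have h0: "h \<zero>\<^bsub>M\<^esub> = \<zero>\<^bsub>N\<^esub>"
    using h(3)[of "\<zero>\<^bsub>R\<^esub>" "\<zero>\<^bsub>M\<^esub>"] h(1) by simp
  have hm: "\<ominus>\<^bsub>N\<^esub> h x = h (\<ominus>\<^bsub>M\<^esub> x)" if x: "x \<in> carrier M" for x
    using h(2)[of "\<ominus>\<^bsub>M\<^esub> x" x] x h0 h(1) by (simp add: M.l_neg N.minus_equality)
  show ?thesis
  proof (rule N.submoduleI)
    show "\<zero>\<^bsub>N\<^esub> \<in> h ` carrier M" using h0 by (metis M.zero_closed image_eqI)
  qed (auto simp: h(1) hm h(2,3)[symmetric])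
qed

lemma submodule_restrict:
  assumes "Module.module R M" and "submodule A R M" and "submodule B R M" and "B \<subseteq> A"
  shows "submodule B R (M\<lparr>carrier := A\<rparr>)"
proof -
  have "Module.module R (M\<lparr>carrier := A\<rparr>)" "Module.module R (M\<lparr>carrier := B\<rparr>)"
    using assms submodule.submodule_is_module by blast+
  then show ?thesis
    using assms(4) by (intro Module.module.module_incl_imp_submodule) auto
qed

lemma quotient_module_is_module:
  assumes "Module.module R M" and "submodule H R M"
  shows "Module.module R (quotient_module M H)"
proof -
  interpret Module.module R M by fact
  note sub = submoduleE[OF assms(2)]
  interpret H: abelian_subgroup H M
    using submodule.axioms(1)[OF assms(2)]
    by (intro abelian_subgroupI3 additive_subgroup.intro) (auto intro: abelian_group_axioms)
  let ?Q = "quotient_module M H"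
  have carr: "carrier ?Q = {H +>\<^bsub>M\<^esub> x | x. x \<in> carrier M}"
    by (auto simp: quotient_module_def A_RCOSETS_def')
  have add: "(H +>\<^bsub>M\<^esub> x) \<oplus>\<^bsub>?Q\<^esub> (H +>\<^bsub>M\<^esub> y) = H +>\<^bsub>M\<^esub> (x \<oplus>\<^bsub>M\<^esub> y)"
    if "x \<in> carrier M" "y \<in> carrier M" for x y
    using H.a_rcos_sum[OF that] by (simp add: quotient_module_def)
  have zero: "\<zero>\<^bsub>?Q\<^esub> = H +>\<^bsub>M\<^esub> \<zero>\<^bsub>M\<^esub>"
    using sub(1) by (simp add: quotient_module_def)
  have smult: "r \<odot>\<^bsub>?Q\<^esub> (H +>\<^bsub>M\<^esub> x) = H +>\<^bsub>M\<^esub> (r \<odot>\<^bsub>M\<^esub> x)"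
    if r: "r \<in> carrier R" and x: "x \<in> carrier M" for r x
  proof -
    have Hc: "h \<in> carrier M" if "h \<in> H" for h using sub(1) that by blast
    have "r \<odot>\<^bsub>?Q\<^esub> (H +>\<^bsub>M\<^esub> x) = {h \<oplus>\<^bsub>M\<^esub> r \<odot>\<^bsub>M\<^esub> (k \<oplus>\<^bsub>M\<^esub> x) | h k. h \<in> H \<and> k \<in> H}"
      by (auto simp: quotient_module_def set_add_def' a_r_coset_def')
    also have "\<dots> = {h \<oplus>\<^bsub>M\<^esub> r \<odot>\<^bsub>M\<^esub> x | h. h \<in> H}"
    proof (intro equalityI subsetI)
      fix y assume "y \<in> {h \<oplus>\<^bsub>M\<^esub> r \<odot>\<^bsub>M\<^esub> (k \<oplus>\<^bsub>M\<^esub> x) | h k. h \<in> H \<and> k \<in> H}"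
      then obtain h k where hk: "h \<in> H" "k \<in> H" "y = h \<oplus>\<^bsub>M\<^esub> r \<odot>\<^bsub>M\<^esub> (k \<oplus>\<^bsub>M\<^esub> x)" by auto
      then have "y = (h \<oplus>\<^bsub>M\<^esub> r \<odot>\<^bsub>M\<^esub> k) \<oplus>\<^bsub>M\<^esub> r \<odot>\<^bsub>M\<^esub> x"
        using r x Hc by (simp add: smult_r_distr a_assoc)
      then show "y \<in> {h \<oplus>\<^bsub>M\<^esub> r \<odot>\<^bsub>M\<^esub> x | h. h \<in> H}" using hk r sub(4,5) by blast
    next
      fix y assume "y \<in> {h \<oplus>\<^bsub>M\<^esub> r \<odot>\<^bsub>M\<^esub> x | h. h \<in> H}"
      then obtain h where "h \<in> H" "y = h \<oplus>\<^bsub>M\<^esub> r \<odot>\<^bsub>M\<^esub> (\<zero>\<^bsub>M\<^esub> \<oplus>\<^bsub>M\<^esub> x)" using x by auto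
      then show "y \<in> {h \<oplus>\<^bsub>M\<^esub> r \<odot>\<^bsub>M\<^esub> (k \<oplus>\<^bsub>M\<^esub> x) | h k. h \<in> H \<and> k \<in> H}"
        using H.zero_closed by blast
    qed
    also have "\<dots> = H +>\<^bsub>M\<^esub> (r \<odot>\<^bsub>M\<^esub> x)" by (auto simp: a_r_coset_def')
    finally show ?thesis .
  qed
  have ag: "abelian_group ?Q"
  proof (rule abelian_groupI)
    fix A assume "A \<in> carrier ?Q"
    then obtain x where x: "x \<in> carrier M" "A = H +>\<^bsub>M\<^esub> x" by (auto simp: carr)
    show "\<exists>B\<in>carrier ?Q. B \<oplus>\<^bsub>?Q\<^esub> A = \<zero>\<^bsub>?Q\<^esub>"
      by (rule bexI[of _ "H +>\<^bsub>M\<^esub> (\<ominus>\<^bsub>M\<^esub> x)"]) (use x in \<open>auto simp: carr add zero l_neg\<close>)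
  qed (auto simp: carr add zero a_ac)
  show ?thesis
    by (rule moduleI[OF R.is_cring ag])
       (auto simp: carr add smult smult_l_distr smult_r_distr smult_assoc1)
qed

lemma regular_module_is_module:
  assumes "cring R" shows "Module.module R (regular_module R)"
proof -
  interpret cring R by fact
  have "abelian_group (regular_module R)"
    by (rule abelian_groupI)
       (auto simp: regular_module_def a_ac intro: bexI[of _ "\<ominus>\<^bsub>R\<^esub> _"] l_neg)
  then show ?thesis
    by (intro moduleI assms) (auto simp: regular_module_def l_distr r_distr m_assoc)
qed

lemma Hom_cohomology_is_module:
  fixes R :: "('a, 'm) ring_scheme" and X :: "nat \<Rightarrow> 'i set"
    and N :: "('a, 'c, 'k) module_scheme"
  assumes M: "Module.module R M" and N: "Module.module R N" and res: "free_resolution R M X d e"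
  shows "Module.module R (Hom_cohomology R X d N i)"
proof -
  interpret N: Module.module R N by fact
  define F where "F i = free_module R (X i)" for i
  define C where "C i = Hom_module R (F i) N" for i
  define D where "D i = (\<lambda>f :: ('i \<Rightarrow> 'a) \<Rightarrow> 'c. compose (carrier (F (Suc i))) f (d i))" for i
  have F: "Module.module R (F i)" for i
    unfolding F_def by (rule free_module_is_module[OF N.R.is_cring])
  have C: "Module.module R (C i)" for i
    unfolding C_def by (rule Hom_module_is_module[OF F N])
  have d: "d i \<in> mod_hom R (F (Suc i)) (F i)" for i
    using res by (auto simp: free_resolution_def F_def)
  have D: "D i \<in> mod_hom R (C i) (C (Suc i))" for i
    unfolding D_def C_def by (rule compose_mod_hom[OF F d])
  have Z: "Hom_cocycles R X d N i = {f \<in> carrier (C i). D i f = \<zero>\<^bsub>C (Suc i)\<^esub>}" for i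
    by (simp add: Hom_cocycles_def C_def D_def F_def)
  have subZ: "submodule (Hom_cocycles R X d N i) R (C i)" for i
    unfolding Z by (rule mod_hom_kernel_submodule[OF C C D])
  have B_Suc: "Hom_coboundaries R X d N (Suc i) = D i ` carrier (C i)" for i
    by (simp add: C_def D_def F_def)
  have dd: "d j (d (Suc j) x) = \<zero>\<^bsub>F j\<^esub>" if "x \<in> carrier (F (Suc (Suc j)))" for j x
    using that res unfolding free_resolution_def F_def by blast
  have "submodule (Hom_coboundaries R X d N i) R (C i) \<and>
      Hom_coboundaries R X d N i \<subseteq> Hom_cocycles R X d N i"
  proof (cases i)
    case 0
    have "submodule {\<zero>\<^bsub>C 0\<^esub>} R (C 0)"
    proof -
      interpret C0: Module.module R "C 0" by (rule C)
      show ?thesis by (rule C0.submoduleI) auto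
    qed
    moreover have "\<zero>\<^bsub>C 0\<^esub> \<in> Hom_cocycles R X d N 0"
      using submodule.axioms(1)[OF subZ[of 0]] subgroup.one_closed by fastforce
    ultimately show ?thesis using 0 by (simp add: C_def F_def)
  next
    case (Suc j)
    have "D (Suc j) (D j f) = \<zero>\<^bsub>C (Suc (Suc j))\<^esub>" if f: "f \<in> carrier (C j)" for f
    proof -
      have f': "f \<in> mod_hom R (F j) N" using f by (simp add: C_def Hom_module_simps)
      interpret Fj: Module.module R "F j" by (rule F)
      have "f \<zero>\<^bsub>F j\<^esub> = \<zero>\<^bsub>N\<^esub>"
        using mod_homD(3)[OF f', of "\<zero>\<^bsub>R\<^esub>" "\<zero>\<^bsub>F j\<^esub>"] mod_homD(1)[OF f', of "\<zero>\<^bsub>F j\<^esub>"] by simp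
      then show ?thesis
        using dd mod_homD(1)[OF d[of "Suc j"]]
        by (intro ext) (auto simp: D_def C_def Hom_module_simps compose_def)
    qed
    then show ?thesis
      using mod_hom_image_submodule[OF C C D[of j]] mod_homD(1)[OF D[of j]]
      unfolding Suc B_Suc Z by auto
  qed
  then show ?thesis
    unfolding Hom_cohomology_def C_def[symmetric, unfolded F_def]
    by (intro quotient_module_is_module submodule_restrict submodule.submodule_is_module[OF _ C]
        C subZ) auto
qed

lemma Ext_is_module:
  assumes "Module.module R M" and "Module.module R N"
  shows "Module.module R (Ext R i M N)"
proof -
  obtain X d where Xd: "chosen_resolution R M = (X, d)" by fastforce
  then show ?thesis
    using chosen_resolution[OF assms(1) Xd] Hom_cohomology_is_module[OF assms]
    by (auto simp: Ext_def)
qed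

lemma equiv_frac_rel:
  assumes "Module.module R M" and "primeideal \<pp> R"
  shows "equiv (carrier M \<times> (carrier R - \<pp>)) (frac_rel R M \<pp>)"
proof -
  interpret Module.module R M by fact
  interpret p: primeideal \<pp> R by fact
  have one: "\<one>\<^bsub>R\<^esub> \<in> carrier R - \<pp>" using p.I_notcarr p.one_imp_carrier by auto
  have mult: "s \<otimes>\<^bsub>R\<^esub> t \<in> carrier R - \<pp>" if "s \<in> carrier R - \<pp>" "t \<in> carrier R - \<pp>" for s t
    using that p.I_prime by auto
  show ?thesis
  proof (rule equivI)
    show "frac_rel R M \<pp> \<subseteq> (carrier M \<times> (carrier R - \<pp>)) \<times> (carrier M \<times> (carrier R - \<pp>))"
      by (auto simp: frac_rel_def)
    show "refl_on (carrier M \<times> (carrier R - \<pp>)) (frac_rel R M \<pp>)"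
      using one by (auto simp: refl_on_def frac_rel_def)
    show "sym (frac_rel R M \<pp>)"
      by (auto simp: sym_def frac_rel_def) (metis DiffI)
    show "trans (frac_rel R M \<pp>)"
    proof (rule transI)
      fix a b c assume ab: "(a, b) \<in> frac_rel R M \<pp>" and bc: "(b, c) \<in> frac_rel R M \<pp>"
      obtain x s y t z r where abc: "a = (x, s)" "b = (y, t)" "c = (z, r)"
        by (metis surj_pair)
      obtain u where u: "u \<in> carrier R - \<pp>" "u \<odot>\<^bsub>M\<^esub> (t \<odot>\<^bsub>M\<^esub> x) = u \<odot>\<^bsub>M\<^esub> (s \<odot>\<^bsub>M\<^esub> y)"
        using ab by (auto simp: frac_rel_def abc)
      obtain v where v: "v \<in> carrier R - \<pp>" "v \<odot>\<^bsub>M\<^esub> (r \<odot>\<^bsub>M\<^esub> y) = v \<odot>\<^bsub>M\<^esub> (t \<odot>\<^bsub>M\<^esub> z)"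
        using bc by (auto simp: frac_rel_def abc)
      have c: "x \<in> carrier M" "y \<in> carrier M" "z \<in> carrier M" "s \<in> carrier R - \<pp>"
        "t \<in> carrier R - \<pp>" "r \<in> carrier R - \<pp>"
        using ab bc by (auto simp: frac_rel_def abc)
      have c': "s \<in> carrier R" "t \<in> carrier R" "r \<in> carrier R" "u \<in> carrier R" "v \<in> carrier R"
        using c u(1) v(1) by auto
      let ?w = "u \<otimes>\<^bsub>R\<^esub> v \<otimes>\<^bsub>R\<^esub> t"
      have "?w \<odot>\<^bsub>M\<^esub> (r \<odot>\<^bsub>M\<^esub> x) = (v \<otimes>\<^bsub>R\<^esub> r) \<odot>\<^bsub>M\<^esub> (u \<odot>\<^bsub>M\<^esub> (t \<odot>\<^bsub>M\<^esub> x))"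
        using c(1-3) c' by (simp add: smult_assoc1[symmetric] m_ac)
      also have "\<dots> = (u \<otimes>\<^bsub>R\<^esub> s) \<odot>\<^bsub>M\<^esub> (v \<odot>\<^bsub>M\<^esub> (r \<odot>\<^bsub>M\<^esub> y))"
        using c(1-3) c' unfolding u(2) by (simp add: smult_assoc1[symmetric] m_ac)
      also have "\<dots> = ?w \<odot>\<^bsub>M\<^esub> (s \<odot>\<^bsub>M\<^esub> z)"
        using c(1-3) c' unfolding v(2) by (simp add: smult_assoc1[symmetric] m_ac)
      finally show "(a, c) \<in> frac_rel R M \<pp>"
        using c mult[OF mult[OF u(1) v(1)] c(5)] by (auto simp: frac_rel_def abc)
    qed
  qed
qed

lemma localized_module_is_module:
  assumes M: "Module.module R M" and p: "primeideal \<pp> R"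
  shows "Module.module R (localized_module R M \<pp>)"
proof -
  interpret Module.module R M by fact
  interpret p: primeideal \<pp> R by fact
  let ?S = "carrier R - \<pp>" and ?L = "localized_module R M \<pp>"
  define frac where "frac x s = frac_rel R M \<pp> `` {(x, s)}" for x s
  note equiv = equiv_frac_rel[OF M p]
  have one: "\<one>\<^bsub>R\<^esub> \<in> ?S" using p.I_notcarr p.one_imp_carrier by auto
  have mult: "s \<otimes>\<^bsub>R\<^esub> t \<in> ?S" if "s \<in> ?S" "t \<in> ?S" for s t
    using that p.I_prime by auto
  have carr: "carrier ?L = {frac x s | x s. x \<in> carrier M \<and> s \<in> ?S}"
    by (auto simp: localized_module_def quotient_def frac_def)
  have rel: "((x, s), (y, t)) \<in> frac_rel R M \<pp>"
    if "x \<in> carrier M" "y \<in> carrier M" "s \<in> ?S" "t \<in> ?S" "u \<in> ?S"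
      "u \<odot>\<^bsub>M\<^esub> (t \<odot>\<^bsub>M\<^esub> x) = u \<odot>\<^bsub>M\<^esub> (s \<odot>\<^bsub>M\<^esub> y)" for x s y t u
    using that by (auto simp: frac_rel_def)
  have frac_eq: "frac x s = frac y t"
    if "x \<in> carrier M" "y \<in> carrier M" "s \<in> ?S" "t \<in> ?S" "u \<in> ?S"
      "u \<odot>\<^bsub>M\<^esub> (t \<odot>\<^bsub>M\<^esub> x) = u \<odot>\<^bsub>M\<^esub> (s \<odot>\<^bsub>M\<^esub> y)" for x s y t u
    unfolding frac_def by (rule equiv_class_eq[OF equiv rel[OF that]])
  have self: "(x, s) \<in> frac x s" if "x \<in> carrier M" "s \<in> ?S" for x s
    unfolding frac_def using equiv_class_self[OF equiv] that by auto
  have fracD: "y \<in> carrier M \<and> t \<in> ?S \<and> (\<exists>u\<in>?S. u \<odot>\<^bsub>M\<^esub> (t \<odot>\<^bsub>M\<^esub> x) = u \<odot>\<^bsub>M\<^esub> (s \<odot>\<^bsub>M\<^esub> y))"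
    if "(y, t) \<in> frac x s" for x s y t
    using that by (auto simp: frac_def frac_rel_def)
  have add: "frac x s \<oplus>\<^bsub>?L\<^esub> frac y t = frac (t \<odot>\<^bsub>M\<^esub> x \<oplus>\<^bsub>M\<^esub> s \<odot>\<^bsub>M\<^esub> y) (s \<otimes>\<^bsub>R\<^esub> t)"
    if x: "x \<in> carrier M" "s \<in> ?S" and y: "y \<in> carrier M" "t \<in> ?S" for x s y t
  proof -
    have *: "frac (t' \<odot>\<^bsub>M\<^esub> x' \<oplus>\<^bsub>M\<^esub> s' \<odot>\<^bsub>M\<^esub> y') (s' \<otimes>\<^bsub>R\<^esub> t') =
        frac (t \<odot>\<^bsub>M\<^esub> x \<oplus>\<^bsub>M\<^esub> s \<odot>\<^bsub>M\<^esub> y) (s \<otimes>\<^bsub>R\<^esub> t)"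
      if x': "(x', s') \<in> frac x s" and y': "(y', t') \<in> frac y t" for x' s' y' t'
    proof -
      obtain u where u: "u \<in> ?S" "u \<odot>\<^bsub>M\<^esub> (s' \<odot>\<^bsub>M\<^esub> x) = u \<odot>\<^bsub>M\<^esub> (s \<odot>\<^bsub>M\<^esub> x')"
        and cx: "x' \<in> carrier M" "s' \<in> ?S" using fracD[OF x'] by blast
      obtain v where v: "v \<in> ?S" "v \<odot>\<^bsub>M\<^esub> (t' \<odot>\<^bsub>M\<^esub> y) = v \<odot>\<^bsub>M\<^esub> (t \<odot>\<^bsub>M\<^esub> y')"
        and cy: "y' \<in> carrier M" "t' \<in> ?S" using fracD[OF y'] by blast
      have c: "s \<in> carrier R" "t \<in> carrier R" "s' \<in> carrier R" "t' \<in> carrier R"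
        "u \<in> carrier R" "v \<in> carrier R"
        using x y cx cy u v by auto
      have "(u \<otimes>\<^bsub>R\<^esub> v) \<odot>\<^bsub>M\<^esub> ((s \<otimes>\<^bsub>R\<^esub> t) \<odot>\<^bsub>M\<^esub> (t' \<odot>\<^bsub>M\<^esub> x' \<oplus>\<^bsub>M\<^esub> s' \<odot>\<^bsub>M\<^esub> y')) =
          (v \<otimes>\<^bsub>R\<^esub> t \<otimes>\<^bsub>R\<^esub> t') \<odot>\<^bsub>M\<^esub> (u \<odot>\<^bsub>M\<^esub> (s \<odot>\<^bsub>M\<^esub> x')) \<oplus>\<^bsub>M\<^esub>
          (u \<otimes>\<^bsub>R\<^esub> s \<otimes>\<^bsub>R\<^esub> s') \<odot>\<^bsub>M\<^esub> (v \<odot>\<^bsub>M\<^esub> (t \<odot>\<^bsub>M\<^esub> y'))"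
        using c cx(1) cy(1) by (simp add: smult_r_distr smult_assoc1[symmetric] m_ac)
      also have "\<dots> = (u \<otimes>\<^bsub>R\<^esub> v) \<odot>\<^bsub>M\<^esub> ((s' \<otimes>\<^bsub>R\<^esub> t') \<odot>\<^bsub>M\<^esub> (t \<odot>\<^bsub>M\<^esub> x \<oplus>\<^bsub>M\<^esub> s \<odot>\<^bsub>M\<^esub> y))"
        using c x(1) y(1) unfolding u(2)[symmetric] v(2)[symmetric]
        by (simp add: smult_r_distr smult_assoc1[symmetric] m_ac)
      finally show ?thesis
        using c cx(1) cy(1) x(1) y(1) mult[OF cx(2) cy(2)] mult[OF x(2) y(2)] mult[OF u(1) v(1)]
        by (intro frac_eq) auto
    qed
    have "frac x s \<oplus>\<^bsub>?L\<^esub> frac y t = (\<Union>(x', s')\<in>frac x s. \<Union>(y', t')\<in>frac y t.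
        frac (t' \<odot>\<^bsub>M\<^esub> x' \<oplus>\<^bsub>M\<^esub> s' \<odot>\<^bsub>M\<^esub> y') (s' \<otimes>\<^bsub>R\<^esub> t'))"
      by (simp add: localized_module_def frac_def)
    also have "\<dots> = (\<Union>(x', s')\<in>frac x s. \<Union>(y', t')\<in>frac y t.
        frac (t \<odot>\<^bsub>M\<^esub> x \<oplus>\<^bsub>M\<^esub> s \<odot>\<^bsub>M\<^esub> y) (s \<otimes>\<^bsub>R\<^esub> t))"
      using * by (intro SUP_cong) (auto intro!: SUP_cong)
    also have "\<dots> = frac (t \<odot>\<^bsub>M\<^esub> x \<oplus>\<^bsub>M\<^esub> s \<odot>\<^bsub>M\<^esub> y) (s \<otimes>\<^bsub>R\<^esub> t)"
      using self[OF x] self[OF y] by auto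
    finally show ?thesis .
  qed
  have smult: "r \<odot>\<^bsub>?L\<^esub> frac x s = frac (r \<odot>\<^bsub>M\<^esub> x) s"
    if r: "r \<in> carrier R" and x: "x \<in> carrier M" "s \<in> ?S" for r x s
  proof -
    have *: "frac (r \<odot>\<^bsub>M\<^esub> x') s' = frac (r \<odot>\<^bsub>M\<^esub> x) s" if x': "(x', s') \<in> frac x s" for x' s'
    proof -
      obtain u where u: "u \<in> ?S" "u \<odot>\<^bsub>M\<^esub> (s' \<odot>\<^bsub>M\<^esub> x) = u \<odot>\<^bsub>M\<^esub> (s \<odot>\<^bsub>M\<^esub> x')"
        and cx: "x' \<in> carrier M" "s' \<in> ?S" using fracD[OF x'] by blast
      have c: "s \<in> carrier R" "s' \<in> carrier R" "u \<in> carrier R" using x cx u by auto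
      have "u \<odot>\<^bsub>M\<^esub> (s \<odot>\<^bsub>M\<^esub> (r \<odot>\<^bsub>M\<^esub> x')) = r \<odot>\<^bsub>M\<^esub> (u \<odot>\<^bsub>M\<^esub> (s \<odot>\<^bsub>M\<^esub> x'))"
        using c cx(1) r by (simp add: smult_assoc1[symmetric] m_ac)
      also have "\<dots> = u \<odot>\<^bsub>M\<^esub> (s' \<odot>\<^bsub>M\<^esub> (r \<odot>\<^bsub>M\<^esub> x))"
        using c x(1) r unfolding u(2)[symmetric] by (simp add: smult_assoc1[symmetric] m_ac)
      finally show ?thesis using r cx x u(1) by (intro frac_eq) auto
    qed
    have "r \<odot>\<^bsub>?L\<^esub> frac x s = (\<Union>(x', s')\<in>frac x s. frac (r \<odot>\<^bsub>M\<^esub> x') s')"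
      by (simp add: localized_module_def frac_def)
    also have "\<dots> = (\<Union>(x', s')\<in>frac x s. frac (r \<odot>\<^bsub>M\<^esub> x) s)"
      using * by (intro SUP_cong) auto
    also have "\<dots> = frac (r \<odot>\<^bsub>M\<^esub> x) s" using self[OF x] by auto
    finally show ?thesis .
  qed
  have zero: "\<zero>\<^bsub>?L\<^esub> = frac \<zero>\<^bsub>M\<^esub> \<one>\<^bsub>R\<^esub>" by (simp add: localized_module_def frac_def)
  have fracE: thesis if "A \<in> carrier ?L" "\<And>x s. \<lbrakk>x \<in> carrier M; s \<in> ?S; A = frac x s\<rbrakk> \<Longrightarrow> thesis"
    for A thesis
    using that by (auto simp: carr)
  have closed: "frac x s \<in> carrier ?L" if "x \<in> carrier M" "s \<in> ?S" for x s
    using that by (auto simp: carr)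
  have ag: "abelian_group ?L"
  proof (rule abelian_groupI)
    fix A B C assume A: "A \<in> carrier ?L" and B: "B \<in> carrier ?L" and C: "C \<in> carrier ?L"
    obtain x s where x: "x \<in> carrier M" "s \<in> ?S" "A = frac x s" using A by (rule fracE)
    obtain y t where y: "y \<in> carrier M" "t \<in> ?S" "B = frac y t" using B by (rule fracE)
    obtain z r where z: "z \<in> carrier M" "r \<in> ?S" "C = frac z r" using C by (rule fracE)
    have c: "s \<in> carrier R" "t \<in> carrier R" "r \<in> carrier R" using x y z by auto
    note st = mult[OF x(2) y(2)] and tr = mult[OF y(2) z(2)]
    show "A \<oplus>\<^bsub>?L\<^esub> B \<oplus>\<^bsub>?L\<^esub> C = A \<oplus>\<^bsub>?L\<^esub> (B \<oplus>\<^bsub>?L\<^esub> C)"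
      using x y z c st tr
      by (simp add: add smult_r_distr smult_assoc1[symmetric] m_ac a_ac del: Diff_iff)
  next
    fix A B assume A: "A \<in> carrier ?L" and B: "B \<in> carrier ?L"
    obtain x s where x: "x \<in> carrier M" "s \<in> ?S" "A = frac x s" using A by (rule fracE)
    obtain y t where y: "y \<in> carrier M" "t \<in> ?S" "B = frac y t" using B by (rule fracE)
    have c: "s \<in> carrier R" "t \<in> carrier R" using x y by auto
    show "A \<oplus>\<^bsub>?L\<^esub> B \<in> carrier ?L"
      using x y c mult[OF x(2) y(2)] by (simp add: add closed del: Diff_iff)
    show "A \<oplus>\<^bsub>?L\<^esub> B = B \<oplus>\<^bsub>?L\<^esub> A"
      using x y c by (simp add: add m_comm M.a_comm del: Diff_iff)
  next
    show "\<zero>\<^bsub>?L\<^esub> \<in> carrier ?L" unfolding zero by (intro closed one) auto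
  next
    fix A assume A: "A \<in> carrier ?L"
    obtain x s where x: "x \<in> carrier M" "s \<in> ?S" "A = frac x s" using A by (rule fracE)
    have c: "s \<in> carrier R" using x by auto
    show "\<zero>\<^bsub>?L\<^esub> \<oplus>\<^bsub>?L\<^esub> A = A"
      using x c one by (simp add: zero add del: Diff_iff)
    have "frac (\<ominus>\<^bsub>M\<^esub> x) s \<oplus>\<^bsub>?L\<^esub> A = frac \<zero>\<^bsub>M\<^esub> (s \<otimes>\<^bsub>R\<^esub> s)"
      using x c by (simp add: add smult_r_minus M.l_neg del: Diff_iff)
    also have "\<dots> = \<zero>\<^bsub>?L\<^esub>"
      unfolding zero using c one mult[OF x(2) x(2)] by (intro frac_eq[where u = "\<one>\<^bsub>R\<^esub>"]) auto
    finally show "\<exists>B\<in>carrier ?L. B \<oplus>\<^bsub>?L\<^esub> A = \<zero>\<^bsub>?L\<^esub>"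
      using x closed M.a_inv_closed by blast
  qed
  show ?thesis
  proof (rule moduleI[OF R.is_cring ag])
    fix a b A B
    assume a: "a \<in> carrier R" and b: "b \<in> carrier R" and A: "A \<in> carrier ?L" and B: "B \<in> carrier ?L"
    obtain x s where x: "x \<in> carrier M" "s \<in> ?S" "A = frac x s" using A by (rule fracE)
    obtain y t where y: "y \<in> carrier M" "t \<in> ?S" "B = frac y t" using B by (rule fracE)
    have c: "s \<in> carrier R" "t \<in> carrier R" using x y by auto
    show "a \<odot>\<^bsub>?L\<^esub> A \<in> carrier ?L" using a x by (simp add: smult closed del: Diff_iff)
    show "(a \<otimes>\<^bsub>R\<^esub> b) \<odot>\<^bsub>?L\<^esub> A = a \<odot>\<^bsub>?L\<^esub> (b \<odot>\<^bsub>?L\<^esub> A)"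
      using a b x by (simp add: smult smult_assoc1 del: Diff_iff)
    show "a \<odot>\<^bsub>?L\<^esub> (A \<oplus>\<^bsub>?L\<^esub> B) = a \<odot>\<^bsub>?L\<^esub> A \<oplus>\<^bsub>?L\<^esub> a \<odot>\<^bsub>?L\<^esub> B"
      using a x y c mult[OF x(2) y(2)]
      by (simp add: add smult smult_r_distr smult_assoc1[symmetric] m_ac del: Diff_iff)
    have "frac (s \<odot>\<^bsub>M\<^esub> (a \<odot>\<^bsub>M\<^esub> x) \<oplus>\<^bsub>M\<^esub> s \<odot>\<^bsub>M\<^esub> (b \<odot>\<^bsub>M\<^esub> x)) (s \<otimes>\<^bsub>R\<^esub> s) = frac ((a \<oplus>\<^bsub>R\<^esub> b) \<odot>\<^bsub>M\<^esub> x) s"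
    proof (rule frac_eq[OF _ _ mult[OF x(2) x(2)] x(2) one])
      have "s \<odot>\<^bsub>M\<^esub> (s \<odot>\<^bsub>M\<^esub> (a \<odot>\<^bsub>M\<^esub> x) \<oplus>\<^bsub>M\<^esub> s \<odot>\<^bsub>M\<^esub> (b \<odot>\<^bsub>M\<^esub> x)) = (s \<otimes>\<^bsub>R\<^esub> s) \<odot>\<^bsub>M\<^esub> ((a \<oplus>\<^bsub>R\<^esub> b) \<odot>\<^bsub>M\<^esub> x)"
        using a b x(1) c by (simp add: smult_l_distr smult_r_distr smult_assoc1)
      then show "\<one>\<^bsub>R\<^esub> \<odot>\<^bsub>M\<^esub> (s \<odot>\<^bsub>M\<^esub> (s \<odot>\<^bsub>M\<^esub> (a \<odot>\<^bsub>M\<^esub> x) \<oplus>\<^bsub>M\<^esub> s \<odot>\<^bsub>M\<^esub> (b \<odot>\<^bsub>M\<^esub> x))) =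
          \<one>\<^bsub>R\<^esub> \<odot>\<^bsub>M\<^esub> ((s \<otimes>\<^bsub>R\<^esub> s) \<odot>\<^bsub>M\<^esub> ((a \<oplus>\<^bsub>R\<^esub> b) \<odot>\<^bsub>M\<^esub> x))" by simp
    qed (use a b x c in auto)
    then show "(a \<oplus>\<^bsub>R\<^esub> b) \<odot>\<^bsub>?L\<^esub> A = a \<odot>\<^bsub>?L\<^esub> A \<oplus>\<^bsub>?L\<^esub> b \<odot>\<^bsub>?L\<^esub> A"
      using a b x by (simp add: add smult del: Diff_iff)
  next
    fix A assume A: "A \<in> carrier ?L"
    obtain x s where x: "x \<in> carrier M" "s \<in> ?S" "A = frac x s" using A by (rule fracE)
    show "\<one>\<^bsub>R\<^esub> \<odot>\<^bsub>?L\<^esub> A = A" using x by (simp add: smult del: Diff_iff)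
  qed
qed

end

theory Submission
  imports Defs
begin

text \<open>
  Suppose that \<open>\<pp> \<in> min(M)\<close> is associated to no \<open>Ext\<^sup>i(M, R)\<close>.  Minimality of \<open>\<pp>\<close> makes every
  element of \<open>\<pp>\<close> nilpotent, up to a factor outside \<open>\<pp>\<close>, on \<open>M\<close> and hence on \<open>Ext\<^sup>i(M, R)\<close>; so a
  class that does not vanish at \<open>\<pp>\<close> would have a multiple with annihilator \<open>\<pp>\<close>, and therefore
  \<open>Ext\<^sup>i(M, R)\<^sub>\<pp> = 0\<close> for all \<open>i\<close>.  Among the ideals \<open>I \<subseteq> \<pp>\<close> with \<open>Ext\<^sup>i(M, R/I)\<^sub>\<pp> = 0\<close> for all
  \<open>i\<close> choose a maximal one.  If some \<open>x \<in> \<pp>\<close> is regular on \<open>(R/I)\<^sub>\<pp>\<close>, then the long exact sequence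
  of \<open>0 \<rightarrow> R/I \<rightarrow> R/I \<rightarrow> R/(I + x) \<rightarrow> 0\<close> at \<open>\<pp>\<close> contradicts maximality.  Otherwise prime avoidance
  gives \<open>\<pp> \<in> Ass(R/I)\<close>, and then \<open>M \<rightarrow> R/\<pp> \<rightarrow> R/I\<close> is an element of \<open>Hom(M, R/I)\<close> that does not
  vanish at \<open>\<pp>\<close>.  Localization is avoided by working with elements up to factors outside \<open>\<pp>\<close>; this
  is also what allows the free modules in the resolution to have infinite rank.
\<close>


section \<open>Colon ideals and prime avoidance\<close>

locale noetherian_cring = noetherian_ring R + cring R for R (structure)

text \<open>The colon ideal \<open>(I : y)\<close>, that is, the annihilator of the class of
  \<open>y\<close> in \<open>R/I\<close>, formed without the quotient ring. The associated primes of
  \<open>R/I\<close> are the prime ideals of this form.\<close>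

definition colon :: "('a, 'm) ring_scheme \<Rightarrow> 'a set \<Rightarrow> 'a \<Rightarrow> 'a set"
  where "colon R I y = {r \<in> carrier R. r \<otimes>\<^bsub>R\<^esub> y \<in> I}"

lemma (in cring) ideal_colon:
  assumes "ideal I R" and y: "y \<in> carrier R"
  shows "ideal (colon R I y) R"
proof -
  interpret I: ideal I R by fact
  show ?thesis
  proof (rule idealI[OF ring_axioms])
    show "subgroup (colon R I y) (add_monoid R)"
    proof (rule add.subgroupI)
      show "colon R I y \<noteq> {}"
        using y by (auto simp: colon_def intro!: exI[of _ \<zero>])
      fix a assume a: "a \<in> colon R I y"
      then have "\<ominus> a \<otimes> y = \<ominus> (a \<otimes> y)" using y by (auto simp: colon_def l_minus)
      then show "\<ominus> a \<in> colon R I y" using a by (auto simp: colon_def)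
    qed (auto simp: colon_def l_distr y)
    show "x \<otimes> a \<in> colon R I y" if "a \<in> colon R I y" "x \<in> carrier R" for a x
      using that y by (auto simp: colon_def m_assoc I.I_l_closed)
    then show "a \<otimes> x \<in> colon R I y" if "a \<in> colon R I y" "x \<in> carrier R" for a x
      using that by (metis (lifting) colon_def m_comm mem_Collect_eq)
  qed
qed

lemma (in cring) colon_subset_colon_mult:
  assumes "ideal I R" and "b \<in> carrier R" and "y \<in> carrier R"
  shows "colon R I y \<subseteq> colon R I (b \<otimes> y)"
  using assms(2,3) ideal.I_l_closed[OF assms(1)]
  by (auto simp: colon_def m_lcomm[of _ b y])

lemma (in ideal) minus_closed: "a \<in> I \<Longrightarrow> b \<in> I \<Longrightarrow> a \<ominus> b \<in> I"
  by (simp add: a_minus_def)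

text \<open>The set is \<open>I + (x)\<close>, written through its membership test because later
  steps use the coefficient \<open>b\<close>.\<close>

lemma (in cring) ideal_insert:
  assumes "ideal I R" and x: "x \<in> carrier R"
  shows "ideal {z \<in> carrier R. \<exists>b\<in>carrier R. z \<ominus> x \<otimes> b \<in> I} R"
proof -
  interpret I: ideal I R by fact
  have "{z \<in> carrier R. \<exists>b\<in>carrier R. z \<ominus> x \<otimes> b \<in> I} = I <+>\<^bsub>R\<^esub> PIdl x"
  proof (intro equalityI subsetI)
    fix z assume "z \<in> {z \<in> carrier R. \<exists>b\<in>carrier R. z \<ominus> x \<otimes> b \<in> I}"
    then obtain b where z: "z \<in> carrier R" and b: "b \<in> carrier R" "z \<ominus> x \<otimes> b \<in> I" by auto
    have "z = (z \<ominus> x \<otimes> b) \<oplus> b \<otimes> x"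
      using z b(1) x by (simp add: a_minus_def a_assoc l_neg m_comm)
    then show "z \<in> I <+>\<^bsub>R\<^esub> PIdl x" using b by (auto simp: set_add_def' cgenideal_def)
  next
    fix z assume "z \<in> I <+>\<^bsub>R\<^esub> PIdl x"
    then obtain a b where a: "a \<in> I" and b: "b \<in> carrier R" and z: "z = a \<oplus> b \<otimes> x"
      by (auto simp: set_add_def' cgenideal_def)
    have "z \<ominus> x \<otimes> b = a"
      using I.Icarr[OF a] b x by (simp add: z a_minus_def a_assoc r_neg m_comm)
    then show "z \<in> {z \<in> carrier R. \<exists>b\<in>carrier R. z \<ominus> x \<otimes> b \<in> I}"
      using I.Icarr[OF a] a b x unfolding z by (auto intro!: bexI[of _ b])
  qed
  then show ?thesis using add_ideals[OF assms(1) cgenideal_ideal[OF x]] by simp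
qed

text \<open>In a noetherian ring the union of a nonempty chain of ideals is a member of the chain,
  so Zorn's lemma applies to an arbitrary nonempty family of ideals.\<close>

lemma (in noetherian_ring) exists_maximal_ideal:
  assumes "\<I> \<noteq> {}" and "\<And>I. I \<in> \<I> \<Longrightarrow> ideal I R"
  shows "\<exists>I\<in>\<I>. \<forall>J\<in>\<I>. I \<subseteq> J \<longrightarrow> J = I"
proof (rule subset_Zorn_nonempty[OF assms(1)])
  fix C assume "C \<noteq> {}" and C: "subset.chain \<I> C"
  moreover have "subset.chain {I. ideal I R} C"
    using C assms(2) by (auto simp: subset.chain_def)
  ultimately have "\<Union>C \<in> C" by (intro ideal_chain_is_trivial)
  then show "\<Union>C \<in> \<I>" using C by (auto simp: subset.chain_def)
qed

lemma (in primeideal) one_notin: "\<one> \<notin> I"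
  using I_notcarr one_imp_carrier by auto

lemma (in primeideal) compl_mult:
  "s \<in> carrier R - I \<Longrightarrow> t \<in> carrier R - I \<Longrightarrow> s \<otimes> t \<in> carrier R - I"
  using I_prime by auto

text \<open>Pick an element outside the prime from \<open>J\<close> and from each member of
  \<open>\<Q>\<close>; their product stays outside by primality and lies in all these
  ideals.\<close>

lemma (in primeideal) exists_in_finite_Inter_notin:
  assumes "finite \<Q>" and "\<And>Q. Q \<in> \<Q> \<Longrightarrow> ideal Q R \<and> \<not> Q \<subseteq> I" and J: "ideal J R" "\<not> J \<subseteq> I"
  shows "\<exists>z\<in>J - I. \<forall>Q\<in>\<Q>. z \<in> Q"
  using assms(1,2)
proof (induction \<Q> rule: finite_induct)
  case empty
  then show ?case using J by auto
next
  case (insert Q \<Q>)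
  then obtain z where z: "z \<in> J - I" "\<forall>Q\<in>\<Q>. z \<in> Q" by auto
  obtain q where q: "q \<in> Q" "q \<notin> I" using insert by auto
  have qc: "q \<in> carrier R" using q insert.prems by (auto intro: ideal.Icarr)
  have zc: "z \<in> carrier R" using z J(1) by (auto intro: ideal.Icarr)
  show ?case
  proof (intro bexI[of _ "q \<otimes> z"] ballI)
    show "q \<otimes> z \<in> J - I"
      using z q qc zc ideal.I_l_closed[OF J(1)] I_prime[OF qc zc] by auto
    fix Q' assume "Q' \<in> insert Q \<Q>"
    then show "q \<otimes> z \<in> Q'"
      using z(2) q(1) qc zc ideal.I_l_closed[of Q' R z q] ideal.I_r_closed[of Q R q z] insert.prems
      by auto
  qed
qed

text \<open>If no member contains \<open>J\<close>, take an inclusion-minimal member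
  \<open>P\<close>. By induction the others do not cover \<open>J\<close>, so some \<open>x\<close>
  in \<open>J\<close> lies in \<open>P\<close> only, while some \<open>z\<close> in \<open>J\<close>
  lies in every member except \<open>P\<close>. Then \<open>x \<oplus> z\<close> lies in none of
  them.\<close>

lemma (in cring) prime_avoidance:
  assumes "finite \<Q>" and "\<And>Q. Q \<in> \<Q> \<Longrightarrow> primeideal Q R" and J: "ideal J R" and "J \<subseteq> \<Union>\<Q>"
  shows "\<exists>Q\<in>\<Q>. J \<subseteq> Q"
  using assms(1,2,4)
proof (induction \<Q> rule: finite_psubset_induct)
  case (psubset \<Q>)
  interpret J: ideal J R by fact
  show ?case
  proof (rule ccontr)
    assume none: "\<not> (\<exists>Q\<in>\<Q>. J \<subseteq> Q)"
    have "\<Q> \<noteq> {}" using psubset.prems(2) J.zero_closed by blast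
    then obtain P where P: "P \<in> \<Q>" and min: "\<And>Q. Q \<in> \<Q> \<Longrightarrow> Q \<subseteq> P \<Longrightarrow> P = Q"
      using finite_has_minimal[OF psubset.hyps(1)] by blast
    interpret P: primeideal P R using P psubset.prems(1) by blast
    have "\<not> J \<subseteq> \<Union>(\<Q> - {P})"
      using psubset.IH[of "\<Q> - {P}"] psubset.prems(1) P none by blast
    then obtain x where x: "x \<in> J" "x \<notin> \<Union>(\<Q> - {P})" by blast
    have xP: "x \<in> P" using x psubset.prems(2) by blast
    \<comment> \<open>Minimality of \<open>P\<close> enters here: it lets \<open>z\<close> avoid
      \<open>P\<close> while lying in every other member.\<close>
    have "ideal Q R \<and> \<not> Q \<subseteq> P" if "Q \<in> \<Q> - {P}" for Q
      using that min[of Q] psubset.prems(1)[of Q] by (auto intro: primeideal.axioms(1))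
    moreover have "\<not> J \<subseteq> P" using none P by blast
    ultimately have "\<exists>z\<in>J - P. \<forall>Q\<in>\<Q> - {P}. z \<in> Q"
      using psubset.hyps(1) J by (intro P.exists_in_finite_Inter_notin) auto
    then obtain z where z: "z \<in> J" "z \<notin> P" "\<And>Q. Q \<in> \<Q> - {P} \<Longrightarrow> z \<in> Q" by blast
    have xc: "x \<in> carrier R" and zc: "z \<in> carrier R" using x z by auto
    have "x \<oplus> z \<in> J" using x z by auto
    then obtain Q where Q: "Q \<in> \<Q>" "x \<oplus> z \<in> Q" using psubset.prems(2) by blast
    interpret Q: primeideal Q R using Q psubset.prems(1) by blast
    show False
    proof (cases "Q = P")
      case True
      then have "(x \<oplus> z) \<ominus> x \<in> P" using Q xP by (intro P.minus_closed) auto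
      moreover have "(x \<oplus> z) \<ominus> x = z"
        using xc zc by (simp add: a_minus_def a_comm[of x z] a_assoc r_neg)
      ultimately show False using z(2) by simp
    next
      case False
      then have "(x \<oplus> z) \<ominus> z \<in> Q" using Q z(3) by (intro Q.minus_closed) auto
      moreover have "(x \<oplus> z) \<ominus> z = x" using xc zc by (simp add: a_minus_def a_assoc r_neg)
      ultimately show False using x(2) Q(1) False by auto
    qed
  qed
qed

section \<open>Zero divisors modulo an ideal\<close>

context noetherian_cring
begin

text \<open>For \<open>a b\<close> in \<open>(I : y)\<close> with \<open>b y\<close> outside
  \<open>I\<close>, maximality forces \<open>(I : b y) = (I : y)\<close>, and \<open>a\<close> lies
  in the former.\<close>

lemma primeideal_maximal_colon:
  assumes I: "ideal I R" and y: "y \<in> carrier R" "y \<notin> I"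
    and max: "\<And>z. z \<in> carrier R \<Longrightarrow> z \<notin> I \<Longrightarrow> colon R I y \<subseteq> colon R I z \<Longrightarrow> colon R I z = colon R I y"
  shows "primeideal (colon R I y) R"
proof (rule primeidealI[OF ideal_colon[OF I y(1)] is_cring])
  interpret I: ideal I R by fact
  have "\<one> \<notin> colon R I y" using y by (simp add: colon_def)
  then show "carrier R \<noteq> colon R I y" by auto
  fix a b assume a: "a \<in> carrier R" and b: "b \<in> carrier R" and ab: "a \<otimes> b \<in> colon R I y"
  show "a \<in> colon R I y \<or> b \<in> colon R I y"
  proof (rule disjCI)
    assume "b \<notin> colon R I y"
    then have bny: "b \<otimes> y \<notin> I" using b by (simp add: colon_def)
    have sub: "colon R I y \<subseteq> colon R I (b \<otimes> y)"
      using b y(1) by (intro colon_subset_colon_mult[OF I]) auto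
    have "a \<in> colon R I (b \<otimes> y)" using ab a b y(1) by (simp add: colon_def m_assoc)
    then show "a \<in> colon R I y" using max[OF _ bny sub] b y(1) by simp
  qed
qed

text \<open>These are the maximal associated primes of \<open>R/I\<close>; their union is the set of
  zero divisors modulo \<open>I\<close>. The noetherian condition is used twice: on colon ideals, to
  place each inside a maximal one, and on ideals generated by chosen elements \<open>y Q\<close>,
  for finiteness.\<close>

lemma zero_divisors_finite_colon_primes:
  assumes I: "ideal I R"
  obtains \<Q> where "finite \<Q>"
    and "\<And>Q. Q \<in> \<Q> \<Longrightarrow> primeideal Q R \<and> (\<exists>y\<in>carrier R - I. Q = colon R I y)"
    and "\<And>y. y \<in> carrier R - I \<Longrightarrow> \<exists>Q\<in>\<Q>. colon R I y \<subseteq> Q"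
proof -
  interpret I: ideal I R by fact
  let ?A = "colon R I ` (carrier R - I)"
  define \<Q> where "\<Q> = {Q \<in> ?A. \<forall>J\<in>?A. Q \<subseteq> J \<longrightarrow> J = Q}"
  have prime: "primeideal Q R" if "Q \<in> \<Q>" for Q
    using that primeideal_maximal_colon[OF I] by (auto simp: \<Q>_def)
  obtain y where y: "\<And>Q. Q \<in> \<Q> \<Longrightarrow> y Q \<in> carrier R - I \<and> Q = colon R I (y Q)"
  proof -
    have "\<forall>Q\<in>\<Q>. \<exists>y. y \<in> carrier R - I \<and> Q = colon R I y" by (auto simp: \<Q>_def)
    from bchoice[OF this] show thesis using that by blast
  qed
  have cover: "\<exists>Q\<in>\<Q>. colon R I z \<subseteq> Q" if z: "z \<in> carrier R - I" for z
  proof -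
    let ?B = "{J \<in> ?A. colon R I z \<subseteq> J}"
    have "\<exists>Q\<in>?B. \<forall>J\<in>?B. Q \<subseteq> J \<longrightarrow> J = Q"
    proof (rule exists_maximal_ideal)
      show "?B \<noteq> {}" using z by blast
      show "ideal K R" if "K \<in> ?B" for K
        using that ideal_colon[OF I] by blast
    qed
    then obtain Q where Q: "Q \<in> ?A" "colon R I z \<subseteq> Q" and max: "\<forall>J\<in>?B. Q \<subseteq> J \<longrightarrow> J = Q"
      by (elim bexE CollectE conjE)
    have "J = Q" if "J \<in> ?A" "Q \<subseteq> J" for J
      by (rule max[rule_format]) (use that Q(2) in auto)
    then have "Q \<in> \<Q>" using Q(1) unfolding \<Q>_def by blast
    then show ?thesis using Q(2) by blast
  qed
  have "finite \<Q>"
  proof -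
    \<comment> \<open>Choose a finite \<open>\<F>\<close> for which the ideal generated by the
      elements \<open>y P\<close>, \<open>P\<close> in \<open>\<F>\<close>, is maximal; adjoining a
      further \<open>Q\<close> cannot enlarge it, so \<open>y Q\<close> already lies in it.\<close>
    let ?B = "{Idl (y ` \<F>) | \<F>. finite \<F> \<and> \<F> \<subseteq> \<Q>}"
    have "\<exists>J\<in>?B. \<forall>K\<in>?B. J \<subseteq> K \<longrightarrow> K = J"
    proof (rule exists_maximal_ideal)
      show "?B \<noteq> {}" by blast
      show "ideal K R" if "K \<in> ?B" for K
        using that y by (auto intro!: genideal_ideal)
    qed
    then obtain J where J: "J \<in> ?B" and max: "\<And>K. K \<in> ?B \<Longrightarrow> J \<subseteq> K \<Longrightarrow> K = J"
      by meson
    from J obtain \<F> where \<F>: "finite \<F>" "\<F> \<subseteq> \<Q>" "J = Idl (y ` \<F>)" by auto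
    have carr: "y ` \<G> \<subseteq> carrier R" if "\<G> \<subseteq> \<Q>" for \<G> using y that by auto
    have "Q \<in> \<F>" if Q: "Q \<in> \<Q>" for Q
    proof (rule ccontr)
      assume nQ: "Q \<notin> \<F>"
      interpret Q: primeideal Q R using prime Q .
      have "Idl (y ` \<F>) \<subseteq> Idl (y ` insert Q \<F>)"
        using carr[of "insert Q \<F>"] \<F>(2) Q by (intro subset_Idl_subset) auto
      then have "Idl (y ` insert Q \<F>) = J"
        using \<F> Q by (intro max) (auto intro!: exI[of _ "insert Q \<F>"])
      then have yQ: "y Q \<in> Idl (y ` \<F>)"
        using genideal_self[OF carr[of "insert Q \<F>"]] \<F> Q by auto
      have "ideal P R \<and> \<not> P \<subseteq> Q" if P: "P \<in> \<F>" for P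
      proof
        show "ideal P R" using P \<F>(2) by (intro primeideal.axioms(1) prime) auto
        have "\<forall>J\<in>?A. P \<subseteq> J \<longrightarrow> J = P" and "Q \<in> ?A" using P \<F>(2) Q by (auto simp: \<Q>_def)
        then show "\<not> P \<subseteq> Q" using P nQ by metis
      qed
      \<comment> \<open>Distinct maximal colon ideals are incomparable, so some \<open>z\<close>
        outside \<open>Q\<close> lies in every \<open>P\<close> in \<open>\<F>\<close>. It
        multiplies each \<open>y P\<close> into \<open>I\<close>, hence also \<open>y Q\<close>,
        which puts \<open>z\<close> into \<open>Q\<close>.\<close>
      then obtain z where z: "z \<in> carrier R - Q" "\<forall>P\<in>\<F>. z \<in> P"
        using Q.exists_in_finite_Inter_notin[OF \<F>(1) _ oneideal] Q.one_notin by blast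
      have "Idl (y ` \<F>) \<subseteq> colon R I z"
      proof (rule genideal_minimal[OF ideal_colon[OF I]])
        show "y ` \<F> \<subseteq> colon R I z"
        proof
          fix w assume "w \<in> y ` \<F>"
          then obtain P where P: "P \<in> \<F>" "w = y P" by auto
          then have "z \<in> colon R I (y P)" using y \<F>(2) z(2) by blast
          then show "w \<in> colon R I z"
            using P y \<F>(2) by (auto simp: colon_def m_comm)
        qed
      qed (use z in auto)
      then have "y Q \<in> colon R I z" using yQ by blast
      then have "z \<in> colon R I (y Q)"
        using z(1) y[OF Q, THEN conjunct1] by (simp add: colon_def m_comm[of z])
      then show False using z(1) y[OF Q] by auto
    qed
    then have "\<Q> \<subseteq> \<F>" by blast
    then show ?thesis using \<F>(1) by (rule finite_subset)
  qed
  show thesis by (rule that[OF \<open>finite \<Q>\<close> conjI[OF prime] cover]) (use y in blast)+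
qed

text \<open>Among the ideals \<open>(I : t)\<close> with \<open>t\<close> outside
  \<open>\<pp>\<close> choose a maximal one, \<open>(I : s)\<close>; it equals
  \<open>(I : t s)\<close> for every such \<open>t\<close>. A single factor \<open>s\<close> thus
  serves all \<open>r\<close> whose class vanishes in the localization of \<open>R/I\<close> at
  \<open>\<pp>\<close>.\<close>

lemma saturation_bounded:
  assumes p: "primeideal \<pp> R" and I: "ideal I R"
  obtains s where "s \<in> carrier R - \<pp>"
    and "\<And>r t. r \<in> carrier R \<Longrightarrow> t \<in> carrier R - \<pp> \<Longrightarrow> t \<otimes> r \<in> I \<Longrightarrow> s \<otimes> r \<in> I"
proof -
  interpret p: primeideal \<pp> R by fact
  interpret I: ideal I R by fact
  have "\<exists>J\<in>colon R I ` (carrier R - \<pp>). \<forall>K\<in>colon R I ` (carrier R - \<pp>). J \<subseteq> K \<longrightarrow> K = J"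
  proof (rule exists_maximal_ideal)
    show "colon R I ` (carrier R - \<pp>) \<noteq> {}" using p.one_notin by blast
    show "ideal K R" if "K \<in> colon R I ` (carrier R - \<pp>)" for K
      using that ideal_colon[OF I] by blast
  qed
  then obtain J where J: "J \<in> colon R I ` (carrier R - \<pp>)"
    and max: "\<And>K. K \<in> colon R I ` (carrier R - \<pp>) \<Longrightarrow> J \<subseteq> K \<Longrightarrow> K = J"
    by meson
  from J obtain s where s: "s \<in> carrier R - \<pp>" "J = colon R I s" by auto
  have "s \<otimes> r \<in> I" if r: "r \<in> carrier R" and t: "t \<in> carrier R - \<pp>" and tr: "t \<otimes> r \<in> I" for r t
  proof -
    have "colon R I s \<subseteq> colon R I (t \<otimes> s)"
      using s t by (intro colon_subset_colon_mult[OF I]) auto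
    then have "colon R I (t \<otimes> s) = colon R I s"
      using max s p.compl_mult[OF t s(1)] by blast
    moreover have "r \<in> colon R I (t \<otimes> s)"
      using r t s tr I.I_r_closed[OF tr, of s] by (simp add: colon_def m_ac)
    ultimately show ?thesis using r s(1) by (auto simp: colon_def m_comm)
  qed
  then show thesis using that s(1) by blast
qed

text \<open>Localizing at \<open>\<pp>\<close> is replaced by enlarging \<open>I\<close> to the
  ideal \<open>K\<close> below. If \<open>\<pp>\<close> is covered by the maximal associated primes
  of \<open>R/K\<close>, prime avoidance puts it inside one of them, which then equals
  \<open>\<pp>\<close>; otherwise some element of \<open>\<pp>\<close> is regular on
  \<open>R/K\<close>.\<close>

lemma associated_or_locally_regular:
  assumes p: "primeideal \<pp> R" and I: "ideal I R" and sub: "I \<subseteq> \<pp>"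
  shows "(\<exists>y\<in>carrier R. colon R I y = \<pp>) \<or>
    (\<exists>x\<in>\<pp>. \<forall>r\<in>carrier R. x \<otimes> r \<in> I \<longrightarrow> (\<exists>s\<in>carrier R - \<pp>. s \<otimes> r \<in> I))"
proof -
  interpret p: primeideal \<pp> R by fact
  interpret I: ideal I R by fact
  obtain s where s: "s \<in> carrier R - \<pp>"
    and sat: "\<And>r t. r \<in> carrier R \<Longrightarrow> t \<in> carrier R - \<pp> \<Longrightarrow> t \<otimes> r \<in> I \<Longrightarrow> s \<otimes> r \<in> I"
    by (rule saturation_bounded[OF p I]) blast
  \<comment> \<open>\<open>K\<close> is the preimage of the extension of \<open>I\<close> to the
    localization at \<open>\<pp>\<close>, so elements outside \<open>\<pp>\<close> are regular
    modulo \<open>K\<close>.\<close>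
  define K where "K = colon R I s"
  have K: "ideal K R" unfolding K_def using s by (intro ideal_colon[OF I]) auto
  have memK: "r \<in> K \<longleftrightarrow> r \<in> carrier R \<and> s \<otimes> r \<in> I" for r
    using s by (auto simp: K_def colon_def m_comm)
  have satK: "r \<in> K" if r: "r \<in> carrier R" and t: "t \<in> carrier R - \<pp>" and "t \<otimes> r \<in> K" for r t
    using that s sat[OF r p.compl_mult[OF s t]] by (auto simp: memK m_assoc)
  obtain \<Q> where \<Q>: "finite \<Q>"
    "\<And>Q. Q \<in> \<Q> \<Longrightarrow> primeideal Q R \<and> (\<exists>y\<in>carrier R - K. Q = colon R K y)"
    "\<And>y. y \<in> carrier R - K \<Longrightarrow> \<exists>Q\<in>\<Q>. colon R K y \<subseteq> Q"
    by (rule zero_divisors_finite_colon_primes[OF K]) blast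
  show ?thesis
  proof (cases "\<pp> \<subseteq> \<Union>\<Q>")
    case True
    then obtain Q where Q: "Q \<in> \<Q>" "\<pp> \<subseteq> Q" using prime_avoidance[OF \<Q>(1) _ p.is_ideal] \<Q>(2) by blast
    then obtain y where y: "y \<in> carrier R - K" "Q = colon R K y" using \<Q>(2) by blast
    have "colon R I (s \<otimes> y) = \<pp>"
    proof (intro equalityI subsetI)
      fix r assume "r \<in> colon R I (s \<otimes> y)"
      then have r: "r \<in> carrier R" "r \<otimes> y \<in> K"
        using y s by (auto simp: colon_def memK m_lcomm)
      \<comment> \<open>Otherwise \<open>r\<close> would be a factor outside \<open>\<pp>\<close>,
        and saturation would put \<open>y\<close> into \<open>K\<close>.\<close>
      then show "r \<in> \<pp>" using satK[of y r] y by auto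
    next
      fix r assume "r \<in> \<pp>"
      then have "r \<in> carrier R" "r \<otimes> y \<in> K" using Q y by (auto simp: colon_def)
      then show "r \<in> colon R I (s \<otimes> y)" using y s by (auto simp: colon_def memK m_lcomm)
    qed
    then show ?thesis using y s by blast
  next
    case False
    then obtain x where x: "x \<in> \<pp>" "x \<notin> \<Union>\<Q>" by blast
    have "\<exists>t\<in>carrier R - \<pp>. t \<otimes> r \<in> I" if r: "r \<in> carrier R" "x \<otimes> r \<in> I" for r
    proof -
      have "x \<otimes> r \<in> K" using r x s by (auto simp: memK intro: I.I_l_closed)
      then have "x \<in> colon R K r" using x by (auto simp: colon_def)
      then have "r \<in> K" using \<Q>(3)[of r] r x(2) by blast
      then show ?thesis using s by (auto simp: memK)
    qed
    then show ?thesis using x(1) by blast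
  qed
qed

end


section \<open>Maps out of free modules\<close>

lemma regular_module_simps [simp]:
  "carrier (regular_module R) = carrier R"
  "\<zero>\<^bsub>regular_module R\<^esub> = \<zero>\<^bsub>R\<^esub>"
  "a \<oplus>\<^bsub>regular_module R\<^esub> b = a \<oplus>\<^bsub>R\<^esub> b"
  "a \<odot>\<^bsub>regular_module R\<^esub> b = a \<otimes>\<^bsub>R\<^esub> b"
  "\<ominus>\<^bsub>regular_module R\<^esub> a = \<ominus>\<^bsub>R\<^esub> a"
  "a \<ominus>\<^bsub>regular_module R\<^esub> b = a \<ominus>\<^bsub>R\<^esub> b"
  by (simp_all add: regular_module_def a_inv_def m_inv_def a_minus_def)

lemma (in cring) ideal_imp_submodule:
  assumes "ideal I R" shows "submodule I R (regular_module R)"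
proof -
  interpret I: ideal I R by fact
  show ?thesis
    by (rule Module.module.submoduleI[OF regular_module_is_module[OF is_cring]])
       (auto intro: I.Icarr I.I_l_closed)
qed

lemma (in abelian_group) minus_eq_zero_iff:
  assumes "x \<in> carrier G" and "y \<in> carrier G"
  shows "x \<ominus> y = \<zero> \<longleftrightarrow> x = y"
  using assms minus_equality[of x "\<ominus> y"] by (auto simp: minus_eq r_neg)

lemma (in Module.module) submodule_zero: "submodule H R M \<Longrightarrow> \<zero>\<^bsub>M\<^esub> \<in> H"
  using submodule.axioms(1) subgroup.one_closed by fastforce

lemma (in Module.module) submodule_minus:
  "submodule H R M \<Longrightarrow> x \<in> H \<Longrightarrow> y \<in> H \<Longrightarrow> x \<ominus>\<^bsub>M\<^esub> y \<in> H"
  by (simp add: a_minus_def submoduleE)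

lemma (in Module.module) zero_submodule: "submodule {\<zero>\<^bsub>M\<^esub>} R M"
  by (rule submoduleI) auto

text \<open>The set is \<open>H + Rm\<close>, written through its membership test because the
  coefficient \<open>r\<close> is used later.\<close>

lemma (in Module.module) submodule_insert:
  assumes H: "submodule H R M" and m: "m \<in> carrier M"
  shows "submodule {x \<in> carrier M. \<exists>r\<in>carrier R. x \<ominus>\<^bsub>M\<^esub> r \<odot>\<^bsub>M\<^esub> m \<in> H} R M"
proof (rule submoduleI)
  note E = submoduleE[OF H]
  have Hc: "x \<in> carrier M" if "x \<in> H" for x using E(1) that by blast
  let ?K = "{x \<in> carrier M. \<exists>r\<in>carrier R. x \<ominus>\<^bsub>M\<^esub> r \<odot>\<^bsub>M\<^esub> m \<in> H}"
  have I: "x \<in> ?K" if "x \<in> carrier M" "r \<in> carrier R" "x \<ominus>\<^bsub>M\<^esub> r \<odot>\<^bsub>M\<^esub> m = h" "h \<in> H" for x r h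
    using that by auto
  show "?K \<subseteq> carrier M" by auto
  show "\<zero>\<^bsub>M\<^esub> \<in> ?K"
    by (rule I[of _ "\<zero>\<^bsub>R\<^esub>" "\<zero>\<^bsub>M\<^esub>"]) (use m submodule_zero[OF H] in \<open>auto simp: a_minus_def\<close>)
  show "\<ominus>\<^bsub>M\<^esub> x \<in> ?K" if "x \<in> ?K" for x
  proof -
    obtain r where r: "x \<in> carrier M" "r \<in> carrier R" "x \<ominus>\<^bsub>M\<^esub> r \<odot>\<^bsub>M\<^esub> m \<in> H" using \<open>x \<in> ?K\<close> by auto
    show ?thesis
      by (rule I[of _ "\<ominus>\<^bsub>R\<^esub> r", OF _ _ _ E(3)[OF r(3)]])
         (use r m in \<open>auto simp: a_minus_def smult_l_minus minus_add\<close>)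
  qed
  show "x \<oplus>\<^bsub>M\<^esub> y \<in> ?K" if "x \<in> ?K" "y \<in> ?K" for x y
  proof -
    obtain r where r: "x \<in> carrier M" "r \<in> carrier R" "x \<ominus>\<^bsub>M\<^esub> r \<odot>\<^bsub>M\<^esub> m \<in> H" using \<open>x \<in> ?K\<close> by auto
    obtain s where s: "y \<in> carrier M" "s \<in> carrier R" "y \<ominus>\<^bsub>M\<^esub> s \<odot>\<^bsub>M\<^esub> m \<in> H" using \<open>y \<in> ?K\<close> by auto
    show ?thesis
      by (rule I[of _ "r \<oplus>\<^bsub>R\<^esub> s", OF _ _ _ E(5)[OF r(3) s(3)]])
         (use r s m in \<open>auto simp: a_minus_def smult_l_distr minus_add a_ac\<close>)
  qed
  show "a \<odot>\<^bsub>M\<^esub> x \<in> ?K" if a: "a \<in> carrier R" and "x \<in> ?K" for a x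
  proof -
    obtain r where r: "x \<in> carrier M" "r \<in> carrier R" "x \<ominus>\<^bsub>M\<^esub> r \<odot>\<^bsub>M\<^esub> m \<in> H" using \<open>x \<in> ?K\<close> by auto
    show ?thesis
      by (rule I[of _ "a \<otimes>\<^bsub>R\<^esub> r", OF _ _ _ E(4)[OF a r(3)]])
         (use r a m in \<open>auto simp: a_minus_def smult_r_distr smult_r_minus smult_assoc1\<close>)
  qed
qed

lemma (in Module.module) smult_mod_hom:
  "r \<in> carrier R \<Longrightarrow> (\<lambda>x. r \<odot>\<^bsub>M\<^esub> x) \<in> mod_hom R M M"
  by (auto simp: mod_hom_def smult_r_distr smult_assoc1[symmetric] m_comm)

lemma (in Module.module) orbit_mod_hom:
  "x \<in> carrier M \<Longrightarrow> (\<lambda>r. r \<odot>\<^bsub>M\<^esub> x) \<in> mod_hom R (regular_module R) M"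
  by (auto simp: mod_hom_def smult_l_distr smult_assoc1)

lemma mod_hom_comp:
  "f \<in> mod_hom R L M \<Longrightarrow> g \<in> mod_hom R M N \<Longrightarrow> (\<lambda>x. g (f x)) \<in> mod_hom R L N"
  by (auto simp: mod_hom_def Pi_def)

lemma mod_hom_minus:
  assumes "Module.module R M" and "f \<in> mod_hom R L M" and "g \<in> mod_hom R L M"
  shows "(\<lambda>x. f x \<ominus>\<^bsub>M\<^esub> g x) \<in> mod_hom R L M"
proof -
  interpret Module.module R M by fact
  show ?thesis
    using assms(2,3)
    by (auto simp: mod_hom_def Pi_def a_minus_def minus_add a_ac smult_r_distr smult_r_minus)
qed

lemma mod_hom_zero:
  assumes "Module.module R L" and "Module.module R M" and "f \<in> mod_hom R L M"
  shows "f \<zero>\<^bsub>L\<^esub> = \<zero>\<^bsub>M\<^esub>"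
proof -
  interpret L: Module.module R L by fact
  interpret M: Module.module R M by fact
  show ?thesis
    using mod_homD(3)[OF assms(3), of "\<zero>\<^bsub>R\<^esub>" "\<zero>\<^bsub>L\<^esub>"] mod_homD(1)[OF assms(3), of "\<zero>\<^bsub>L\<^esub>"] by simp
qed

definition unit_vec :: "('a, 'm) ring_scheme \<Rightarrow> 'i \<Rightarrow> 'i \<Rightarrow> 'a"
  where "unit_vec R i = (\<lambda>j. if j = i then \<one>\<^bsub>R\<^esub> else \<zero>\<^bsub>R\<^esub>)"

lemma (in cring) unit_vec_closed:
  assumes "i \<in> X" shows "unit_vec R i \<in> carrier (free_module R X)"
proof -
  have "{j. unit_vec R i j \<noteq> \<zero>} \<subseteq> {i}" by (auto simp: unit_vec_def)
  then show ?thesis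
    using assms finite_subset[of _ "{i}"] by (auto simp: free_module_simps unit_vec_def)
qed

lemma free_lift_unit_vec:
  assumes "Module.module R N" and g: "g \<in> X \<rightarrow> carrier N" and i: "i \<in> X"
  shows "free_lift R N g (unit_vec R i) = g i"
proof -
  interpret Module.module R N by fact
  have "free_lift R N g (unit_vec R i) = (\<Oplus>\<^bsub>N\<^esub>j\<in>{i}. unit_vec R i j \<odot>\<^bsub>N\<^esub> g j)"
    by (rule free_lift_superset[OF assms(1) g unit_vec_closed[OF i]])
       (use i in \<open>auto simp: unit_vec_def\<close>)
  then show ?thesis using g i by (simp add: unit_vec_def Pi_def)
qed

text \<open>Elements of a free module have finite support, so induction over a finite set containing
  the support reaches every \<open>f\<close>, even if \<open>X\<close> is infinite.\<close>

lemma free_module_hom_image_subset: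
  assumes N: "Module.module R N" and u: "u \<in> mod_hom R (free_module R X) N"
    and H: "submodule H R N" and gen: "\<And>i. i \<in> X \<Longrightarrow> u (unit_vec R i) \<in> H"
    and f: "f \<in> carrier (free_module R X)"
  shows "u f \<in> H"
proof -
  interpret N: Module.module R N by fact
  interpret F: Module.module R "free_module R X"
    by (rule free_module_is_module) (rule N.R.is_cring)
  note E = N.submoduleE[OF H]
  have "\<And>f. f \<in> carrier (free_module R X) \<Longrightarrow> {i. f i \<noteq> \<zero>\<^bsub>R\<^esub>} \<subseteq> S \<Longrightarrow> u f \<in> H"
    if "finite S" "S \<subseteq> X" for S
    using that
  proof (induction S rule: finite_induct)
    case (empty f)
    then have "f = \<zero>\<^bsub>free_module R X\<^esub>" by (auto simp: free_module_simps)
    then show ?case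
      using mod_hom_zero[OF F.module_axioms N u] N.submodule_zero[OF H] by simp
  next
    case (insert i S f)
    \<comment> \<open>Splitting off the \<open>i\<close>-th coordinate leaves an element supported
      in \<open>S\<close>.\<close>
    define g where "g = f(i := \<zero>\<^bsub>R\<^esub>)"
    have fi: "f i \<in> carrier R" and i: "i \<in> X" using insert by (auto simp: free_module_simps)
    have "{j. g j \<noteq> \<zero>\<^bsub>R\<^esub>} \<subseteq> {j. f j \<noteq> \<zero>\<^bsub>R\<^esub>}" by (auto simp: g_def)
    from finite_subset[OF this] have g: "g \<in> carrier (free_module R X)"
      using insert.prems(1) by (auto simp: free_module_simps g_def)
    have "{j. g j \<noteq> \<zero>\<^bsub>R\<^esub>} \<subseteq> S" using insert.prems(2) by (auto simp: g_def)
    then have ug: "u g \<in> H" using insert.IH[of g] g insert.prems by auto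
    have "f = f i \<odot>\<^bsub>free_module R X\<^esub> unit_vec R i \<oplus>\<^bsub>free_module R X\<^esub> g"
      using insert.prems(1) by (auto simp: free_module_simps g_def unit_vec_def fun_eq_iff)
    then have "u f = f i \<odot>\<^bsub>N\<^esub> u (unit_vec R i) \<oplus>\<^bsub>N\<^esub> u g"
      using mod_homD(2,3)[OF u] fi g N.R.unit_vec_closed[OF i] by (metis F.smult_closed)
    then show ?case using E(4,5) gen[OF i] fi ug by simp
  qed
  then show ?thesis using f by (auto simp: free_module_simps)
qed

text \<open>Projectivity of a free module: lift each basis vector and extend linearly. Working
  modulo \<open>H\<close> covers targets \<open>N/H\<close> without forming the quotient;
  \<open>H = 0\<close> gives honest lifts.\<close>

lemma free_module_lift_mod:
  assumes L: "Module.module R L" and N: "Module.module R N"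
    and g: "g \<in> mod_hom R L N" and h: "h \<in> mod_hom R (free_module R X) N"
    and H: "submodule H R N"
    and ex: "\<And>f. f \<in> carrier (free_module R X) \<Longrightarrow> \<exists>c\<in>carrier L. h f \<ominus>\<^bsub>N\<^esub> g c \<in> H"
  shows "\<exists>k\<in>mod_hom R (free_module R X) L.
    \<forall>f\<in>carrier (free_module R X). h f \<ominus>\<^bsub>N\<^esub> g (k f) \<in> H"
proof -
  interpret N: Module.module R N by fact
  have "\<forall>i\<in>X. \<exists>c. c \<in> carrier L \<and> h (unit_vec R i) \<ominus>\<^bsub>N\<^esub> g c \<in> H"
    using ex[OF N.R.unit_vec_closed] by auto
  from bchoice[OF this] obtain c
    where c: "\<forall>i\<in>X. c i \<in> carrier L \<and> h (unit_vec R i) \<ominus>\<^bsub>N\<^esub> g (c i) \<in> H" ..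
  then have cX: "c \<in> X \<rightarrow> carrier L" by auto
  define k where "k = free_lift R L c"
  have k: "k \<in> mod_hom R (free_module R X) L" unfolding k_def by (rule free_lift_hom[OF L cX])
  have "h f \<ominus>\<^bsub>N\<^esub> g (k f) \<in> H" if "f \<in> carrier (free_module R X)" for f
    by (rule free_module_hom_image_subset[OF N mod_hom_minus[OF N h mod_hom_comp[OF k g]] H _ that])
       (use c in \<open>auto simp: k_def free_lift_unit_vec[OF L cX]\<close>)
  with k show ?thesis by blast
qed


section \<open>Support and associated primes\<close>

text \<open>Trades finite sums for submodules: later uses only have to exhibit a submodule
  containing the generators.\<close>

lemma finitely_generated_moduleE:
  assumes M: "Module.module R M" and "finitely_generated_module R M"
  obtains A where "finite A" and "A \<subseteq> carrier M"
    and "\<And>H. submodule H R M \<Longrightarrow> A \<subseteq> H \<Longrightarrow> H = carrier M"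
proof -
  interpret Module.module R M by fact
  obtain A where A: "finite A" "A \<subseteq> carrier M"
    and gen: "carrier M = {\<Oplus>\<^bsub>M\<^esub>x\<in>A. c x \<odot>\<^bsub>M\<^esub> x | c. c \<in> A \<rightarrow> carrier R}"
    using assms(2) unfolding finitely_generated_module_def by blast
  have "H = carrier M" if H: "submodule H R M" and AH: "A \<subseteq> H" for H
  proof
    note E = submoduleE[OF H]
    show "H \<subseteq> carrier M" by (rule E(1))
    show "carrier M \<subseteq> H"
    proof
      fix z assume "z \<in> carrier M"
      then obtain c where c: "c \<in> A \<rightarrow> carrier R" and z: "z = (\<Oplus>\<^bsub>M\<^esub>x\<in>A. c x \<odot>\<^bsub>M\<^esub> x)"
        using gen by auto
      have "(\<Oplus>\<^bsub>M\<^esub>x\<in>B. c x \<odot>\<^bsub>M\<^esub> x) \<in> H" if "B \<subseteq> A" for B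
        using finite_subset[OF that A(1)] that
      proof (induction B rule: finite_induct)
        case empty
        then show ?case using submodule_zero[OF H] by simp
      next
        case (insert b B)
        have "(\<Oplus>\<^bsub>M\<^esub>x\<in>insert b B. c x \<odot>\<^bsub>M\<^esub> x) = c b \<odot>\<^bsub>M\<^esub> b \<oplus>\<^bsub>M\<^esub> (\<Oplus>\<^bsub>M\<^esub>x\<in>B. c x \<odot>\<^bsub>M\<^esub> x)"
          using insert c A(2) by (intro finsum_insert) (auto simp: Pi_def subset_iff)
        then show ?case using insert c AH by (auto simp: Pi_def subset_iff intro!: E(4,5))
      qed
      then show "z \<in> H" by (simp add: z)
    qed
  qed
  then show thesis using that A by blast
qed

text \<open>The fraction \<open>x/s\<close> vanishes exactly when some element outside
  \<open>\<pp>\<close> kills \<open>x\<close>, whatever the denominator \<open>s\<close>.\<close>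

lemma mem_Supp_iff:
  assumes M: "Module.module R M" and p: "primeideal \<pp> R"
  shows "\<pp> \<in> Supp R M \<longleftrightarrow> (\<exists>x\<in>carrier M. \<forall>s\<in>carrier R - \<pp>. s \<odot>\<^bsub>M\<^esub> x \<noteq> \<zero>\<^bsub>M\<^esub>)"
proof -
  interpret Module.module R M by fact
  interpret p: primeideal \<pp> R by fact
  let ?L = "localized_module R M \<pp>" and ?S = "carrier R - \<pp>"
  let ?f = "\<lambda>x s. frac_rel R M \<pp> `` {(x, s)}"
  have one: "\<one>\<^bsub>R\<^esub> \<in> ?S" using p.one_notin by auto
  have carr: "carrier ?L = {?f x s | x s. x \<in> carrier M \<and> s \<in> ?S}"
    by (auto simp: localized_module_def quotient_def)
  have zero: "\<zero>\<^bsub>?L\<^esub> = ?f \<zero>\<^bsub>M\<^esub> \<one>\<^bsub>R\<^esub>" by (simp add: localized_module_def)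
  have eq: "?f x s = \<zero>\<^bsub>?L\<^esub> \<longleftrightarrow> (\<exists>u\<in>?S. u \<odot>\<^bsub>M\<^esub> x = \<zero>\<^bsub>M\<^esub>)" if x: "x \<in> carrier M" and s: "s \<in> ?S" for x s
  proof -
    have "?f x s = \<zero>\<^bsub>?L\<^esub> \<longleftrightarrow> ((x, s), (\<zero>\<^bsub>M\<^esub>, \<one>\<^bsub>R\<^esub>)) \<in> frac_rel R M \<pp>"
      unfolding zero by (rule eq_equiv_class_iff[OF equiv_frac_rel[OF M p]]) (use x s one in auto)
    also have "\<dots> \<longleftrightarrow> (\<exists>u\<in>?S. u \<odot>\<^bsub>M\<^esub> x = \<zero>\<^bsub>M\<^esub>)" using x s one by (auto simp: frac_rel_def)
    finally show ?thesis .
  qed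
  have "\<zero>\<^bsub>?L\<^esub> \<in> carrier ?L"
    using localized_module_is_module[OF M p] by (simp add: abelian_group.axioms abelian_monoid.zero_closed module_def)
  then have "carrier ?L \<noteq> {\<zero>\<^bsub>?L\<^esub>} \<longleftrightarrow> (\<exists>A\<in>carrier ?L. A \<noteq> \<zero>\<^bsub>?L\<^esub>)" by auto
  then have "\<pp> \<in> Supp R M \<longleftrightarrow> (\<exists>x\<in>carrier M. \<exists>s\<in>?S. ?f x s \<noteq> \<zero>\<^bsub>?L\<^esub>)"
    using p by (simp add: Supp_def carr) blast
  also have "\<dots> \<longleftrightarrow> (\<exists>x\<in>carrier M. \<forall>s\<in>?S. s \<odot>\<^bsub>M\<^esub> x \<noteq> \<zero>\<^bsub>M\<^esub>)"
    using one by (auto simp: eq)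
  finally show ?thesis .
qed

text \<open>If \<open>M\<close> vanished at \<open>\<pp>\<close>, each generator would be killed by
  an element outside \<open>\<pp>\<close>; the product of these finitely many elements would
  annihilate \<open>M\<close> and still lie outside \<open>\<pp>\<close>.\<close>

lemma annihilator_subset_imp_mem_Supp:
  assumes M: "Module.module R M" and fg: "finitely_generated_module R M" and p: "primeideal \<pp> R"
    and ann: "\<And>s. s \<in> carrier R \<Longrightarrow> \<forall>x\<in>carrier M. s \<odot>\<^bsub>M\<^esub> x = \<zero>\<^bsub>M\<^esub> \<Longrightarrow> s \<in> \<pp>"
  shows "\<pp> \<in> Supp R M"
proof (rule ccontr)
  interpret Module.module R M by fact
  interpret p: primeideal \<pp> R by fact
  assume "\<pp> \<notin> Supp R M"
  then have tors: "\<exists>s\<in>carrier R - \<pp>. s \<odot>\<^bsub>M\<^esub> x = \<zero>\<^bsub>M\<^esub>" if "x \<in> carrier M" for x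
    using mem_Supp_iff[OF M p] that by auto
  obtain A where A: "finite A" "A \<subseteq> carrier M"
    and gen: "\<And>H. submodule H R M \<Longrightarrow> A \<subseteq> H \<Longrightarrow> H = carrier M"
    by (rule finitely_generated_moduleE[OF M fg]) blast
  have "\<exists>s\<in>carrier R - \<pp>. \<forall>x\<in>A. s \<odot>\<^bsub>M\<^esub> x = \<zero>\<^bsub>M\<^esub>"
    using A
  proof (induction A rule: finite_induct)
    case empty
    then show ?case using p.one_notin by auto
  next
    case (insert a A)
    then obtain s where s: "s \<in> carrier R - \<pp>" "\<forall>x\<in>A. s \<odot>\<^bsub>M\<^esub> x = \<zero>\<^bsub>M\<^esub>" by auto
    obtain t where t: "t \<in> carrier R - \<pp>" "t \<odot>\<^bsub>M\<^esub> a = \<zero>\<^bsub>M\<^esub>" using tors insert.prems by auto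
    have "(s \<otimes>\<^bsub>R\<^esub> t) \<odot>\<^bsub>M\<^esub> x = \<zero>\<^bsub>M\<^esub>" if "x \<in> insert a A" for x
    proof (cases "x = a")
      case True
      then show ?thesis using s t insert.prems by (simp add: smult_assoc1)
    next
      case False
      then have "(t \<otimes>\<^bsub>R\<^esub> s) \<odot>\<^bsub>M\<^esub> x = \<zero>\<^bsub>M\<^esub>" using s t insert.prems that by (auto simp: smult_assoc1)
      then show ?thesis using s t by (simp add: m_comm)
    qed
    then show ?case using p.compl_mult[OF s(1) t(1)] by blast
  qed
  then obtain s where s: "s \<in> carrier R - \<pp>" "\<forall>x\<in>A. s \<odot>\<^bsub>M\<^esub> x = \<zero>\<^bsub>M\<^esub>" ..
  have "{x \<in> carrier M. s \<odot>\<^bsub>M\<^esub> x = \<zero>\<^bsub>M\<^esub>} = carrier M"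
    by (intro gen mod_hom_kernel_submodule[OF M M] smult_mod_hom) (use s A in auto)
  then show False using ann[of s] s(1) by auto
qed

text \<open>In lieu of Nakayama's lemma: at \<open>\<pp>\<close>, the quotient \<open>M/W\<close> becomes cyclic and nonzero.\<close>

lemma exists_local_cyclic_quotient:
  assumes M: "Module.module R M" and fg: "finitely_generated_module R M" and p: "\<pp> \<in> Supp R M"
  obtains W m s where "submodule W R M" and "m \<in> carrier M" and "s \<in> carrier R - \<pp>"
    and "\<And>x. x \<in> carrier M \<Longrightarrow> \<exists>r\<in>carrier R. s \<odot>\<^bsub>M\<^esub> x \<ominus>\<^bsub>M\<^esub> r \<odot>\<^bsub>M\<^esub> m \<in> W"
    and "\<And>r. r \<in> carrier R \<Longrightarrow> r \<odot>\<^bsub>M\<^esub> m \<in> W \<Longrightarrow> r \<in> \<pp>"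
proof -
  interpret Module.module R M by fact
  have pr: "primeideal \<pp> R" using p by (simp add: Supp_def)
  interpret p: primeideal \<pp> R by (rule pr)
  let ?S = "carrier R - \<pp>"
  \<comment> \<open>The generators in \<open>A\<close> are adjoined to \<open>W\<close> one at a
    time. The invariant is the last assumption, that \<open>M/W\<close> does not vanish at
    \<open>\<pp>\<close>; once \<open>A\<close> is empty it contradicts
    \<open>W = M\<close>.\<close>
  have key: "\<exists>W m s. submodule W R M \<and> m \<in> carrier M \<and> s \<in> ?S \<and>
      (\<forall>x\<in>carrier M. \<exists>r\<in>carrier R. s \<odot>\<^bsub>M\<^esub> x \<ominus>\<^bsub>M\<^esub> r \<odot>\<^bsub>M\<^esub> m \<in> W) \<and>
      (\<forall>r\<in>carrier R. r \<odot>\<^bsub>M\<^esub> m \<in> W \<longrightarrow> r \<in> \<pp>)"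
    if "finite A" "A \<subseteq> carrier M" "submodule W R M"
      "\<And>H. submodule H R M \<Longrightarrow> W \<subseteq> H \<Longrightarrow> A \<subseteq> H \<Longrightarrow> H = carrier M"
      "\<not> (\<exists>s\<in>?S. \<forall>x\<in>carrier M. s \<odot>\<^bsub>M\<^esub> x \<in> W)" for A W
    using that
  proof (induction A arbitrary: W rule: finite_induct)
    case empty
    then have "W = carrier M" by auto
    then show ?case using empty.prems(4) p.one_notin by (metis DiffI R.one_closed smult_closed)
  next
    case (insert a A W)
    note E = submoduleE[OF insert.prems(2)]
    have a: "a \<in> carrier M" using insert.prems(1) by auto
    define V where "V = {x \<in> carrier M. \<exists>r\<in>carrier R. x \<ominus>\<^bsub>M\<^esub> r \<odot>\<^bsub>M\<^esub> a \<in> W}"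
    have V: "submodule V R M" unfolding V_def by (rule submodule_insert[OF insert.prems(2) a])
    have "x \<in> V" if "x \<in> W" for x
    proof -
      have "x \<in> carrier M" using that E(1) by blast
      then have "x \<ominus>\<^bsub>M\<^esub> \<zero>\<^bsub>R\<^esub> \<odot>\<^bsub>M\<^esub> a = x" using a by (simp add: a_minus_def)
      then show ?thesis using that \<open>x \<in> carrier M\<close> unfolding V_def by force
    qed
    then have WV: "W \<subseteq> V" by blast
    have "a \<ominus>\<^bsub>M\<^esub> \<one>\<^bsub>R\<^esub> \<odot>\<^bsub>M\<^esub> a \<in> W" using a submodule_zero[OF insert.prems(2)] by (simp add: a_minus_def r_neg)
    then have aV: "a \<in> V" using a unfolding V_def by blast
    \<comment> \<open>If \<open>M/V\<close> still does not vanish at \<open>\<pp>\<close>, continue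
      with \<open>V = W + Ra\<close>. Otherwise \<open>M/W\<close> is generated by \<open>a\<close>
      at \<open>\<pp>\<close>, and \<open>a\<close> serves as \<open>m\<close>.\<close>
    show ?case
    proof (cases "\<exists>s\<in>?S. \<forall>x\<in>carrier M. s \<odot>\<^bsub>M\<^esub> x \<in> V")
      case False
      show ?thesis
      proof (rule insert.IH[OF _ V _ False])
        show "A \<subseteq> carrier M" using insert.prems(1) by auto
        show "H = carrier M" if "submodule H R M" "V \<subseteq> H" "A \<subseteq> H" for H
          using that WV aV by (intro insert.prems(3)) auto
      qed
    next
      case True
      then obtain s where s: "s \<in> ?S" "\<forall>x\<in>carrier M. s \<odot>\<^bsub>M\<^esub> x \<in> V" by blast
      \<comment> \<open>If \<open>r\<close> were outside \<open>\<pp>\<close> with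
        \<open>r a\<close> in \<open>W\<close>, then \<open>r s\<close> would carry all of
        \<open>M\<close> into \<open>W\<close>, against the invariant.\<close>
      have "r \<in> \<pp>" if r: "r \<in> carrier R" "r \<odot>\<^bsub>M\<^esub> a \<in> W" for r
      proof (rule ccontr)
        assume "r \<notin> \<pp>"
        then have rs: "r \<otimes>\<^bsub>R\<^esub> s \<in> ?S" using r s p.compl_mult by blast
        have "(r \<otimes>\<^bsub>R\<^esub> s) \<odot>\<^bsub>M\<^esub> x \<in> W" if x: "x \<in> carrier M" for x
        proof -
          obtain q where q: "q \<in> carrier R" "s \<odot>\<^bsub>M\<^esub> x \<ominus>\<^bsub>M\<^esub> q \<odot>\<^bsub>M\<^esub> a \<in> W"
            using s(2) x by (auto simp: V_def)
          have "r \<odot>\<^bsub>M\<^esub> (s \<odot>\<^bsub>M\<^esub> x \<ominus>\<^bsub>M\<^esub> q \<odot>\<^bsub>M\<^esub> a) \<oplus>\<^bsub>M\<^esub> q \<odot>\<^bsub>M\<^esub> (r \<odot>\<^bsub>M\<^esub> a) \<in> W"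
            using E(4,5) q r by blast
          moreover have "q \<odot>\<^bsub>M\<^esub> (r \<odot>\<^bsub>M\<^esub> a) = r \<odot>\<^bsub>M\<^esub> (q \<odot>\<^bsub>M\<^esub> a)"
            using q r a by (simp add: smult_assoc1[symmetric] m_comm)
          moreover have "r \<odot>\<^bsub>M\<^esub> (s \<odot>\<^bsub>M\<^esub> x \<ominus>\<^bsub>M\<^esub> q \<odot>\<^bsub>M\<^esub> a) \<oplus>\<^bsub>M\<^esub> r \<odot>\<^bsub>M\<^esub> (q \<odot>\<^bsub>M\<^esub> a) = (r \<otimes>\<^bsub>R\<^esub> s) \<odot>\<^bsub>M\<^esub> x"
            using q r s x a
            by (simp add: a_minus_def smult_r_distr smult_r_minus smult_assoc1 a_assoc l_neg)
          ultimately show ?thesis by simp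
        qed
        then show False using insert.prems(4) rs by blast
      qed
      then show ?thesis using insert.prems(2) a s by (auto simp: V_def)
    qed
  qed
  obtain A where A: "finite A" "A \<subseteq> carrier M"
    and gen: "\<And>H. submodule H R M \<Longrightarrow> A \<subseteq> H \<Longrightarrow> H = carrier M"
    by (rule finitely_generated_moduleE[OF M fg]) blast
  have "\<not> (\<exists>s\<in>?S. \<forall>x\<in>carrier M. s \<odot>\<^bsub>M\<^esub> x \<in> {\<zero>\<^bsub>M\<^esub>})"
    using p mem_Supp_iff[OF M pr] by blast
  from key[OF A zero_submodule gen this] show thesis using that by blast
qed

section \<open>Primes minimal in the support, and torsion that makes a prime associated\<close>

lemma (in noetherian_cring) exists_prime_avoiding:
  assumes I: "ideal I R" and T: "\<one> \<in> T" "T \<subseteq> carrier R" "\<And>s t. s \<in> T \<Longrightarrow> t \<in> T \<Longrightarrow> s \<otimes> t \<in> T"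
    and disj: "I \<inter> T = {}"
  obtains Q where "primeideal Q R" and "I \<subseteq> Q" and "Q \<inter> T = {}"
proof -
  let ?A = "{J. ideal J R \<and> I \<subseteq> J \<and> J \<inter> T = {}}"
  have "\<exists>J\<in>?A. \<forall>K\<in>?A. J \<subseteq> K \<longrightarrow> K = J"
    by (rule exists_maximal_ideal) (use I disj in auto)
  then obtain Q where Q: "ideal Q R" "I \<subseteq> Q" "Q \<inter> T = {}"
    and max: "\<And>K. ideal K R \<Longrightarrow> K \<inter> T = {} \<Longrightarrow> Q \<subseteq> K \<Longrightarrow> K = Q"
    by auto
  interpret Q: ideal Q R by fact
  \<comment> \<open>By maximality of \<open>Q\<close>, the larger ideal \<open>Q + (x)\<close>
    cannot avoid \<open>T\<close>.\<close>
  have meets: "\<exists>t\<in>T. \<exists>b\<in>carrier R. t \<ominus> x \<otimes> b \<in> Q" if x: "x \<in> carrier R" "x \<notin> Q" for x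
  proof -
    let ?K = "{z \<in> carrier R. \<exists>b\<in>carrier R. z \<ominus> x \<otimes> b \<in> Q}"
    have K: "ideal ?K R" by (rule ideal_insert[OF Q(1) x(1)])
    have "z \<in> ?K" if "z \<in> Q" for z
    proof -
      have "z \<ominus> x \<otimes> \<zero> = z" using Q.Icarr[OF that] x by (simp add: a_minus_def)
      then show ?thesis using that Q.Icarr[OF that] by (metis (mono_tags, lifting) mem_Collect_eq zero_closed)
    qed
    moreover have "x \<ominus> x \<otimes> \<one> \<in> Q" using x by (simp add: a_minus_def r_neg)
    then have "x \<in> ?K" using x by blast
    ultimately show ?thesis using max[OF K] x(2) by blast
  qed
  have "primeideal Q R"
  proof (rule primeidealI[OF Q(1) is_cring])
    show "carrier R \<noteq> Q" using Q(3) T by auto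
    fix a b assume ab: "a \<in> carrier R" "b \<in> carrier R" "a \<otimes> b \<in> Q"
    show "a \<in> Q \<or> b \<in> Q"
    proof (rule ccontr)
      assume "\<not> (a \<in> Q \<or> b \<in> Q)"
      then obtain s c t d where s: "s \<in> T" "c \<in> carrier R" "s \<ominus> a \<otimes> c \<in> Q"
        and t: "t \<in> T" "d \<in> carrier R" "t \<ominus> b \<otimes> d \<in> Q"
        using meets ab by metis
      have st: "s \<in> carrier R" "t \<in> carrier R" using s t T(2) by auto
      \<comment> \<open>Combining both memberships with \<open>a b\<close> in \<open>Q\<close>
        cancels every term but \<open>s t\<close>, which therefore lies in \<open>Q\<close> as well
        as in \<open>T\<close>.\<close>
      have "t \<otimes> (s \<ominus> a \<otimes> c) \<oplus> ((a \<otimes> c) \<otimes> (t \<ominus> b \<otimes> d) \<oplus> (c \<otimes> d) \<otimes> (a \<otimes> b)) \<in> Q"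
        using s(2) t(2) st ab(1,2)
        by (intro Q.a_closed Q.I_l_closed[OF s(3)] Q.I_l_closed[OF t(3)] Q.I_l_closed[OF ab(3)]) auto
      also have "t \<otimes> (s \<ominus> a \<otimes> c) \<oplus> ((a \<otimes> c) \<otimes> (t \<ominus> b \<otimes> d) \<oplus> (c \<otimes> d) \<otimes> (a \<otimes> b)) = s \<otimes> t"
        using st s(2) t(2) ab(1,2) by (simp add: a_minus_def r_distr r_minus a_assoc l_neg r_neg m_ac r_neg1 r_neg2)
      finally show False using T(3)[OF s(1) t(1)] Q(3) by auto
    qed
  qed
  then show thesis using that Q by blast
qed

text \<open>Let \<open>T\<close> be the multiplicative set generated by \<open>a\<close> and the
  complement of \<open>\<pp>\<close>. If the annihilator of \<open>M\<close> missed
  \<open>T\<close>, so would some prime \<open>Q\<close> containing it; this \<open>Q\<close> is in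
  the support and inside \<open>\<pp>\<close>, but omits \<open>a\<close>, against minimality of
  \<open>\<pp>\<close>.\<close>

lemma (in noetherian_cring) min_Supp_power_annihilates:
  assumes M: "Module.module R M" and fg: "finitely_generated_module R M"
    and p: "\<pp> \<in> min_Supp R M" and a: "a \<in> \<pp>"
  shows "\<exists>n. \<exists>s\<in>carrier R - \<pp>. \<forall>x\<in>carrier M. (s \<otimes> a [^] (n::nat)) \<odot>\<^bsub>M\<^esub> x = \<zero>\<^bsub>M\<^esub>"
proof (rule ccontr)
  assume none: "\<not> ?thesis"
  interpret M: Module.module R M by fact
  interpret p: primeideal \<pp> R using p by (simp add: min_Supp_def Supp_def)
  have ac: "a \<in> carrier R" using a by auto
  define I where "I = {r \<in> carrier R. \<forall>x\<in>carrier M. r \<odot>\<^bsub>M\<^esub> x = \<zero>\<^bsub>M\<^esub>}"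
  define T where "T = {s \<otimes> a [^] (n::nat) | s n. s \<in> carrier R - \<pp>}"
  have I: "ideal I R"
  proof (rule idealI[OF ring_axioms])
    show "subgroup I (add_monoid R)"
      by (rule add.subgroupI) (auto simp: I_def M.smult_l_distr M.smult_l_minus intro!: exI[of _ \<zero>])
    show *: "x \<otimes> b \<in> I" if "b \<in> I" "x \<in> carrier R" for b x
      using that by (auto simp: I_def M.smult_assoc1)
    show "b \<otimes> x \<in> I" if "b \<in> I" "x \<in> carrier R" for b x
      using *[OF that] that by (simp add: m_comm I_def)
  qed
  have ST: "s \<in> T" if "s \<in> carrier R - \<pp>" for s
    unfolding T_def using that by (auto intro!: exI[of _ s] exI[of _ "0::nat"])
  have aT: "a \<in> T"
    unfolding T_def using p.one_notin ac by (auto intro!: exI[of _ \<one>] exI[of _ "1::nat"])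
  have "s \<otimes> t \<in> T" if s: "s \<in> T" and t: "t \<in> T" for s t
  proof -
    obtain u m where u: "u \<in> carrier R - \<pp>" "s = u \<otimes> a [^] (m::nat)"
      using s by (auto simp: T_def)
    obtain v n where v: "v \<in> carrier R - \<pp>" "t = v \<otimes> a [^] (n::nat)"
      using t by (auto simp: T_def)
    have "s \<otimes> t = (u \<otimes> v) \<otimes> a [^] (m + n)"
      using u v ac by (simp add: nat_pow_mult[symmetric] m_ac)
    then show ?thesis unfolding T_def using p.compl_mult[OF u(1) v(1)] by blast
  qed
  moreover have "I \<inter> T = {}" using none by (auto simp: I_def T_def)
  moreover have "\<one> \<in> T" using ST p.one_notin by auto
  moreover have "T \<subseteq> carrier R" using ac by (auto simp: T_def)
  ultimately obtain Q where Q: "primeideal Q R" "I \<subseteq> Q" "Q \<inter> T = {}"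
    using exists_prime_avoiding[OF I] by metis
  have "Q \<in> Supp R M"
    by (rule annihilator_subset_imp_mem_Supp[OF M fg Q(1)]) (use Q(2) in \<open>auto simp: I_def\<close>)
  moreover have "Q \<subseteq> \<pp>"
    using Q(3) ST ideal.Icarr[OF primeideal.axioms(1)[OF Q(1)]] by blast
  ultimately have "Q = \<pp>" using p by (auto simp: min_Supp_def)
  then show False using Q(3) aT a by blast
qed

text \<open>Choose a multiple \<open>x\<close> of \<open>e\<close> whose annihilator is maximal
  among those inside \<open>\<pp>\<close>. Any multiple of \<open>x\<close> whose annihilator is
  still inside \<open>\<pp>\<close> has the same annihilator as \<open>x\<close>; this is applied to
  \<open>s x\<close> for \<open>s\<close> outside \<open>\<pp>\<close> and to powers of
  \<open>a\<close> times \<open>x\<close>.\<close>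

lemma (in noetherian_cring) mem_Ass_if_power_torsion:
  assumes E: "Module.module R E" and p: "primeideal \<pp> R" and e: "e \<in> carrier E"
    and sub: "annihilator R E e \<subseteq> \<pp>"
    and pow: "\<And>a. a \<in> \<pp> \<Longrightarrow> \<exists>n. \<exists>s\<in>carrier R - \<pp>. (s \<otimes> a [^] (n::nat)) \<odot>\<^bsub>E\<^esub> e = \<zero>\<^bsub>E\<^esub>"
  shows "\<pp> \<in> Ass R E"
proof -
  interpret E: Module.module R E by fact
  interpret p: primeideal \<pp> R by fact
  let ?ann = "annihilator R E"
  have ann_ideal: "ideal (?ann x) R" if x: "x \<in> carrier E" for x
  proof (rule idealI[OF ring_axioms])
    show "subgroup (?ann x) (add_monoid R)"
      by (rule add.subgroupI) (use x in \<open>auto simp: annihilator_def E.smult_l_distr E.smult_l_minus intro!: exI[of _ \<zero>]\<close>)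
    show *: "r \<otimes> b \<in> ?ann x" if "b \<in> ?ann x" "r \<in> carrier R" for b r
      using that x by (auto simp: annihilator_def E.smult_assoc1)
    show "b \<otimes> r \<in> ?ann x" if "b \<in> ?ann x" "r \<in> carrier R" for b r
      using *[OF that] that by (simp add: m_comm annihilator_def)
  qed
  let ?A = "{?ann (r \<odot>\<^bsub>E\<^esub> e) | r. r \<in> carrier R \<and> ?ann (r \<odot>\<^bsub>E\<^esub> e) \<subseteq> \<pp>}"
  have "\<exists>I\<in>?A. \<forall>J\<in>?A. I \<subseteq> J \<longrightarrow> J = I"
  proof (rule exists_maximal_ideal)
    have "?ann (\<one> \<odot>\<^bsub>E\<^esub> e) \<subseteq> \<pp>" using sub e by simp
    then show "?A \<noteq> {}" by blast
  qed (use ann_ideal e in auto)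
  then obtain I where I: "I \<in> ?A" and max: "\<forall>J\<in>?A. I \<subseteq> J \<longrightarrow> J = I" by (elim bexE)
  then obtain r where r: "r \<in> carrier R" "?ann (r \<odot>\<^bsub>E\<^esub> e) \<subseteq> \<pp>" and Ir: "I = ?ann (r \<odot>\<^bsub>E\<^esub> e)" by auto
  define x where "x = r \<odot>\<^bsub>E\<^esub> e"
  have x: "x \<in> carrier E" using r e by (simp add: x_def)
  have annD: "b \<otimes> c \<in> ?ann x \<longleftrightarrow> b \<in> ?ann (c \<odot>\<^bsub>E\<^esub> x)" if "b \<in> carrier R" "c \<in> carrier R" for b c
    using that x by (auto simp: annihilator_def E.smult_assoc1)
  have max': "?ann (c \<odot>\<^bsub>E\<^esub> x) = ?ann x" if c: "c \<in> carrier R" "?ann (c \<odot>\<^bsub>E\<^esub> x) \<subseteq> \<pp>" for c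
  proof -
    have "c \<odot>\<^bsub>E\<^esub> x = (c \<otimes> r) \<odot>\<^bsub>E\<^esub> e" using c r e by (simp add: x_def E.smult_assoc1)
    moreover have "?ann x \<subseteq> ?ann (c \<odot>\<^bsub>E\<^esub> x)"
    proof
      fix b assume b: "b \<in> ?ann x"
      then have "b \<in> carrier R" by (simp add: annihilator_def)
      then show "b \<in> ?ann (c \<odot>\<^bsub>E\<^esub> x)"
        using annD[of b c] c(1) b ideal.I_r_closed[OF ann_ideal[OF x]] by blast
    qed
    moreover have "?ann ((c \<otimes> r) \<odot>\<^bsub>E\<^esub> e) \<in> ?A" if "?ann ((c \<otimes> r) \<odot>\<^bsub>E\<^esub> e) \<subseteq> \<pp>"
      using that c r by blast
    ultimately show ?thesis using max[rule_format, of "?ann ((c \<otimes> r) \<odot>\<^bsub>E\<^esub> e)"] c(2) Ir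
      by (simp add: x_def)
  qed
  \<comment> \<open>The annihilator of \<open>s x\<close> stays inside \<open>\<pp>\<close> by
    primality, so passing from \<open>x\<close> to \<open>s x\<close> does not enlarge it.\<close>
  have sat: "b \<in> ?ann x" if b: "b \<in> carrier R" and s: "s \<in> carrier R - \<pp>" and bs: "b \<otimes> s \<in> ?ann x" for b s
  proof -
    have "?ann (s \<odot>\<^bsub>E\<^esub> x) \<subseteq> \<pp>"
    proof
      fix c assume c: "c \<in> ?ann (s \<odot>\<^bsub>E\<^esub> x)"
      then have cc: "c \<in> carrier R" by (simp add: annihilator_def)
      then have "c \<otimes> s \<in> \<pp>" using c annD[of c s] s r(2) by (auto simp: x_def)
      then show "c \<in> \<pp>" using p.I_prime[OF cc] s by auto
    qed
    then have "?ann (s \<odot>\<^bsub>E\<^esub> x) = ?ann x" using max' s by auto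
    then show ?thesis using bs annD b s by auto
  qed
  have "a \<in> ?ann x" if a: "a \<in> \<pp>" for a
  proof -
    have ac: "a \<in> carrier R" using a by auto
    obtain n s where s: "s \<in> carrier R - \<pp>" "(s \<otimes> a [^] (n::nat)) \<odot>\<^bsub>E\<^esub> e = \<zero>\<^bsub>E\<^esub>"
      using pow[OF a] by blast
    have "(a [^] n \<otimes> s) \<odot>\<^bsub>E\<^esub> x = r \<odot>\<^bsub>E\<^esub> ((s \<otimes> a [^] n) \<odot>\<^bsub>E\<^esub> e)"
      using s(1) ac r e unfolding x_def by (simp add: E.smult_assoc1[symmetric] m_ac)
    then have "a [^] n \<otimes> s \<in> ?ann x" using s ac r by (simp add: annihilator_def)
    then have "a [^] n \<in> ?ann x" using sat s ac by simp
    then have ex: "\<exists>n::nat. a [^] n \<in> ?ann x" ..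
    \<comment> \<open>Let \<open>k = Suc j\<close> be the least exponent for which the power of
      \<open>a\<close> kills \<open>x\<close>. By saturation the annihilator of
      \<open>a [^] j\<close> times \<open>x\<close> is inside \<open>\<pp>\<close>, so it equals
      that of \<open>x\<close>; it contains \<open>a\<close>.\<close>
    define k where "k = (LEAST n::nat. a [^] n \<in> ?ann x)"
    have k: "a [^] k \<in> ?ann x" unfolding k_def by (rule LeastI_ex[OF ex])
    have "k \<noteq> 0"
    proof
      assume "k = 0"
      then have "\<one> \<in> \<pp>" using k r(2) by (auto simp: x_def)
      then show False using p.one_notin by simp
    qed
    then obtain j where j: "k = Suc j" using not0_implies_Suc by blast
    have nj: "a [^] j \<notin> ?ann x" using not_less_Least[of j "\<lambda>n. a [^] n \<in> ?ann x"] j by (simp add: k_def)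
    have "?ann (a [^] j \<odot>\<^bsub>E\<^esub> x) \<subseteq> \<pp>"
    proof (rule subsetI, rule ccontr)
      fix t assume t: "t \<in> ?ann (a [^] j \<odot>\<^bsub>E\<^esub> x)" and "t \<notin> \<pp>"
      then have tS: "t \<in> carrier R - \<pp>" by (simp add: annihilator_def)
      have "t \<otimes> a [^] j \<in> ?ann x" using t annD[of t "a [^] j"] tS ac by auto
      then have "a [^] j \<otimes> t \<in> ?ann x" using tS ac by (simp add: m_comm)
      then show False using sat[OF _ tS] nj ac by auto
    qed
    then have "?ann (a [^] j \<odot>\<^bsub>E\<^esub> x) = ?ann x" using max' ac by simp
    moreover have "a \<in> ?ann (a [^] j \<odot>\<^bsub>E\<^esub> x)"
      using k ac annD[of a "a [^] j"] by (simp add: j nat_pow_Suc m_comm)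
    ultimately show ?thesis by simp
  qed
  then have "\<pp> = ?ann x" using r(2) by (auto simp: x_def)
  then show ?thesis using p x by (auto simp: Ass_def)
qed


section \<open>Cohomology classes\<close>

text \<open>The coboundaries of degree \<open>i\<close> as plain functions instead of extensional
  ones, so that they are compared with other maps only on the carrier;
  \<open>restrict_mem_Hom_coboundaries_iff\<close> translates back. Degree 0 has only the zero map
  because the complex starts there.\<close>

definition coboundary_maps ::
    "('a, 'm) ring_scheme \<Rightarrow> (nat \<Rightarrow> 'i set) \<Rightarrow> (nat \<Rightarrow> ('i \<Rightarrow> 'a) \<Rightarrow> ('i \<Rightarrow> 'a)) \<Rightarrow>
      ('a, 'c, 'k) module_scheme \<Rightarrow> nat \<Rightarrow> (('i \<Rightarrow> 'a) \<Rightarrow> 'c) set"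
  where "coboundary_maps R X d N i =
    (case i of 0 \<Rightarrow> {\<lambda>f. \<zero>\<^bsub>N\<^esub>}
     | Suc j \<Rightarrow> {\<lambda>f. g (d j f) | g. g \<in> mod_hom R (free_module R (X j)) N})"

lemma free_resolutionD:
  assumes "free_resolution R M X d e"
  shows "e \<in> mod_hom R (free_module R (X 0)) M"
    and "e ` carrier (free_module R (X 0)) = carrier M"
    and "d n \<in> mod_hom R (free_module R (X (Suc n))) (free_module R (X n))"
    and "z \<in> carrier (free_module R (X (Suc 0))) \<Longrightarrow> e (d 0 z) = \<zero>\<^bsub>M\<^esub>"
    and "z \<in> carrier (free_module R (X (Suc (Suc n)))) \<Longrightarrow>
      d n (d (Suc n) z) = \<zero>\<^bsub>free_module R (X n)\<^esub>"
    and "f \<in> carrier (free_module R (X 0)) \<Longrightarrow> e f = \<zero>\<^bsub>M\<^esub> \<Longrightarrow>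
      \<exists>z\<in>carrier (free_module R (X (Suc 0))). f = d 0 z"
    and "f \<in> carrier (free_module R (X (Suc n))) \<Longrightarrow> d n f = \<zero>\<^bsub>free_module R (X n)\<^esub> \<Longrightarrow>
      \<exists>z\<in>carrier (free_module R (X (Suc (Suc n)))). f = d (Suc n) z"
proof -
  note res = assms[unfolded free_resolution_def]
  show "e \<in> mod_hom R (free_module R (X 0)) M"
    and "e ` carrier (free_module R (X 0)) = carrier M"
    and "d n \<in> mod_hom R (free_module R (X (Suc n))) (free_module R (X n))"
    using res by auto
  have im: "d 0 ` carrier (free_module R (X (Suc 0))) =
      {f \<in> carrier (free_module R (X 0)). e f = \<zero>\<^bsub>M\<^esub>}"
    and im': "d (Suc n) ` carrier (free_module R (X (Suc (Suc n)))) =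
      {f \<in> carrier (free_module R (X (Suc n))). d n f = \<zero>\<^bsub>free_module R (X n)\<^esub>}"
    using res by auto
  show "z \<in> carrier (free_module R (X (Suc 0))) \<Longrightarrow> e (d 0 z) = \<zero>\<^bsub>M\<^esub>"
    and "f \<in> carrier (free_module R (X 0)) \<Longrightarrow> e f = \<zero>\<^bsub>M\<^esub> \<Longrightarrow>
      \<exists>z\<in>carrier (free_module R (X (Suc 0))). f = d 0 z"
    using im by blast+
  show "z \<in> carrier (free_module R (X (Suc (Suc n)))) \<Longrightarrow>
      d n (d (Suc n) z) = \<zero>\<^bsub>free_module R (X n)\<^esub>"
    and "f \<in> carrier (free_module R (X (Suc n))) \<Longrightarrow> d n f = \<zero>\<^bsub>free_module R (X n)\<^esub> \<Longrightarrow>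
      \<exists>z\<in>carrier (free_module R (X (Suc (Suc n)))). f = d (Suc n) z"
    using im' by blast+
qed

text \<open>A null-homotopy \<open>h\<close> of multiplication by \<open>c\<close>, seen only on boundaries, where the other half
  \<open>h \<circ> d\<close> of the homotopy formula vanishes.\<close>

lemma annihilator_homotopy:
  assumes M: "Module.module R M" and res: "free_resolution R M X d e"
    and c: "c \<in> carrier R" "\<And>x. x \<in> carrier M \<Longrightarrow> c \<odot>\<^bsub>M\<^esub> x = \<zero>\<^bsub>M\<^esub>"
  shows "\<exists>h\<in>mod_hom R (free_module R (X n)) (free_module R (X (Suc n))).
    \<forall>z\<in>carrier (free_module R (X (Suc n))).
      c \<odot>\<^bsub>free_module R (X n)\<^esub> d n z = d n (h (d n z))"
proof -
  interpret M: Module.module R M by fact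
  define F where "F n = free_module R (X n)" for n
  have F: "Module.module R (F n)" for n
    unfolding F_def by (rule free_module_is_module[OF M.R.is_cring])
  note D = free_resolutionD[OF res, folded F_def]
  have "\<exists>h\<in>mod_hom R (F n) (F (Suc n)).
    \<forall>z\<in>carrier (F (Suc n)). c \<odot>\<^bsub>F n\<^esub> d n z = d n (h (d n z))"
  proof (induction n)
    case 0
    interpret F0: Module.module R "F 0" by (rule F)
    \<comment> \<open>The augmentation kills \<open>c f\<close> because \<open>c\<close> annihilates
      \<open>M\<close>, so \<open>c f\<close> is a boundary by exactness.\<close>
    have "\<exists>y\<in>carrier (F (Suc 0)). c \<odot>\<^bsub>F 0\<^esub> f \<ominus>\<^bsub>F 0\<^esub> d 0 y \<in> {\<zero>\<^bsub>F 0\<^esub>}" if f: "f \<in> carrier (F 0)" for f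
    proof -
      have "e (c \<odot>\<^bsub>F 0\<^esub> f) = \<zero>\<^bsub>M\<^esub>" using mod_homD[OF D(1)] f c by simp
      then obtain y where y: "y \<in> carrier (F (Suc 0))" "c \<odot>\<^bsub>F 0\<^esub> f = d 0 y" using D(6) f c by blast
      then have "c \<odot>\<^bsub>F 0\<^esub> f \<ominus>\<^bsub>F 0\<^esub> d 0 y = \<zero>\<^bsub>F 0\<^esub>"
        using mod_homD(1)[OF D(3) y(1)] by (simp add: F0.r_neg a_minus_def)
      then show ?thesis using y(1) by blast
    qed
    then obtain h where h: "h \<in> mod_hom R (F 0) (F (Suc 0))"
      and eq: "\<And>f. f \<in> carrier (F 0) \<Longrightarrow> c \<odot>\<^bsub>F 0\<^esub> f \<ominus>\<^bsub>F 0\<^esub> d 0 (h f) \<in> {\<zero>\<^bsub>F 0\<^esub>}"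
      using free_module_lift_mod[where R = R and X = "X 0", folded F_def,
          OF F F D(3) F0.smult_mod_hom[OF c(1)] F0.zero_submodule] by blast
    show ?case
      using h eq mod_homD(1)[OF h] mod_homD(1)[OF D(3)] c(1)
      by (intro bexI[OF _ h] ballI) (simp add: F0.minus_eq_zero_iff)
  next
    case (Suc n)
    then obtain h where h: "h \<in> mod_hom R (F n) (F (Suc n))"
      and hd: "\<And>z. z \<in> carrier (F (Suc n)) \<Longrightarrow> c \<odot>\<^bsub>F n\<^esub> d n z = d n (h (d n z))" by blast
    interpret Fn: Module.module R "F n" by (rule F)
    interpret Fm: Module.module R "F (Suc n)" by (rule F)
    \<comment> \<open>\<open>u\<close> is multiplication by \<open>c\<close> minus
      \<open>h \<circ> d n\<close>. By the induction hypothesis its values are cycles, hence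
      boundaries, and lifting it along the next differential gives the next homotopy
      \<open>k\<close>.\<close>
    define u where "u f = c \<odot>\<^bsub>F (Suc n)\<^esub> f \<ominus>\<^bsub>F (Suc n)\<^esub> h (d n f)" for f
    have u: "u \<in> mod_hom R (F (Suc n)) (F (Suc n))"
      unfolding u_def by (rule mod_hom_minus[OF F Fm.smult_mod_hom[OF c(1)] mod_hom_comp[OF D(3) h]])
    have "\<exists>y\<in>carrier (F (Suc (Suc n))). u f \<ominus>\<^bsub>F (Suc n)\<^esub> d (Suc n) y \<in> {\<zero>\<^bsub>F (Suc n)\<^esub>}"
      if f: "f \<in> carrier (F (Suc n))" for f
    proof -
      have hc: "h (d n f) \<in> carrier (F (Suc n))" using mod_homD(1)[OF h] mod_homD(1)[OF D(3)] f by blast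
      have "u f \<oplus>\<^bsub>F (Suc n)\<^esub> h (d n f) = c \<odot>\<^bsub>F (Suc n)\<^esub> f"
        using hc f c(1) by (simp add: u_def a_minus_def Fm.a_assoc Fm.l_neg)
      then have "d n (u f) \<oplus>\<^bsub>F n\<^esub> d n (h (d n f)) = c \<odot>\<^bsub>F n\<^esub> d n f"
        using mod_homD(2)[OF D(3) mod_homD(1)[OF u f] hc] mod_homD(3)[OF D(3) c(1) f] by simp
      then have "d n (u f) = \<zero>\<^bsub>F n\<^esub>"
        using hd[OF f] mod_homD(1)[OF D(3)] mod_homD(1)[OF u f] hc
        by (metis Fn.add.r_cancel_one)
      then obtain y where y: "y \<in> carrier (F (Suc (Suc n)))" "u f = d (Suc n) y"
        using D(7) mod_homD(1)[OF u f] by blast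
      then have "u f \<ominus>\<^bsub>F (Suc n)\<^esub> d (Suc n) y = \<zero>\<^bsub>F (Suc n)\<^esub>"
        using mod_homD(1)[OF D(3) y(1)] by (simp add: Fm.r_neg a_minus_def)
      then show ?thesis using y(1) by blast
    qed
    then obtain k where k: "k \<in> mod_hom R (F (Suc n)) (F (Suc (Suc n)))"
      and eq: "\<And>f. f \<in> carrier (F (Suc n)) \<Longrightarrow> u f \<ominus>\<^bsub>F (Suc n)\<^esub> d (Suc n) (k f) \<in> {\<zero>\<^bsub>F (Suc n)\<^esub>}"
      using free_module_lift_mod[where R = R and X = "X (Suc n)", folded F_def,
          OF F F D(3) u Fm.zero_submodule] by blast
    have "c \<odot>\<^bsub>F (Suc n)\<^esub> d (Suc n) z = d (Suc n) (k (d (Suc n) z))" if z: "z \<in> carrier (F (Suc (Suc n)))" for z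
    proof -
      let ?f = "d (Suc n) z"
      have f: "?f \<in> carrier (F (Suc n))" using mod_homD(1)[OF D(3) z] .
      have "h (d n ?f) = \<zero>\<^bsub>F (Suc n)\<^esub>" using D(5)[OF z] mod_hom_zero[OF F F h] by simp
      then have "u ?f = c \<odot>\<^bsub>F (Suc n)\<^esub> ?f" using f c(1) by (simp add: u_def a_minus_def)
      then show ?thesis
        using eq[OF f] f c(1) mod_homD(1)[OF D(3)] mod_homD(1)[OF k]
        by (simp add: Fm.minus_eq_zero_iff)
    qed
    with k show ?case by blast
  qed
  then show ?thesis by (simp add: F_def)
qed

text \<open>With the homotopy \<open>h\<close>, the map \<open>c - h \<circ> d\<close> takes values
  in boundaries, on which the cocycle \<open>\<phi>\<close> vanishes, so \<open>c \<phi>\<close>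
  equals the coboundary \<open>\<phi> \<circ> h \<circ> d\<close>. In degree 0 already
  \<open>c f\<close> is a boundary, and \<open>c \<phi>\<close> is zero.\<close>

lemma annihilator_kills_cohomology:
  assumes M: "Module.module R M" and N: "Module.module R N" and res: "free_resolution R M X d e"
    and c: "c \<in> carrier R" "\<And>x. x \<in> carrier M \<Longrightarrow> c \<odot>\<^bsub>M\<^esub> x = \<zero>\<^bsub>M\<^esub>"
    and \<phi>: "\<phi> \<in> mod_hom R (free_module R (X i)) N"
    and cocycle: "\<And>z. z \<in> carrier (free_module R (X (Suc i))) \<Longrightarrow> \<phi> (d i z) = \<zero>\<^bsub>N\<^esub>"
  shows "\<exists>\<gamma>\<in>coboundary_maps R X d N i. \<forall>f\<in>carrier (free_module R (X i)). c \<odot>\<^bsub>N\<^esub> \<phi> f = \<gamma> f"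
proof -
  interpret M: Module.module R M by fact
  interpret N: Module.module R N by fact
  define F where "F n = free_module R (X n)" for n
  have F: "Module.module R (F n)" for n
    unfolding F_def by (rule free_module_is_module[OF M.R.is_cring])
  note D = free_resolutionD[OF res, folded F_def] and \<phi> = \<phi>[folded F_def] and cocycle = cocycle[folded F_def]
  show ?thesis unfolding F_def[symmetric]
  proof (cases i)
    case 0
    have "c \<odot>\<^bsub>N\<^esub> \<phi> f = \<zero>\<^bsub>N\<^esub>" if f: "f \<in> carrier (F i)" for f
    proof -
      interpret F0: Module.module R "F 0" by (rule F)
      have "e (c \<odot>\<^bsub>F 0\<^esub> f) = \<zero>\<^bsub>M\<^esub>" using mod_homD[OF D(1)] f c 0 by simp
      then obtain y where "y \<in> carrier (F (Suc 0))" "c \<odot>\<^bsub>F 0\<^esub> f = d 0 y" using D(6) f c 0 by blast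
      then show ?thesis using cocycle mod_homD(3)[OF \<phi> c(1) f] 0 by simp
    qed
    then show "\<exists>\<gamma>\<in>coboundary_maps R X d N i. \<forall>f\<in>carrier (F i). c \<odot>\<^bsub>N\<^esub> \<phi> f = \<gamma> f"
      by (simp add: 0 coboundary_maps_def)
  next
    case (Suc n)
    interpret Fn: Module.module R "F n" by (rule F)
    interpret Fm: Module.module R "F (Suc n)" by (rule F)
    obtain h where h: "h \<in> mod_hom R (F n) (F (Suc n))"
      and hd: "\<And>z. z \<in> carrier (F (Suc n)) \<Longrightarrow> c \<odot>\<^bsub>F n\<^esub> d n z = d n (h (d n z))"
      using annihilator_homotopy[OF M res c, folded F_def] by blast
    have "c \<odot>\<^bsub>N\<^esub> \<phi> f = \<phi> (h (d n f))" if f: "f \<in> carrier (F (Suc n))" for f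
    proof -
      let ?u = "c \<odot>\<^bsub>F (Suc n)\<^esub> f \<ominus>\<^bsub>F (Suc n)\<^esub> h (d n f)"
      have hc: "h (d n f) \<in> carrier (F (Suc n))" using mod_homD(1)[OF h] mod_homD(1)[OF D(3)] f by blast
      have u: "?u \<in> carrier (F (Suc n))" using hc f c(1) by simp
      have sum: "?u \<oplus>\<^bsub>F (Suc n)\<^esub> h (d n f) = c \<odot>\<^bsub>F (Suc n)\<^esub> f"
        using hc f c(1) by (simp add: a_minus_def Fm.a_assoc Fm.l_neg)
      then have "d n ?u \<oplus>\<^bsub>F n\<^esub> d n (h (d n f)) = c \<odot>\<^bsub>F n\<^esub> d n f"
        using mod_homD(2)[OF D(3) u hc] mod_homD(3)[OF D(3) c(1) f] by simp
      then have "d n ?u = \<zero>\<^bsub>F n\<^esub>"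
        using hd[OF f] mod_homD(1)[OF D(3)] u hc by (metis Fn.add.r_cancel_one)
      then obtain y where "y \<in> carrier (F (Suc (Suc n)))" "?u = d (Suc n) y"
        using D(7) u by blast
      then have "\<phi> ?u = \<zero>\<^bsub>N\<^esub>" using cocycle Suc by simp
      moreover have "\<phi> ?u \<oplus>\<^bsub>N\<^esub> \<phi> (h (d n f)) = c \<odot>\<^bsub>N\<^esub> \<phi> f"
        using sum mod_homD(2)[OF \<phi>[unfolded Suc] u hc] mod_homD(3)[OF \<phi>[unfolded Suc] c(1) f] by simp
      ultimately show ?thesis using mod_homD(1)[OF \<phi>[unfolded Suc] hc] by simp
    qed
    moreover have "(\<lambda>f. \<phi> (h (d n f))) \<in> coboundary_maps R X d N i"
      using mod_hom_comp[OF h \<phi>[unfolded Suc]] unfolding Suc coboundary_maps_def F_def by auto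
    ultimately show "\<exists>\<gamma>\<in>coboundary_maps R X d N i. \<forall>f\<in>carrier (F i). c \<odot>\<^bsub>N\<^esub> \<phi> f = \<gamma> f"
      by (intro bexI[of _ "\<lambda>f. \<phi> (h (d n f))"]) (simp_all add: Suc)
  qed
qed

section \<open>Cocycles given as maps and their classes in the cohomology module\<close>

lemma quotient_module_smult_eq_zero_iff:
  assumes M: "Module.module R M" and H: "submodule H R M" and r: "r \<in> carrier R" and x: "x \<in> carrier M"
  shows "r \<odot>\<^bsub>quotient_module M H\<^esub> (H +>\<^bsub>M\<^esub> x) = H \<longleftrightarrow> r \<odot>\<^bsub>M\<^esub> x \<in> H"
proof -
  interpret Module.module R M by fact
  note E = submoduleE[OF H]
  have Hc: "h \<in> carrier M" if "h \<in> H" for h using E(1) that by blast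
  note z = submodule_zero[OF H]
  have eq: "r \<odot>\<^bsub>quotient_module M H\<^esub> (H +>\<^bsub>M\<^esub> x) = {h \<oplus>\<^bsub>M\<^esub> r \<odot>\<^bsub>M\<^esub> (k \<oplus>\<^bsub>M\<^esub> x) | h k. h \<in> H \<and> k \<in> H}"
    by (auto simp: quotient_module_def set_add_def' a_r_coset_def')
  show ?thesis
  proof
    assume "r \<odot>\<^bsub>quotient_module M H\<^esub> (H +>\<^bsub>M\<^esub> x) = H"
    moreover have "\<zero>\<^bsub>M\<^esub> \<oplus>\<^bsub>M\<^esub> r \<odot>\<^bsub>M\<^esub> (\<zero>\<^bsub>M\<^esub> \<oplus>\<^bsub>M\<^esub> x) \<in> r \<odot>\<^bsub>quotient_module M H\<^esub> (H +>\<^bsub>M\<^esub> x)"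
      unfolding eq using z by blast
    ultimately show "r \<odot>\<^bsub>M\<^esub> x \<in> H" using r x by simp
  next
    assume rx: "r \<odot>\<^bsub>M\<^esub> x \<in> H"
    show "r \<odot>\<^bsub>quotient_module M H\<^esub> (H +>\<^bsub>M\<^esub> x) = H"
      unfolding eq
    proof (intro equalityI subsetI)
      fix y assume "y \<in> {h \<oplus>\<^bsub>M\<^esub> r \<odot>\<^bsub>M\<^esub> (k \<oplus>\<^bsub>M\<^esub> x) | h k. h \<in> H \<and> k \<in> H}"
      then show "y \<in> H" using r x rx Hc E(4,5) by (auto simp: smult_r_distr)
    next
      fix y assume y: "y \<in> H"
      have "y = (y \<ominus>\<^bsub>M\<^esub> r \<odot>\<^bsub>M\<^esub> x) \<oplus>\<^bsub>M\<^esub> r \<odot>\<^bsub>M\<^esub> (\<zero>\<^bsub>M\<^esub> \<oplus>\<^bsub>M\<^esub> x)"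
        using Hc[OF y] r x by (simp add: a_minus_def a_assoc l_neg)
      then show "y \<in> {h \<oplus>\<^bsub>M\<^esub> r \<odot>\<^bsub>M\<^esub> (k \<oplus>\<^bsub>M\<^esub> x) | h k. h \<in> H \<and> k \<in> H}"
        using submodule_minus[OF H y rx] z by blast
    qed
  qed
qed

lemma restrict_mod_hom_Hom_module:
  assumes "Module.module R M" and "\<phi> \<in> mod_hom R M N"
  shows "restrict \<phi> (carrier M) \<in> carrier (Hom_module R M N)"
proof -
  interpret Module.module R M by fact
  show ?thesis using assms(2) by (auto simp: Hom_module_simps mod_hom_def Pi_def)
qed

lemma restrict_mem_Hom_coboundaries_iff:
  assumes R: "cring R" and res: "free_resolution R M X d e"
  shows "restrict \<psi> (carrier (free_module R (X i))) \<in> Hom_coboundaries R X d N i \<longleftrightarrow>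
    (\<exists>\<gamma>\<in>coboundary_maps R X d N i. \<forall>f\<in>carrier (free_module R (X i)). \<psi> f = \<gamma> f)"
proof (cases i)
  case 0
  then show ?thesis
    by (auto simp: Hom_module_simps coboundary_maps_def restrict_def fun_eq_iff)
next
  case (Suc j)
  have F: "Module.module R (free_module R (X j))" by (rule free_module_is_module[OF R])
  let ?F = "carrier (free_module R (X (Suc j)))"
  have d: "d j f \<in> carrier (free_module R (X j))" if "f \<in> ?F" for f
    using mod_homD(1)[OF free_resolutionD(3)[OF res] that] .
  show ?thesis
  proof
    assume "restrict \<psi> (carrier (free_module R (X i))) \<in> Hom_coboundaries R X d N i"
    then obtain g where g: "g \<in> mod_hom R (free_module R (X j)) N"
      and eq: "restrict \<psi> ?F = compose ?F g (d j)"
      by (auto simp: Suc Hom_module_simps)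
    have "\<psi> f = g (d j f)" if "f \<in> ?F" for f
      using fun_cong[OF eq, of f] that by (simp add: compose_def)
    then show "\<exists>\<gamma>\<in>coboundary_maps R X d N i. \<forall>f\<in>carrier (free_module R (X i)). \<psi> f = \<gamma> f"
      using g by (auto simp: Suc coboundary_maps_def)
  next
    assume "\<exists>\<gamma>\<in>coboundary_maps R X d N i. \<forall>f\<in>carrier (free_module R (X i)). \<psi> f = \<gamma> f"
    then obtain g where g: "g \<in> mod_hom R (free_module R (X j)) N"
      and eq: "\<And>f. f \<in> ?F \<Longrightarrow> \<psi> f = g (d j f)"
      by (auto simp: Suc coboundary_maps_def)
    have "restrict \<psi> ?F = compose ?F (restrict g (carrier (free_module R (X j)))) (d j)"
      using eq d by (auto simp: compose_def fun_eq_iff)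
    then show "restrict \<psi> (carrier (free_module R (X i))) \<in> Hom_coboundaries R X d N i"
      using restrict_mod_hom_Hom_module[OF F g] by (auto simp: Suc)
  qed
qed

lemma Hom_coboundaries_submodule:
  assumes N: "Module.module R N" and res: "free_resolution R M X d e"
  shows "submodule (Hom_coboundaries R X d N i) R (Hom_module R (free_module R (X i)) N)"
proof -
  interpret N: Module.module R N by fact
  have F: "Module.module R (free_module R (X n))" for n by (rule free_module_is_module[OF N.R.is_cring])
  show ?thesis
  proof (cases i)
    case 0
    then show ?thesis using module.zero_submodule[OF Hom_module_is_module[OF F N]] by simp
  next
    case (Suc j)
    show ?thesis unfolding Suc Hom_coboundaries.simps
      by (rule mod_hom_image_submodule[OF Hom_module_is_module[OF F N] Hom_module_is_module[OF F N]
            compose_mod_hom[OF F free_resolutionD(3)[OF res]]])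
  qed
qed

text \<open>Bridge from cocycles given as plain maps to elements of the cohomology module; it
  reduces the annihilator of a class to pointwise equations.\<close>

lemma cohomology_class_exists:
  assumes N: "Module.module R N" and res: "free_resolution R M X d e"
    and \<phi>: "\<phi> \<in> mod_hom R (free_module R (X i)) N"
    and cocycle: "\<And>z. z \<in> carrier (free_module R (X (Suc i))) \<Longrightarrow> \<phi> (d i z) = \<zero>\<^bsub>N\<^esub>"
  obtains c where "c \<in> carrier (Hom_cohomology R X d N i)"
    and "\<And>r. r \<in> carrier R \<Longrightarrow>
      r \<odot>\<^bsub>Hom_cohomology R X d N i\<^esub> c = \<zero>\<^bsub>Hom_cohomology R X d N i\<^esub> \<longleftrightarrow>
      (\<exists>\<gamma>\<in>coboundary_maps R X d N i. \<forall>f\<in>carrier (free_module R (X i)). r \<odot>\<^bsub>N\<^esub> \<phi> f = \<gamma> f)"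
proof -
  interpret N: Module.module R N by fact
  have F: "Module.module R (free_module R (X n))" for n by (rule free_module_is_module[OF N.R.is_cring])
  let ?F = "carrier (free_module R (X i))" and ?C = "Hom_module R (free_module R (X i)) N"
    and ?B = "Hom_coboundaries R X d N i" and ?E = "Hom_cohomology R X d N i"
  define \<psi> where "\<psi> = restrict \<phi> ?F"
  have \<psi>: "\<psi> \<in> carrier ?C" unfolding \<psi>_def by (rule restrict_mod_hom_Hom_module[OF F \<phi>])
  have "\<psi> (d i z) = \<zero>\<^bsub>N\<^esub>" if "z \<in> carrier (free_module R (X (Suc i)))" for z
    using cocycle that mod_homD(1)[OF free_resolutionD(3)[OF res] that] by (simp add: \<psi>_def)
  then have Z: "\<psi> \<in> Hom_cocycles R X d N i"
    using \<psi> by (auto simp: Hom_cocycles_def Hom_module_simps(2) compose_def fun_eq_iff)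
  define c where "c = ?B +>\<^bsub>?C\<^esub> \<psi>"
  have "c \<in> carrier ?E"
    using Z by (auto simp: c_def Hom_cohomology_def quotient_module_def A_RCOSETS_def' a_r_coset_def')
  moreover have "r \<odot>\<^bsub>?E\<^esub> c = \<zero>\<^bsub>?E\<^esub> \<longleftrightarrow>
      (\<exists>\<gamma>\<in>coboundary_maps R X d N i. \<forall>f\<in>?F. r \<odot>\<^bsub>N\<^esub> \<phi> f = \<gamma> f)" if r: "r \<in> carrier R" for r
  proof -
    \<comment> \<open>Cutting the carrier of \<open>?C\<close> down to the cocycles affects neither
      scalar multiplication nor zero of the quotient.\<close>
    have "r \<odot>\<^bsub>?E\<^esub> c = r \<odot>\<^bsub>quotient_module ?C ?B\<^esub> (?B +>\<^bsub>?C\<^esub> \<psi>)" and zero: "\<zero>\<^bsub>?E\<^esub> = ?B"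
      by (simp_all add: c_def Hom_cohomology_def quotient_module_def set_add_def' a_r_coset_def')
    then have "r \<odot>\<^bsub>?E\<^esub> c = \<zero>\<^bsub>?E\<^esub> \<longleftrightarrow> r \<odot>\<^bsub>?C\<^esub> \<psi> \<in> ?B"
      using quotient_module_smult_eq_zero_iff[OF Hom_module_is_module[OF F N]
          Hom_coboundaries_submodule[OF N res] r \<psi>] by simp
    also have "r \<odot>\<^bsub>?C\<^esub> \<psi> = restrict (\<lambda>f. r \<odot>\<^bsub>N\<^esub> \<phi> f) ?F"
      by (auto simp: Hom_module_simps(4) \<psi>_def)
    finally show ?thesis unfolding restrict_mem_Hom_coboundaries_iff[OF N.R.is_cring res] .
  qed
  ultimately show thesis by (rule that)
qed


section \<open>Vanishing at a prime\<close>

text \<open>Says that all \<open>Ext\<^sup>i(M, R/I)\<close> vanish at \<open>\<pp>\<close>, where \<open>(X, d)\<close> resolves \<open>M\<close>; a cochain with values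
  in \<open>R/I\<close> is represented by a lift with values in \<open>R\<close>, which exists as the \<open>F\<^sub>i\<close> are free.\<close>

definition locally_acyclic_mod ::
    "('a, 'm) ring_scheme \<Rightarrow> (nat \<Rightarrow> 'i set) \<Rightarrow> (nat \<Rightarrow> ('i \<Rightarrow> 'a) \<Rightarrow> ('i \<Rightarrow> 'a)) \<Rightarrow>
      'a set \<Rightarrow> 'a set \<Rightarrow> bool"
  where "locally_acyclic_mod R X d \<pp> I \<longleftrightarrow>
    (\<forall>i. \<forall>\<phi>\<in>mod_hom R (free_module R (X i)) (regular_module R).
      (\<forall>z\<in>carrier (free_module R (X (Suc i))). \<phi> (d i z) \<in> I) \<longrightarrow>
      (\<exists>s\<in>carrier R - \<pp>. \<exists>\<gamma>\<in>coboundary_maps R X d (regular_module R) i.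
        \<forall>f\<in>carrier (free_module R (X i)). s \<otimes>\<^bsub>R\<^esub> \<phi> f \<ominus>\<^bsub>R\<^esub> \<gamma> f \<in> I))"

lemma coboundary_maps_closed:
  assumes "Module.module R N" and "free_resolution R M X d e"
    and "\<gamma> \<in> coboundary_maps R X d N i" and "f \<in> carrier (free_module R (X i))"
  shows "\<gamma> f \<in> carrier N"
proof -
  interpret Module.module R N by fact
  show ?thesis
    using assms(3,4) mod_homD(1)[OF free_resolutionD(3)[OF assms(2)]]
    by (cases i) (auto simp: coboundary_maps_def mod_homD(1))
qed

text \<open>The long exact sequence of \<open>0 \<rightarrow> R/I \<rightarrow> R/I \<rightarrow> R/(I + x) \<rightarrow> 0\<close>, localized at \<open>\<pp>\<close>.\<close>

lemma (in noetherian_cring) locally_acyclic_mod_insert: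
  assumes res: "free_resolution R M X d e"
    and p: "primeideal \<pp> R" and I: "ideal I R" and x: "x \<in> carrier R"
    and reg: "\<And>r. r \<in> carrier R \<Longrightarrow> x \<otimes> r \<in> I \<Longrightarrow> \<exists>s\<in>carrier R - \<pp>. s \<otimes> r \<in> I"
    and acyc: "locally_acyclic_mod R X d \<pp> I"
  shows "locally_acyclic_mod R X d \<pp> {z \<in> carrier R. \<exists>b\<in>carrier R. z \<ominus> x \<otimes> b \<in> I}"
    (is "locally_acyclic_mod R X d \<pp> ?J")
  unfolding locally_acyclic_mod_def
proof (intro allI ballI impI)
  interpret p: primeideal \<pp> R by fact
  interpret I: ideal I R by fact
  let ?R = "regular_module R"
  have reg_mod: "Module.module R ?R" by (rule regular_module_is_module[OF is_cring])
  interpret N: Module.module R ?R by (rule reg_mod)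
  define F where "F n = free_module R (X n)" for n
  have F: "Module.module R (F n)" for n
    unfolding F_def by (rule free_module_is_module[OF is_cring])
  note D = free_resolutionD[OF res, folded F_def]
  have acyc: "\<exists>s\<in>carrier R - \<pp>. \<exists>\<gamma>\<in>coboundary_maps R X d ?R i.
      \<forall>f\<in>carrier (F i). s \<otimes> \<psi> f \<ominus> \<gamma> f \<in> I"
    if "\<psi> \<in> mod_hom R (F i) ?R" "\<And>z. z \<in> carrier (F (Suc i)) \<Longrightarrow> \<psi> (d i z) \<in> I" for i \<psi>
    using acyc that unfolding locally_acyclic_mod_def F_def by blast
  fix i \<phi> assume "\<phi> \<in> mod_hom R (free_module R (X i)) ?R"
    and "\<forall>z\<in>carrier (free_module R (X (Suc i))). \<phi> (d i z) \<in> ?J"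
  then have \<phi>: "\<phi> \<in> mod_hom R (F i) ?R"
    and J: "\<And>z. z \<in> carrier (F (Suc i)) \<Longrightarrow> \<exists>b\<in>carrier R. \<phi> (d i z) \<ominus> x \<otimes> b \<in> I"
    unfolding F_def by auto
  have \<phi>c: "\<phi> f \<in> carrier R" if "f \<in> carrier (F i)" for f using mod_homD(1)[OF \<phi> that] by simp
  have mult: "(\<lambda>r. a \<otimes> r) \<in> mod_hom R ?R ?R" if "a \<in> carrier R" for a
    using N.smult_mod_hom[OF that] by (simp add: mod_hom_def)
  \<comment> \<open>On boundaries \<open>\<phi>\<close> is a multiple of \<open>x\<close> modulo
    \<open>I\<close>. As \<open>F (Suc i)\<close> is free, the coefficients can be chosen as a
    linear map \<open>b\<close>, which represents the image of \<open>\<phi>\<close> under the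
    connecting homomorphism.\<close>
  obtain b where b: "b \<in> mod_hom R (F (Suc i)) ?R"
    and \<phi>b: "\<And>z. z \<in> carrier (F (Suc i)) \<Longrightarrow> \<phi> (d i z) \<ominus> x \<otimes> b z \<in> I"
    using free_module_lift_mod[where R = R and X = "X (Suc i)", folded F_def,
        OF reg_mod reg_mod mult[OF x] mod_hom_comp[OF D(3) \<phi>] ideal_imp_submodule[OF I]] J
    by (simp only: regular_module_simps) blast
  have bc: "b f \<in> carrier R" if "f \<in> carrier (F (Suc i))" for f using mod_homD(1)[OF b that] by simp
  \<comment> \<open>The factor supplied by \<open>reg\<close> depends on the element;
    \<open>s\<close> is a uniform one, which makes \<open>s b\<close> a cocycle modulo
    \<open>I\<close>.\<close>
  obtain s where s: "s \<in> carrier R - \<pp>"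
    and sat: "\<And>r t. r \<in> carrier R \<Longrightarrow> t \<in> carrier R - \<pp> \<Longrightarrow> t \<otimes> r \<in> I \<Longrightarrow> s \<otimes> r \<in> I"
    by (rule saturation_bounded[OF p I]) blast
  have "s \<otimes> b (d (Suc i) w) \<in> I" if w: "w \<in> carrier (F (Suc (Suc i)))" for w
  proof -
    have dw: "d (Suc i) w \<in> carrier (F (Suc i))" by (rule mod_homD(1)[OF D(3) w])
    have "\<phi> (d i (d (Suc i) w)) = \<zero>"
      using D(5)[OF w] mod_hom_zero[OF F reg_mod \<phi>] by simp
    then have "\<zero> \<ominus> x \<otimes> b (d (Suc i) w) \<in> I" using \<phi>b[OF dw] by simp
    then have "\<ominus> (x \<otimes> b (d (Suc i) w)) \<in> I" using x bc[OF dw] by (simp add: minus_eq)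
    then have "x \<otimes> b (d (Suc i) w) \<in> I" using I.a_inv_closed x bc[OF dw] by fastforce
    then show ?thesis using reg bc[OF dw] sat by blast
  qed
  then obtain t \<gamma> where t: "t \<in> carrier R - \<pp>" and \<gamma>: "\<gamma> \<in> coboundary_maps R X d ?R (Suc i)"
    and t\<gamma>: "\<And>f. f \<in> carrier (F (Suc i)) \<Longrightarrow> t \<otimes> (s \<otimes> b f) \<ominus> \<gamma> f \<in> I"
    using acyc[OF mod_hom_comp[OF b mult[of s]]] s by blast
  from \<gamma> obtain c where c: "c \<in> mod_hom R (F i) ?R" and \<gamma>c: "\<gamma> = (\<lambda>f. c (d i f))"
    by (auto simp: coboundary_maps_def F_def)
  have cc: "c f \<in> carrier R" if "f \<in> carrier (F i)" for f using mod_homD(1)[OF c that] by simp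
  have ts: "t \<otimes> s \<in> carrier R" "t \<in> carrier R" "s \<in> carrier R" using s t by auto
  \<comment> \<open>\<open>t s b\<close> agrees with \<open>c \<circ> d i\<close> modulo
    \<open>I\<close>. Hence subtracting \<open>x c\<close> turns \<open>t s \<phi>\<close> into a
    cocycle modulo \<open>I\<close> without changing it modulo \<open>I + (x)\<close>.\<close>
  define \<psi> where "\<psi> f = (t \<otimes> s) \<otimes> \<phi> f \<ominus> x \<otimes> c f" for f
  have \<psi>: "\<psi> \<in> mod_hom R (F i) ?R"
    unfolding \<psi>_def
    using mod_hom_minus[OF reg_mod mod_hom_comp[OF \<phi> mult[OF ts(1)]] mod_hom_comp[OF c mult[OF x]]] by simp
  have "\<psi> (d i z) \<in> I" if z: "z \<in> carrier (F (Suc i))" for z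
  proof -
    have dz: "d i z \<in> carrier (F i)" by (rule mod_homD(1)[OF D(3) z])
    have "(t \<otimes> s) \<otimes> (\<phi> (d i z) \<ominus> x \<otimes> b z) \<oplus> x \<otimes> (t \<otimes> (s \<otimes> b z) \<ominus> c (d i z)) \<in> I"
      using I.I_l_closed[OF \<phi>b[OF z] ts(1)] I.I_l_closed[OF t\<gamma>[OF z] x] unfolding \<gamma>c
      by (rule I.a_closed)
    also have "(t \<otimes> s) \<otimes> (\<phi> (d i z) \<ominus> x \<otimes> b z) \<oplus> x \<otimes> (t \<otimes> (s \<otimes> b z) \<ominus> c (d i z)) = \<psi> (d i z)"
    proof -
      have "x \<otimes> (t \<otimes> (s \<otimes> b z)) = (t \<otimes> s) \<otimes> (x \<otimes> b z)"
        using ts(2,3) x bc[OF z] by (simp add: m_ac)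
      then show ?thesis
        unfolding \<psi>_def using ts x bc[OF z] \<phi>c[OF dz] cc[OF dz]
        by (simp add: minus_eq r_distr r_minus a_assoc r_neg2 r_neg1)
    qed
    finally show ?thesis .
  qed
  then obtain u \<delta> where u: "u \<in> carrier R - \<pp>" and \<delta>: "\<delta> \<in> coboundary_maps R X d ?R i"
    and u\<delta>: "\<And>f. f \<in> carrier (F i) \<Longrightarrow> u \<otimes> \<psi> f \<ominus> \<delta> f \<in> I"
    using acyc[OF \<psi>] by blast
  \<comment> \<open>\<open>\<psi>\<close> differs from \<open>t s \<phi>\<close> by a multiple of
    \<open>x\<close>; the coefficient witnessing membership in \<open>?J\<close> is
    \<open>u \<otimes> c f\<close>.\<close>
  have "(u \<otimes> (t \<otimes> s)) \<otimes> \<phi> f \<ominus> \<delta> f \<in> ?J" if f: "f \<in> carrier (F i)" for f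
  proof -
    have \<delta>c: "\<delta> f \<in> carrier R"
      using coboundary_maps_closed[OF reg_mod res \<delta>] f by (simp add: F_def)
    have uc: "u \<in> carrier R" using u by simp
    have "u \<otimes> \<psi> f \<ominus> \<delta> f = ((u \<otimes> (t \<otimes> s)) \<otimes> \<phi> f \<ominus> \<delta> f) \<ominus> x \<otimes> (u \<otimes> c f)"
      unfolding \<psi>_def using uc ts x \<phi>c[OF f] cc[OF f] \<delta>c
      by (simp add: minus_eq r_distr r_minus a_ac m_assoc m_lcomm[of x u])
    then have "((u \<otimes> (t \<otimes> s)) \<otimes> \<phi> f \<ominus> \<delta> f) \<ominus> x \<otimes> (u \<otimes> c f) \<in> I" using u\<delta>[OF f] by simp
    moreover have "u \<otimes> c f \<in> carrier R" "(u \<otimes> (t \<otimes> s)) \<otimes> \<phi> f \<ominus> \<delta> f \<in> carrier R"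
      using uc ts \<phi>c[OF f] cc[OF f] \<delta>c by simp_all
    ultimately show ?thesis by blast
  qed
  moreover have "u \<otimes> (t \<otimes> s) \<in> carrier R - \<pp>" by (intro p.compl_mult u t s)
  ultimately show "\<exists>s\<in>carrier R - \<pp>. \<exists>\<gamma>\<in>coboundary_maps R X d ?R i.
      \<forall>f\<in>carrier (free_module R (X i)). s \<otimes> \<phi> f \<ominus> \<gamma> f \<in> ?J"
    using \<delta> unfolding F_def[symmetric] by (intro bexI[of _ "u \<otimes> (t \<otimes> s)"] bexI[of _ \<delta>]) auto
qed

text \<open>A composite \<open>M \<rightarrow> R/\<pp> \<rightarrow> R/I\<close> is a class in \<open>Hom(M, R/I)\<close> that does not vanish at \<open>\<pp>\<close>.\<close>

lemma (in noetherian_cring) not_locally_acyclic_mod_if_associated: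
  assumes M: "Module.module R M" and fg: "finitely_generated_module R M"
    and res: "free_resolution R M X d e" and p: "\<pp> \<in> Supp R M" and I: "ideal I R"
    and y: "y \<in> carrier R" "colon R I y = \<pp>"
  shows "\<not> locally_acyclic_mod R X d \<pp> I"
proof
  assume acyc: "locally_acyclic_mod R X d \<pp> I"
  interpret M: Module.module R M by fact
  interpret p: primeideal \<pp> R using p by (simp add: Supp_def)
  let ?R = "regular_module R"
  have reg_mod: "Module.module R ?R" by (rule regular_module_is_module[OF is_cring])
  define F where "F n = free_module R (X n)" for n
  note D = free_resolutionD[OF res, folded F_def]
  obtain W m s where W: "submodule W R M" and m: "m \<in> carrier M" and s: "s \<in> carrier R - \<pp>"
    and gen: "\<And>x. x \<in> carrier M \<Longrightarrow> \<exists>r\<in>carrier R. s \<odot>\<^bsub>M\<^esub> x \<ominus>\<^bsub>M\<^esub> r \<odot>\<^bsub>M\<^esub> m \<in> W"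
    and Wp: "\<And>r. r \<in> carrier R \<Longrightarrow> r \<odot>\<^bsub>M\<^esub> m \<in> W \<Longrightarrow> r \<in> \<pp>"
    by (rule exists_local_cyclic_quotient[OF M fg p]) blast
  have sc: "s \<in> carrier R" using s by simp
  \<comment> \<open>\<open>\<rho> f\<close> is a coordinate of \<open>s\<close> times
    \<open>e f\<close> along \<open>m\<close>, modulo \<open>W\<close>; reduced modulo
    \<open>\<pp>\<close>, it represents the map from \<open>M\<close> to
    \<open>R/\<pp>\<close>.\<close>
  obtain \<rho> where \<rho>: "\<rho> \<in> mod_hom R (F 0) ?R"
    and e\<rho>: "\<And>f. f \<in> carrier (F 0) \<Longrightarrow> s \<odot>\<^bsub>M\<^esub> e f \<ominus>\<^bsub>M\<^esub> \<rho> f \<odot>\<^bsub>M\<^esub> m \<in> W"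
    using free_module_lift_mod[where R = R and X = "X 0", folded F_def, OF reg_mod M
        M.orbit_mod_hom[OF m] mod_hom_comp[OF D(1) M.smult_mod_hom[OF sc]] W]
      gen mod_homD(1)[OF D(1)]
    by (simp only: regular_module_simps) blast
  have \<rho>c: "\<rho> f \<in> carrier R" if "f \<in> carrier (F 0)" for f using mod_homD(1)[OF \<rho> that] by simp
  \<comment> \<open>Multiplication by \<open>y\<close> embeds \<open>R/\<pp>\<close> into
    \<open>R/I\<close>, because \<open>\<pp> = (I : y)\<close>.\<close>
  have y\<rho>: "y \<otimes> \<rho> f \<in> I \<longleftrightarrow> \<rho> f \<in> \<pp>" if f: "f \<in> carrier (F 0)" for f
    using y \<rho>c[OF f] by (auto simp: colon_def m_comm[of y])
  have hom: "(\<lambda>f. y \<otimes> \<rho> f) \<in> mod_hom R (F 0) ?R"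
    using mod_hom_comp[OF \<rho> module.smult_mod_hom[OF reg_mod y(1)]] by simp
  \<comment> \<open>Boundaries die under \<open>e\<close>, so \<open>\<rho>\<close> sends them to
    coefficients \<open>r\<close> with \<open>r m\<close> in \<open>W\<close>, hence into
    \<open>\<pp>\<close>.\<close>
  have "y \<otimes> \<rho> (d 0 z) \<in> I" if z: "z \<in> carrier (F (Suc 0))" for z
  proof -
    have dz: "d 0 z \<in> carrier (F 0)" by (rule mod_homD(1)[OF D(3) z])
    have "\<ominus>\<^bsub>M\<^esub> (\<rho> (d 0 z) \<odot>\<^bsub>M\<^esub> m) \<in> W"
      using e\<rho>[OF dz] D(4)[OF z] sc m \<rho>c[OF dz] by (simp add: M.minus_eq)
    then have "\<ominus>\<^bsub>M\<^esub> (\<ominus>\<^bsub>M\<^esub> (\<rho> (d 0 z) \<odot>\<^bsub>M\<^esub> m)) \<in> W" by (rule M.submoduleE(3)[OF W])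
    then have "\<rho> (d 0 z) \<in> \<pp>" using Wp \<rho>c[OF dz] m by simp
    then show ?thesis using y\<rho>[OF dz] by simp
  qed
  then have "\<exists>t\<in>carrier R - \<pp>. \<exists>\<gamma>\<in>coboundary_maps R X d ?R 0.
      \<forall>f\<in>carrier (F 0). t \<otimes> (y \<otimes> \<rho> f) \<ominus> \<gamma> f \<in> I"
    using acyc[unfolded locally_acyclic_mod_def, folded F_def, rule_format, OF hom] by simp
  then obtain t \<gamma> where t: "t \<in> carrier R - \<pp>" and \<gamma>: "\<gamma> \<in> coboundary_maps R X d ?R 0"
    and t\<gamma>: "\<And>f. f \<in> carrier (F 0) \<Longrightarrow> t \<otimes> (y \<otimes> \<rho> f) \<ominus> \<gamma> f \<in> I"
    by blast
  \<comment> \<open>At a preimage of \<open>m\<close> the value of \<open>\<rho>\<close> is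
    congruent to \<open>s\<close> modulo \<open>\<pp>\<close>. Coboundaries of degree 0 are zero, so
    acyclicity forces this value, and with it \<open>s\<close>, into \<open>\<pp>\<close>.\<close>
  obtain f where f: "f \<in> carrier (F 0)" "e f = m" using D(2) m by (metis imageE)
  have "t \<otimes> (y \<otimes> \<rho> f) \<in> I"
    using t\<gamma>[OF f(1)] \<gamma> t y(1) \<rho>c[OF f(1)] by (simp add: coboundary_maps_def minus_eq)
  moreover have "t \<otimes> (y \<otimes> \<rho> f) = (t \<otimes> \<rho> f) \<otimes> y"
    using t y(1) \<rho>c[OF f(1)] by (simp add: m_ac)
  ultimately have "t \<otimes> \<rho> f \<in> colon R I y"
    using t \<rho>c[OF f(1)] by (simp add: colon_def)
  then have "t \<otimes> \<rho> f \<in> \<pp>" by (simp only: y(2))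
  then have \<rho>p: "\<rho> f \<in> \<pp>" using p.I_prime t \<rho>c[OF f(1)] by blast
  have "(s \<ominus> \<rho> f) \<odot>\<^bsub>M\<^esub> m = s \<odot>\<^bsub>M\<^esub> m \<ominus>\<^bsub>M\<^esub> \<rho> f \<odot>\<^bsub>M\<^esub> m"
    using sc \<rho>c[OF f(1)] m by (simp add: minus_eq M.minus_eq M.smult_l_distr M.smult_l_minus)
  then have "s \<ominus> \<rho> f \<in> \<pp>" using e\<rho>[OF f(1)] f(2) sc \<rho>c[OF f(1)] by (intro Wp) auto
  then have "(s \<ominus> \<rho> f) \<oplus> \<rho> f \<in> \<pp>" using \<rho>p by simp
  then show False using s sc \<rho>c[OF f(1)] by (simp add: minus_eq a_assoc l_neg)
qed

section \<open>Acyclicity at \<open>\<pp>\<close>: excluded by the support, forced if no associated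
  prime occurs\<close>

lemma (in noetherian_cring) not_locally_acyclic_mod_zero:
  assumes M: "Module.module R M" and fg: "finitely_generated_module R M"
    and res: "free_resolution R M X d e" and p: "\<pp> \<in> Supp R M"
  shows "\<not> locally_acyclic_mod R X d \<pp> {\<zero>}"
proof
  assume acyc: "locally_acyclic_mod R X d \<pp> {\<zero>}"
  have pr: "primeideal \<pp> R" using p by (simp add: Supp_def)
  interpret p: primeideal \<pp> R by (rule pr)
  let ?A = "{I. ideal I R \<and> I \<subseteq> \<pp> \<and> locally_acyclic_mod R X d \<pp> I}"
  have "\<exists>I\<in>?A. \<forall>J\<in>?A. I \<subseteq> J \<longrightarrow> J = I"
  proof (rule exists_maximal_ideal)
    have "{\<zero>} \<in> ?A" using acyc zeroideal p.zero_closed by simp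
    then show "?A \<noteq> {}" by blast
  qed blast
  then obtain I where I: "ideal I R" "I \<subseteq> \<pp>" "locally_acyclic_mod R X d \<pp> I"
    and max: "\<And>J. ideal J R \<Longrightarrow> J \<subseteq> \<pp> \<Longrightarrow> locally_acyclic_mod R X d \<pp> J \<Longrightarrow> I \<subseteq> J \<Longrightarrow> J = I"
    by auto
  interpret I: ideal I R by (rule I(1))
  have "\<not> (\<exists>y\<in>carrier R. colon R I y = \<pp>)"
    using not_locally_acyclic_mod_if_associated[OF M fg res p I(1)] I(3) by blast
  then obtain x where x: "x \<in> \<pp>"
    and reg: "\<And>r. r \<in> carrier R \<Longrightarrow> x \<otimes> r \<in> I \<Longrightarrow> \<exists>s\<in>carrier R - \<pp>. s \<otimes> r \<in> I"
    using associated_or_locally_regular[OF pr I(1,2)] by blast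
  have xc: "x \<in> carrier R" using x by auto
  let ?J = "{z \<in> carrier R. \<exists>b\<in>carrier R. z \<ominus> x \<otimes> b \<in> I}"
  have "?J \<subseteq> \<pp>"
  proof
    fix z assume "z \<in> ?J"
    then obtain b where z: "z \<in> carrier R" and b: "b \<in> carrier R" "z \<ominus> x \<otimes> b \<in> I" by auto
    have "(z \<ominus> x \<otimes> b) \<oplus> x \<otimes> b \<in> \<pp>" using b I(2) p.I_r_closed[OF x] by blast
    then show "z \<in> \<pp>" using z b(1) xc by (simp add: minus_eq a_assoc l_neg)
  qed
  moreover have "I \<subseteq> ?J"
  proof
    fix z assume z: "z \<in> I"
    then have "z \<ominus> x \<otimes> \<zero> \<in> I" using I.Icarr xc by (simp add: minus_eq)
    then show "z \<in> ?J" using I.Icarr[OF z] by blast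
  qed
  ultimately have "?J = I"
    by (intro max ideal_insert[OF I(1) xc] locally_acyclic_mod_insert[OF res pr I(1) xc reg I(3)])
  moreover have "x \<ominus> x \<otimes> \<one> \<in> I" using xc by (simp add: minus_eq r_neg)
  then have "x \<in> ?J" using xc by blast
  ultimately have "x \<otimes> \<one> \<in> I" using xc by simp
  \<comment> \<open>By maximality \<open>x\<close> lies in \<open>I\<close>, so regularity applied
    to \<open>\<one>\<close> yields an element of \<open>I\<close> outside
    \<open>\<pp>\<close>.\<close>
  then obtain s where "s \<in> carrier R - \<pp>" "s \<otimes> \<one> \<in> I" using reg by blast
  then show False using I(2) by auto
qed

text \<open>For each \<open>a\<close> in \<open>\<pp>\<close>, some power of \<open>a\<close> times
  a factor outside \<open>\<pp>\<close> annihilates \<open>M\<close>, hence also the class of the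
  cocycle. If the annihilator of this class were inside \<open>\<pp>\<close>, then
  \<open>\<pp>\<close> would be associated; so some \<open>s\<close> outside \<open>\<pp>\<close>
  kills the class.\<close>

lemma (in noetherian_cring) locally_acyclic_mod_zero_if_not_Ass:
  assumes M: "Module.module R M" and fg: "finitely_generated_module R M"
    and res: "free_resolution R M X d e" and p: "\<pp> \<in> min_Supp R M"
    and not_Ass: "\<And>i. \<pp> \<notin> Ass R (Hom_cohomology R X d (regular_module R) i)"
  shows "locally_acyclic_mod R X d \<pp> {\<zero>}"
  unfolding locally_acyclic_mod_def
proof (intro allI ballI impI)
  let ?R = "regular_module R"
  have reg_mod: "Module.module R ?R" by (rule regular_module_is_module[OF is_cring])
  have pr: "primeideal \<pp> R" using p by (simp add: min_Supp_def Supp_def)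
  interpret p: primeideal \<pp> R by (rule pr)
  fix i \<phi> assume \<phi>: "\<phi> \<in> mod_hom R (free_module R (X i)) ?R"
    and coc: "\<forall>z\<in>carrier (free_module R (X (Suc i))). \<phi> (d i z) \<in> {\<zero>}"
  let ?E = "Hom_cohomology R X d ?R i" and ?F = "carrier (free_module R (X i))"
  have coc': "\<phi> (d i z) = \<zero>\<^bsub>?R\<^esub>" if "z \<in> carrier (free_module R (X (Suc i)))" for z
    using coc that by simp
  obtain c where c: "c \<in> carrier ?E"
    and zero: "\<And>r. r \<in> carrier R \<Longrightarrow> r \<odot>\<^bsub>?E\<^esub> c = \<zero>\<^bsub>?E\<^esub> \<longleftrightarrow>
      (\<exists>\<gamma>\<in>coboundary_maps R X d ?R i. \<forall>f\<in>?F. r \<odot>\<^bsub>?R\<^esub> \<phi> f = \<gamma> f)"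
    by (rule cohomology_class_exists[OF reg_mod res \<phi> coc']) (assumption | blast)+
  have "\<exists>n. \<exists>s\<in>carrier R - \<pp>. (s \<otimes> a [^] (n::nat)) \<odot>\<^bsub>?E\<^esub> c = \<zero>\<^bsub>?E\<^esub>" if a: "a \<in> \<pp>" for a
  proof -
    obtain n s where s: "s \<in> carrier R - \<pp>" "\<forall>x\<in>carrier M. (s \<otimes> a [^] (n::nat)) \<odot>\<^bsub>M\<^esub> x = \<zero>\<^bsub>M\<^esub>"
      using min_Supp_power_annihilates[OF M fg p a] by blast
    have sa: "s \<otimes> a [^] n \<in> carrier R" using s a by auto
    have "(s \<otimes> a [^] n) \<odot>\<^bsub>?E\<^esub> c = \<zero>\<^bsub>?E\<^esub>"
      unfolding zero[OF sa] using s(2)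
      by (intro annihilator_kills_cohomology[OF M reg_mod res sa _ \<phi> coc']) auto
    then show ?thesis using s(1) by blast
  qed
  then have "\<not> annihilator R ?E c \<subseteq> \<pp>"
    using mem_Ass_if_power_torsion[OF Hom_cohomology_is_module[OF M reg_mod res] pr c] not_Ass by blast
  then obtain s where s: "s \<in> carrier R - \<pp>" "s \<odot>\<^bsub>?E\<^esub> c = \<zero>\<^bsub>?E\<^esub>"
    by (auto simp: annihilator_def)
  then obtain \<gamma> where \<gamma>: "\<gamma> \<in> coboundary_maps R X d ?R i" "\<forall>f\<in>?F. s \<otimes> \<phi> f = \<gamma> f"
    using zero[of s] by auto
  have "s \<otimes> \<phi> f \<ominus> \<gamma> f \<in> {\<zero>}" if f: "f \<in> ?F" for f
    using \<gamma>(2) f coboundary_maps_closed[OF reg_mod res \<gamma>(1) f] by (simp add: minus_eq r_neg)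
  then show "\<exists>s\<in>carrier R - \<pp>. \<exists>\<gamma>\<in>coboundary_maps R X d ?R i.
      \<forall>f\<in>?F. s \<otimes> \<phi> f \<ominus> \<gamma> f \<in> {\<zero>}"
    using s(1) \<gamma>(1) by blast
qed

theorem corollary1p4:
  fixes R :: "('a, 'm) ring_scheme" and M :: "('a, 'b, 'n) module_scheme"
  assumes "cring R" and "noetherian_ring R" and "local_ring R"
    and "module R M" and "finitely_generated_module R M"
  shows "min_Supp R M \<subseteq> (\<Union>i::nat. Ass R (Ext R i M (regular_module R)))"
proof (rule subsetI, rule ccontr)
  interpret noetherian_cring R using assms(1,2) by (simp add: noetherian_cring_def)
  fix \<pp> assume p: "\<pp> \<in> min_Supp R M"
    and "\<pp> \<notin> (\<Union>i::nat. Ass R (Ext R i M (regular_module R)))"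
  \<comment> \<open>\<open>Ext\<close> is by definition the cohomology computed from this
    resolution, so the statements about \<open>Hom_cohomology\<close> apply to it directly.\<close>
  moreover obtain X d where Xd: "chosen_resolution R M = (X, d)" by fastforce
  moreover obtain e where res: "free_resolution R M X d e"
    using chosen_resolution[OF assms(4) Xd] by blast
  ultimately have "locally_acyclic_mod R X d \<pp> {\<zero>\<^bsub>R\<^esub>}"
    using assms(4,5) by (intro locally_acyclic_mod_zero_if_not_Ass) (auto simp: Ext_def)
  then show False
    using not_locally_acyclic_mod_zero[OF assms(4,5) res] p by (auto simp: min_Supp_def)
qed

end
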